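(* Let $Q$ be a finite acyclic quiver and $C$ a set of vertices of $\mathbb{Z}Q$ satisfying the exactness assumption (E) of the context. Let $M$ be a finite-dimensional $\mathcal{S}_C$-module such that $K_{LR}(M)$ is rigid, i.e. $\mathrm{Ext}^1(K_{LR}(M),K_{LR}(M))=0$ in $\mathrm{Mod}(\mathcal{R}_C)$. Let $(v,w)$ be a dimension vector of $\mathcal{R}_C$ and let $\pi_{v,w}:\mathrm{Gr}_{(v,w)}(K_{LR}(M))\to\mathrm{Gr}_w(M)$ be the map taking a submodule to its restriction to $\mathcal{S}_C$. Then the fibre of $\pi_{v,w}$ over a submodule $U\subset M$ (of dimension vector $w$) is isomorphic to the quiver Grassmannian of submodules of dimension vector $(v,w)-\underline{\dim}\,K_{LR}(U)$ of the module $K_{LR}(M)/K_{LR}(U)$.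
   Context: Let $k$ be a field. For a $k$-category $\mathcal{C}$, a $\mathcal{C}$-module is a $k$-linear functor $\mathcal{C}^{op}\to\mathrm{Mod}\,k$; $\mathrm{Mod}(\mathcal{C})$ is the category of these. Nakajima categories. Let $Q$ be a finite acyclic quiver with vertex set $Q_0$. The framed quiver $\tilde Q$ is obtained from $Q$ by adding, for each $i\in Q_0$, a new vertex $i'$ and a new arrow $i\to i'$. The repetition quiver $\mathbb{Z}\tilde Q$ has vertices $(i,p)$ with $i\in\tilde Q_0$, $p\in\mathbb{Z}$, and for each arrow $\alpha:i\to j$ of $\tilde Q$ and each $p\in\mathbb{Z}$ an arrow $(\alpha,p):(i,p)\to(j,p)$ and an arrow $\sigma(\alpha,p):(j,p-1)\to(i,p)$; $\mathbb{Z}Q$ is defined in the same way from $Q$ and is the full subquiver on the vertices $(i,p)$, $i\in Q_0$. Put $\tau(i,p)=(i,p-1)$. The vertices $(i',p)$, $i\in Q_0$, are called frozen, the others non frozen. Put $\sigma(i,p)=(i',p-1)$ and $\sigma(i',p)=(i,p)$ for $i\in Q_0$. The regular Nakajima category $\mathcal{R}$ is the $k$-category whose objects are the vertices of $\mathbb{Z}\tilde Q$ and whose morphism space from $a$ to $b$ is the space of $k$-linear combinations of paths from $a$ to $b$ modulo the subspace spanned by all $u\,r_x\,v$, with $u,v$ paths, $x$ a non frozen vertex and $r_x$ the sum of all paths of length two from $\tau(x)$ to $x$. For a set $C$ of vertices of $\mathbb{Z}Q$, $\mathcal{R}_C$ is the quotient of $\mathcal{R}$ by the ideal generated by the identities of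 the frozen vertices not belonging to $\sigma^{-1}(C)$, and $\mathcal{S}_C$ is the full subcategory of $\mathcal{R}_C$ on the vertices in $\sigma^{-1}(C)$. Assumption (E) on $C$: for each non frozen vertex $x$ of $\mathbb{Z}\tilde Q$, the sequences \[ 0\to\mathcal{R}_C(?,x)\to\bigoplus_{x\to y}\mathcal{R}_C(?,y),\qquad 0\to\mathcal{R}_C(x,?)\to\bigoplus_{y\to x}\mathcal{R}_C(y,?) \] are exact, where the sums range over all arrows of $\mathbb{Z}\tilde Q$ with source (respectively target) $x$. Intermediate extension. The restriction $\mathrm{res}:\mathrm{Mod}(\mathcal{R}_C)\to\mathrm{Mod}(\mathcal{S}_C)$ has a left adjoint $K_L$ and a right adjoint $K_R$, both fully faithful. There is a canonical morphism $K_L\to K_R$ (corresponding by adjunction to the isomorphism $\mathbf{1}\to\mathrm{res}\,K_L$); $K_{LR}$ is its image. One has $\mathrm{res}\,K_{LR}(M)=M$ canonically, and for a submodule $U\subset M$, $K_{LR}(U)$ is canonically a submodule of $K_{LR}(M)$. Dimension vectors and Grassmannians. A dimension vector $w$ of $\mathcal{S}_C$ is a finitely supported $\mathbb{N}$-valued function on the objects of $\mathcal{S}_C$; a dimension vector of $\mathcal{R}_C$ is a pair $(v,w)$ with $v$ a finitely supported $\mathbb{N}$-valued function on the non frozen vertices. $\mathrm{Gr}_w(M)$ and $\mathrm{Gr}_{(v,w)}(L)$ are the quiver Grassmannians, i.e. the projective varieties of submodules of the given dimension vector (empty if the vector has a negative entry). *)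

theory Defs
  imports "HOL-Algebra.Ideal" "Graph_Theory.Graph_Theory" "Jordan_Normal_Form.Missing_VectorSpace"
begin

section \<open>Modules presented by generators and relations\<close>

definition free_module :: "'r ring \<Rightarrow> 'x set \<Rightarrow> ('r, 'x \<Rightarrow> 'r) module" where
  "free_module R X =
     \<lparr>carrier = {c. (\<forall>x. c x \<in> carrier R) \<and> (\<forall>x. x \<notin> X \<longrightarrow> c x = \<zero>\<^bsub>R\<^esub>) \<and> finite {x. c x \<noteq> \<zero>\<^bsub>R\<^esub>}},
      monoid.mult = (\<lambda>_ _. undefined), one = undefined,
      zero = (\<lambda>_. \<zero>\<^bsub>R\<^esub>),
      add = (\<lambda>c d x. c x \<oplus>\<^bsub>R\<^esub> d x),
      smult = (\<lambda>r c x. r \<otimes>\<^bsub>R\<^esub> c x)\<rparr>"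

definition basis_elt :: "'r ring \<Rightarrow> 'x \<Rightarrow> 'x \<Rightarrow> 'r" where
  "basis_elt R x = (\<lambda>y. if y = x then \<one>\<^bsub>R\<^esub> else \<zero>\<^bsub>R\<^esub>)"

definition quot_module :: "('r, 'm) module \<Rightarrow> 'm set \<Rightarrow> ('r, 'm set) module" where
  "quot_module V W =
     \<lparr>carrier = a_rcosets\<^bsub>V\<^esub> W,
      monoid.mult = (\<lambda>_ _. undefined), one = undefined,
      zero = W,
      add = (\<lambda>X Y. X <+>\<^bsub>V\<^esub> Y),
      smult = (\<lambda>r X. \<Union>x\<in>X. W +>\<^bsub>V\<^esub> (r \<odot>\<^bsub>V\<^esub> x))\<rparr>"

definition pres_rel :: "'r ring \<Rightarrow> 'x set \<Rightarrow> ('x \<Rightarrow> 'r) set \<Rightarrow> ('x \<Rightarrow> 'r) set" where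
  "pres_rel R X P = LinearCombinations.module.span R (free_module R X) P"

definition pres :: "'r ring \<Rightarrow> 'x set \<Rightarrow> ('x \<Rightarrow> 'r) set \<Rightarrow> ('r, ('x \<Rightarrow> 'r) set) module" where
  "pres R X P = quot_module (free_module R X) (pres_rel R X P)"

definition pres_gen :: "'r ring \<Rightarrow> 'x set \<Rightarrow> ('x \<Rightarrow> 'r) set \<Rightarrow> 'x \<Rightarrow> ('x \<Rightarrow> 'r) set" where
  "pres_gen R X P x = pres_rel R X P +>\<^bsub>free_module R X\<^esub> basis_elt R x"

text \<open>The map out of a presented module that sends the class of the generator \<open>x\<close> to \<open>F x\<close>
  and is semilinear along the ring homomorphism \<open>\<phi>\<close> (linear if \<open>\<phi>\<close> is the identity). It is
  meaningful only if the map on the free module annihilates the relations.\<close>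

definition lin_ext :: "'r ring \<Rightarrow> ('r \<Rightarrow> 's) \<Rightarrow> ('s, 'n) module \<Rightarrow> ('x \<Rightarrow> 'n) \<Rightarrow> ('x \<Rightarrow> 'r) \<Rightarrow> 'n" where
  "lin_ext R \<phi> N F c = (\<Oplus>\<^bsub>N\<^esub>x\<in>{x. c x \<noteq> \<zero>\<^bsub>R\<^esub>}. \<phi> (c x) \<odot>\<^bsub>N\<^esub> F x)"

definition pres_map ::
  "'r ring \<Rightarrow> ('r \<Rightarrow> 's) \<Rightarrow> ('s, 'n) module \<Rightarrow> ('x \<Rightarrow> 'n) \<Rightarrow> ('x \<Rightarrow> 'r) set \<Rightarrow> 'n" where
  "pres_map R \<phi> N F Z = the_elem (lin_ext R \<phi> N F ` Z)"


section \<open>Linear categories and their modules\<close>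

text \<open>\<open>comp C a b c g f\<close> is the composite of \<open>f : a \<rightarrow> b\<close> and \<open>g : b \<rightarrow> c\<close>.\<close>

record ('o, 'm, 'k) kcat =
  obj :: "'o set"
  homs :: "'o \<Rightarrow> 'o \<Rightarrow> ('k, 'm) module"
  comp :: "'o \<Rightarrow> 'o \<Rightarrow> 'o \<Rightarrow> 'm \<Rightarrow> 'm \<Rightarrow> 'm"
  ident :: "'o \<Rightarrow> 'm"

locale k_category =
  fixes k :: "'k ring" and C :: "('o, 'm, 'k) kcat"
  assumes hom_vs: "\<lbrakk>a \<in> obj C; b \<in> obj C\<rbrakk> \<Longrightarrow> vectorspace k (homs C a b)"
    and ident_closed: "a \<in> obj C \<Longrightarrow> ident C a \<in> carrier (homs C a a)"
    and comp_right: "\<lbrakk>a \<in> obj C; b \<in> obj C; c \<in> obj C; f \<in> carrier (homs C a b)\<rbrakk>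
      \<Longrightarrow> (\<lambda>g. comp C a b c g f) \<in> module_hom k (homs C b c) (homs C a c)"
    and comp_left: "\<lbrakk>a \<in> obj C; b \<in> obj C; c \<in> obj C; g \<in> carrier (homs C b c)\<rbrakk>
      \<Longrightarrow> comp C a b c g \<in> module_hom k (homs C a b) (homs C a c)"
    and ident_left: "\<lbrakk>a \<in> obj C; b \<in> obj C; f \<in> carrier (homs C a b)\<rbrakk>
      \<Longrightarrow> comp C a b b (ident C b) f = f"
    and ident_right: "\<lbrakk>a \<in> obj C; b \<in> obj C; f \<in> carrier (homs C a b)\<rbrakk>
      \<Longrightarrow> comp C a a b f (ident C a) = f"
    and comp_assoc: "\<lbrakk>a \<in> obj C; b \<in> obj C; c \<in> obj C; d \<in> obj C; f \<in> carrier (homs C a b);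
        g \<in> carrier (homs C b c); h \<in> carrier (homs C c d)\<rbrakk>
      \<Longrightarrow> comp C a c d h (comp C a b c g f) = comp C a b d (comp C b c d h g) f"

definition quot_cat :: "('o, 'm, 'k) kcat \<Rightarrow> ('o \<Rightarrow> 'o \<Rightarrow> 'm set) \<Rightarrow> ('o, 'm set, 'k) kcat" where
  "quot_cat C I =
     \<lparr>obj = obj C,
      homs = (\<lambda>a b. quot_module (homs C a b) (I a b)),
      comp = (\<lambda>a b c G F. \<Union>g\<in>G. \<Union>f\<in>F. I a c +>\<^bsub>homs C a c\<^esub> comp C a b c g f),
      ident = (\<lambda>a. I a a +>\<^bsub>homs C a a\<^esub> ident C a)\<rparr>"

definition ident_ideal :: "'k ring \<Rightarrow> ('o, 'm, 'k) kcat \<Rightarrow> 'o set \<Rightarrow> 'o \<Rightarrow> 'o \<Rightarrow> 'm set" where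
  "ident_ideal k C Z a b = LinearCombinations.module.span k (homs C a b)
     {comp C a z b u (comp C a z z (ident C z) v) | z u v.
        z \<in> Z \<and> u \<in> carrier (homs C z b) \<and> v \<in> carrier (homs C a z)}"

definition full_subcat :: "('o, 'm, 'k) kcat \<Rightarrow> 'o set \<Rightarrow> ('o, 'm, 'k) kcat" where
  "full_subcat C S = C\<lparr>obj := S\<rparr>"

text \<open>A module over \<open>C\<close> is a \<open>k\<close>-linear functor from the opposite of \<open>C\<close> to \<open>k\<close>-vector spaces;
  \<open>act M a b f\<close> is the map \<open>M b \<rightarrow> M a\<close> induced by \<open>f : a \<rightarrow> b\<close>. The values of the record away
  from the objects of \<open>C\<close> are irrelevant, so that a module over \<open>C\<close> is, by the very same record,
  a module over each full subcategory (its restriction).\<close>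

record ('o, 'm, 'k, 'v) cmod =
  space :: "'o \<Rightarrow> ('k, 'v) module"
  act :: "'o \<Rightarrow> 'o \<Rightarrow> 'm \<Rightarrow> 'v \<Rightarrow> 'v"

locale cat_module =
  fixes k :: "'k ring" and C :: "('o, 'm, 'k) kcat" and M :: "('o, 'm, 'k, 'v) cmod"
  assumes space_vs: "a \<in> obj C \<Longrightarrow> vectorspace k (space M a)"
    and act_hom: "\<lbrakk>a \<in> obj C; b \<in> obj C; f \<in> carrier (homs C a b)\<rbrakk>
      \<Longrightarrow> act M a b f \<in> module_hom k (space M b) (space M a)"
    and act_linear: "\<lbrakk>a \<in> obj C; b \<in> obj C; x \<in> carrier (space M b)\<rbrakk>
      \<Longrightarrow> (\<lambda>f. act M a b f x) \<in> module_hom k (homs C a b) (space M a)"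
    and act_ident: "\<lbrakk>a \<in> obj C; x \<in> carrier (space M a)\<rbrakk> \<Longrightarrow> act M a a (ident C a) x = x"
    and act_comp: "\<lbrakk>a \<in> obj C; b \<in> obj C; c \<in> obj C; f \<in> carrier (homs C a b);
        g \<in> carrier (homs C b c); x \<in> carrier (space M c)\<rbrakk>
      \<Longrightarrow> act M a c (comp C a b c g f) x = act M a b f (act M b c g x)"

definition cmod_hom ::
  "'k ring \<Rightarrow> ('o, 'm, 'k) kcat \<Rightarrow> ('o, 'm, 'k, 'v) cmod \<Rightarrow> ('o, 'm, 'k, 'w) cmod
    \<Rightarrow> ('o \<Rightarrow> 'v \<Rightarrow> 'w) set" where
  "cmod_hom k C M N = {\<phi>.
     (\<forall>a\<in>obj C. \<phi> a \<in> module_hom k (space M a) (space N a)) \<and>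
     (\<forall>a\<in>obj C. \<forall>b\<in>obj C. \<forall>f\<in>carrier (homs C a b). \<forall>x\<in>carrier (space M b).
        \<phi> a (act M a b f x) = act N a b f (\<phi> b x))}"

definition is_submod ::
  "'k ring \<Rightarrow> ('o, 'm, 'k) kcat \<Rightarrow> ('o, 'm, 'k, 'v) cmod \<Rightarrow> ('o \<Rightarrow> 'v set) \<Rightarrow> bool" where
  "is_submod k C M U \<longleftrightarrow> U \<in> extensional (obj C) \<and>
     (\<forall>a\<in>obj C. submodule k (U a) (space M a)) \<and>
     (\<forall>a\<in>obj C. \<forall>b\<in>obj C. \<forall>f\<in>carrier (homs C a b). act M a b f ` U b \<subseteq> U a)"

definition sub_mod :: "('o, 'm, 'k, 'v) cmod \<Rightarrow> ('o \<Rightarrow> 'v set) \<Rightarrow> ('o, 'm, 'k, 'v) cmod" where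
  "sub_mod M U = M\<lparr>space := (\<lambda>a. (space M a)\<lparr>carrier := U a\<rparr>)\<rparr>"

definition quot_mod :: "('o, 'm, 'k, 'v) cmod \<Rightarrow> ('o \<Rightarrow> 'v set) \<Rightarrow> ('o, 'm, 'k, 'v set) cmod" where
  "quot_mod M U =
     \<lparr>space = (\<lambda>a. quot_module (space M a) (U a)),
      act = (\<lambda>a b f X. \<Union>x\<in>X. U a +>\<^bsub>space M a\<^esub> act M a b f x)\<rparr>"

definition dimv :: "'k ring \<Rightarrow> ('o, 'm, 'k, 'v) cmod \<Rightarrow> 'o \<Rightarrow> int" where
  "dimv k M a = int (vectorspace.dim k (space M a))"

definition fin_dim_mod :: "'k ring \<Rightarrow> ('o, 'm, 'k) kcat \<Rightarrow> ('o, 'm, 'k, 'v) cmod \<Rightarrow> bool" where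
  "fin_dim_mod k C M \<longleftrightarrow>
     (\<forall>a\<in>obj C. vectorspace.fin_dim k (space M a)) \<and>
     finite {a \<in> obj C. carrier (space M a) \<noteq> {\<zero>\<^bsub>space M a\<^esub>}}"

text \<open>\<open>Ext\<^sup>1(N, M) = 0\<close> in the sense of Yoneda: every extension of \<open>N\<close> by \<open>M\<close> splits. The
  middle term of an extension is, at each object, in bijection with the product of the two outer
  terms, so that letting its elements range over the product type loses no extension.\<close>

definition Ext1_zero ::
  "'k ring \<Rightarrow> ('o, 'm, 'k) kcat \<Rightarrow> ('o, 'm, 'k, 'w) cmod \<Rightarrow> ('o, 'm, 'k, 'v) cmod \<Rightarrow> bool" where
  "Ext1_zero k C N M \<longleftrightarrow>
     (\<forall>(E :: ('o, 'm, 'k, 'v \<times> 'w) cmod) i p.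
        cat_module k C E \<and> i \<in> cmod_hom k C M E \<and> p \<in> cmod_hom k C E N \<and>
        (\<forall>a\<in>obj C. inj_on (i a) (carrier (space M a)) \<and>
           i a ` carrier (space M a) = {e \<in> carrier (space E a). p a e = \<zero>\<^bsub>space N a\<^esub>} \<and>
           p a ` carrier (space E a) = carrier (space N a))
        \<longrightarrow> (\<exists>s\<in>cmod_hom k C N E. \<forall>a\<in>obj C. \<forall>x\<in>carrier (space N a). p a (s a x) = x))"

definition rigid :: "'k ring \<Rightarrow> ('o, 'm, 'k) kcat \<Rightarrow> ('o, 'm, 'k, 'v) cmod \<Rightarrow> bool" where
  "rigid k C M \<longleftrightarrow> Ext1_zero k C M M"


section \<open>Extension of modules from a full subcategory\<close>

text \<open>Throughout, \<open>S\<close> is a set of objects of \<open>C\<close> and \<open>M\<close> is a module over the full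
  subcategory on \<open>S\<close>.

  The right adjoint of the restriction is given by \<open>(K\<^sub>R M)(x) = Hom(C(-, x), M)\<close>, the
  homomorphisms of modules over the subcategory. That it is a right adjoint is proved below as
  \<open>K_R_universal\<close>.\<close>

definition rep_mod :: "('o, 'm, 'k) kcat \<Rightarrow> 'o \<Rightarrow> ('o, 'm, 'k, 'm) cmod" where
  "rep_mod C x = \<lparr>space = (\<lambda>s. homs C s x), act = (\<lambda>a b f g. comp C a b x g f)\<rparr>"

definition K_R ::
  "'k ring \<Rightarrow> ('o, 'm, 'k) kcat \<Rightarrow> 'o set \<Rightarrow> ('o, 'm, 'k, 'v) cmod
    \<Rightarrow> ('o, 'm, 'k, 'o \<Rightarrow> 'm \<Rightarrow> 'v) cmod" where
  "K_R k C S M =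
     \<lparr>space = (\<lambda>x.
        \<lparr>carrier = {\<phi> \<in> cmod_hom k (full_subcat C S) (rep_mod C x) M.
            \<phi> \<in> extensional S \<and> (\<forall>s\<in>S. \<phi> s \<in> extensional (carrier (homs C s x)))},
         monoid.mult = (\<lambda>_ _. undefined), one = undefined,
         zero = (\<lambda>s\<in>S. \<lambda>g\<in>carrier (homs C s x). \<zero>\<^bsub>space M s\<^esub>),
         add = (\<lambda>\<phi> \<psi>. \<lambda>s\<in>S. \<lambda>g\<in>carrier (homs C s x). \<phi> s g \<oplus>\<^bsub>space M s\<^esub> \<psi> s g),
         smult = (\<lambda>r \<phi>. \<lambda>s\<in>S. \<lambda>g\<in>carrier (homs C s x). r \<odot>\<^bsub>space M s\<^esub> \<phi> s g)\<rparr>),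
      act = (\<lambda>x y f \<phi>. \<lambda>s\<in>S. \<lambda>g\<in>carrier (homs C s x). \<phi> s (comp C s x y f g))\<rparr>"

text \<open>The counit \<open>res K\<^sub>R M \<rightarrow> M\<close>.\<close>

definition K_R_counit :: "('o, 'm, 'k) kcat \<Rightarrow> 'o \<Rightarrow> ('o \<Rightarrow> 'm \<Rightarrow> 'v) \<Rightarrow> 'v" where
  "K_R_counit C s \<phi> = \<phi> s (ident C s)"

text \<open>The left adjoint of the restriction: \<open>(K\<^sub>L M)(x)\<close> is the tensor product over the subcategory
  of \<open>C(x, -)\<close> and \<open>M\<close>, generated by the symbols \<open>g \<otimes> m\<close> with \<open>g : x \<rightarrow> s\<close>, \<open>m \<in> M s\<close>, \<open>s \<in> S\<close>,
  here written \<open>(s, g, m)\<close>. That this is a left adjoint is proved below as \<open>K_L_universal\<close>.\<close>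

definition K_L_gens :: "('o, 'm, 'k) kcat \<Rightarrow> 'o set \<Rightarrow> ('o, 'm, 'k, 'v) cmod \<Rightarrow> 'o \<Rightarrow> ('o \<times> 'm \<times> 'v) set" where
  "K_L_gens C S M x =
     {(s, g, m) | s g m. s \<in> S \<and> g \<in> carrier (homs C x s) \<and> m \<in> carrier (space M s)}"

definition K_L_rels ::
  "'k ring \<Rightarrow> ('o, 'm, 'k) kcat \<Rightarrow> 'o set \<Rightarrow> ('o, 'm, 'k, 'v) cmod \<Rightarrow> 'o \<Rightarrow> ('o \<times> 'm \<times> 'v \<Rightarrow> 'k) set" where
  "K_L_rels k C S M x = (let F = free_module k (K_L_gens C S M x); e = basis_elt k in
     {e (s, g \<oplus>\<^bsub>homs C x s\<^esub> g', m) \<ominus>\<^bsub>F\<^esub> (e (s, g, m) \<oplus>\<^bsub>F\<^esub> e (s, g', m)) | s g g' m.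
        s \<in> S \<and> g \<in> carrier (homs C x s) \<and> g' \<in> carrier (homs C x s) \<and> m \<in> carrier (space M s)} \<union>
     {e (s, g, m \<oplus>\<^bsub>space M s\<^esub> m') \<ominus>\<^bsub>F\<^esub> (e (s, g, m) \<oplus>\<^bsub>F\<^esub> e (s, g, m')) | s g m m'.
        s \<in> S \<and> g \<in> carrier (homs C x s) \<and> m \<in> carrier (space M s) \<and> m' \<in> carrier (space M s)} \<union>
     {e (s, r \<odot>\<^bsub>homs C x s\<^esub> g, m) \<ominus>\<^bsub>F\<^esub> r \<odot>\<^bsub>F\<^esub> e (s, g, m) | s r g m.
        s \<in> S \<and> r \<in> carrier k \<and> g \<in> carrier (homs C x s) \<and> m \<in> carrier (space M s)} \<union>
     {e (s, g, r \<odot>\<^bsub>space M s\<^esub> m) \<ominus>\<^bsub>F\<^esub> r \<odot>\<^bsub>F\<^esub> e (s, g, m) | s r g m.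
        s \<in> S \<and> r \<in> carrier k \<and> g \<in> carrier (homs C x s) \<and> m \<in> carrier (space M s)} \<union>
     {e (t, comp C x s t h g, m) \<ominus>\<^bsub>F\<^esub> e (s, g, act M s t h m) | s t g h m.
        s \<in> S \<and> t \<in> S \<and> g \<in> carrier (homs C x s) \<and> h \<in> carrier (homs C s t) \<and> m \<in> carrier (space M t)})"

definition K_L_gen ::
  "'k ring \<Rightarrow> ('o, 'm, 'k) kcat \<Rightarrow> 'o set \<Rightarrow> ('o, 'm, 'k, 'v) cmod \<Rightarrow> 'o \<Rightarrow> 'o \<times> 'm \<times> 'v
    \<Rightarrow> ('o \<times> 'm \<times> 'v \<Rightarrow> 'k) set" where
  "K_L_gen k C S M x = pres_gen k (K_L_gens C S M x) (K_L_rels k C S M x)"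

definition K_L ::
  "'k ring \<Rightarrow> ('o, 'm, 'k) kcat \<Rightarrow> 'o set \<Rightarrow> ('o, 'm, 'k, 'v) cmod
    \<Rightarrow> ('o, 'm, 'k, ('o \<times> 'm \<times> 'v \<Rightarrow> 'k) set) cmod" where
  "K_L k C S M =
     \<lparr>space = (\<lambda>x. pres k (K_L_gens C S M x) (K_L_rels k C S M x)),
      act = (\<lambda>x y f. pres_map k id (pres k (K_L_gens C S M x) (K_L_rels k C S M x))
         (\<lambda>(s, g, m). K_L_gen k C S M x (s, comp C x y s g f, m)))\<rparr>"

text \<open>The unit \<open>M \<rightarrow> res K\<^sub>L M\<close>.\<close>

definition K_L_unit ::
  "'k ring \<Rightarrow> ('o, 'm, 'k) kcat \<Rightarrow> 'o set \<Rightarrow> ('o, 'm, 'k, 'v) cmod \<Rightarrow> 'o \<Rightarrow> 'v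
    \<Rightarrow> ('o \<times> 'm \<times> 'v \<Rightarrow> 'k) set" where
  "K_L_unit k C S M s m = K_L_gen k C S M s (s, ident C s, m)"

text \<open>The canonical morphism \<open>K\<^sub>L M \<rightarrow> K\<^sub>R M\<close> sends \<open>g \<otimes> m\<close> to the homomorphism
  \<open>h \<mapsto> M(g h)(m)\<close>. By \<open>K_can_hom\<close> and \<open>K_can_adjoint\<close> below it is the morphism that corresponds
  by adjunction to the inverse of the unit. The intermediate extension is its image.\<close>

definition K_can ::
  "'k ring \<Rightarrow> ('o, 'm, 'k) kcat \<Rightarrow> 'o set \<Rightarrow> ('o, 'm, 'k, 'v) cmod \<Rightarrow> 'o
    \<Rightarrow> ('o \<times> 'm \<times> 'v \<Rightarrow> 'k) set \<Rightarrow> 'o \<Rightarrow> 'm \<Rightarrow> 'v" where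
  "K_can k C S M x = pres_map k id (space (K_R k C S M) x)
     (\<lambda>(s, g, m). \<lambda>t\<in>S. \<lambda>h\<in>carrier (homs C t x). act M t s (comp C t x s g h) m)"

definition K_LR_carrier ::
  "'k ring \<Rightarrow> ('o, 'm, 'k) kcat \<Rightarrow> 'o set \<Rightarrow> ('o, 'm, 'k, 'v) cmod \<Rightarrow> 'o \<Rightarrow> ('o \<Rightarrow> 'm \<Rightarrow> 'v) set" where
  "K_LR_carrier k C S M = (\<lambda>x\<in>obj C. K_can k C S M x ` carrier (space (K_L k C S M) x))"

definition K_LR ::
  "'k ring \<Rightarrow> ('o, 'm, 'k) kcat \<Rightarrow> 'o set \<Rightarrow> ('o, 'm, 'k, 'v) cmod
    \<Rightarrow> ('o, 'm, 'k, 'o \<Rightarrow> 'm \<Rightarrow> 'v) cmod" where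
  "K_LR k C S M = sub_mod (K_R k C S M) (K_LR_carrier k C S M)"


section \<open>Quiver Grassmannians\<close>

text \<open>Schemes over \<open>k\<close> are represented by their functors of points. A commutative \<open>k\<close>-algebra
  is a commutative ring \<open>A\<close> with a ring homomorphism \<open>h\<close> from \<open>k\<close>. The rings have their carriers
  in an arbitrary type \<open>'r\<close>; if this type is large enough to carry all finitely generated
  \<open>k\<close>-algebras then, by Yoneda's lemma, an isomorphism of functors of points is the same as an
  isomorphism of schemes (of finite type).\<close>

definition k_algebra :: "'k ring \<Rightarrow> 'r ring \<Rightarrow> ('k \<Rightarrow> 'r) \<Rightarrow> bool" where
  "k_algebra k A h \<longleftrightarrow> cring A \<and> h \<in> ring_hom k A"

definition k_alg_hom ::
  "'k ring \<Rightarrow> 'r ring \<Rightarrow> ('k \<Rightarrow> 'r) \<Rightarrow> 'r ring \<Rightarrow> ('k \<Rightarrow> 'r) \<Rightarrow> ('r \<Rightarrow> 'r) set" where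
  "k_alg_hom k A h B h' = {\<phi> \<in> ring_hom A B. \<forall>r\<in>carrier k. \<phi> (h r) = h' r}"

record ('k, 'r, 'p) kfun =
  pts :: "'r ring \<Rightarrow> ('k \<Rightarrow> 'r) \<Rightarrow> 'p set"
  pull :: "'r ring \<Rightarrow> ('k \<Rightarrow> 'r) \<Rightarrow> 'r ring \<Rightarrow> ('k \<Rightarrow> 'r) \<Rightarrow> ('r \<Rightarrow> 'r) \<Rightarrow> 'p \<Rightarrow> 'p"

definition kfun_iso :: "'k ring \<Rightarrow> ('k, 'r, 'p) kfun \<Rightarrow> ('k, 'r, 'q) kfun \<Rightarrow> bool" where
  "kfun_iso k X Y \<longleftrightarrow> (\<exists>\<eta>.
     (\<forall>A h. k_algebra k A h \<longrightarrow> bij_betw (\<eta> A h) (pts X A h) (pts Y A h)) \<and>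
     (\<forall>A h B h'. k_algebra k A h \<and> k_algebra k B h' \<longrightarrow>
        (\<forall>\<phi>\<in>k_alg_hom k A h B h'. \<forall>p\<in>pts X A h.
           \<eta> B h' (pull X A h B h' \<phi> p) = pull Y A h B h' \<phi> (\<eta> A h p))))"

text \<open>The fibre of a natural transformation \<open>\<pi>\<close> with source \<open>X\<close> over a rational point of its
  target, given by the images \<open>u A h\<close> of that point in the \<open>A\<close>-valued points.\<close>

definition kfun_fibre ::
  "('k, 'r, 'p) kfun \<Rightarrow> ('r ring \<Rightarrow> ('k \<Rightarrow> 'r) \<Rightarrow> 'p \<Rightarrow> 'q) \<Rightarrow> ('r ring \<Rightarrow> ('k \<Rightarrow> 'r) \<Rightarrow> 'q)
    \<Rightarrow> ('k, 'r, 'p) kfun" where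
  "kfun_fibre X \<pi> u = X\<lparr>pts := (\<lambda>A h. {p \<in> pts X A h. \<pi> A h p = u A h})\<rparr>"

text \<open>Extension of scalars \<open>V \<otimes> A\<close> of a vector space, as the \<open>A\<close>-module generated by the
  symbols \<open>v \<otimes> 1\<close> subject to \<open>k\<close>-linearity in \<open>v\<close>.\<close>

definition scalar_rels :: "'k ring \<Rightarrow> 'r ring \<Rightarrow> ('k \<Rightarrow> 'r) \<Rightarrow> ('k, 'v) module \<Rightarrow> ('v \<Rightarrow> 'r) set" where
  "scalar_rels k A h V = (let F = free_module A (carrier V); e = basis_elt A in
     {e (v \<oplus>\<^bsub>V\<^esub> w) \<ominus>\<^bsub>F\<^esub> (e v \<oplus>\<^bsub>F\<^esub> e w) | v w. v \<in> carrier V \<and> w \<in> carrier V} \<union>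
     {e (r \<odot>\<^bsub>V\<^esub> v) \<ominus>\<^bsub>F\<^esub> h r \<odot>\<^bsub>F\<^esub> e v | r v. r \<in> carrier k \<and> v \<in> carrier V})"

definition scal :: "'k ring \<Rightarrow> 'r ring \<Rightarrow> ('k \<Rightarrow> 'r) \<Rightarrow> ('k, 'v) module \<Rightarrow> ('r, ('v \<Rightarrow> 'r) set) module" where
  "scal k A h V = pres A (carrier V) (scalar_rels k A h V)"

definition scal_gen :: "'k ring \<Rightarrow> 'r ring \<Rightarrow> ('k \<Rightarrow> 'r) \<Rightarrow> ('k, 'v) module \<Rightarrow> 'v \<Rightarrow> ('v \<Rightarrow> 'r) set" where
  "scal_gen k A h V = pres_gen A (carrier V) (scalar_rels k A h V)"

text \<open>The map \<open>V \<otimes> A \<rightarrow> W \<otimes> A\<close> induced by a linear map \<open>V \<rightarrow> W\<close>, and the map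
  \<open>V \<otimes> A \<rightarrow> V \<otimes> B\<close> induced by a homomorphism \<open>\<phi>\<close> from \<open>A\<close> to the algebra \<open>(B, h')\<close>.\<close>

definition scal_map ::
  "'k ring \<Rightarrow> 'r ring \<Rightarrow> ('k \<Rightarrow> 'r) \<Rightarrow> ('k, 'w) module \<Rightarrow> ('v \<Rightarrow> 'w) \<Rightarrow> ('v \<Rightarrow> 'r) set \<Rightarrow> ('w \<Rightarrow> 'r) set" where
  "scal_map k A h W f = pres_map A id (scal k A h W) (\<lambda>v. scal_gen k A h W (f v))"

definition scal_change ::
  "'k ring \<Rightarrow> 'r ring \<Rightarrow> 'r ring \<Rightarrow> ('k \<Rightarrow> 'r) \<Rightarrow> ('r \<Rightarrow> 'r) \<Rightarrow> ('k, 'v) module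
    \<Rightarrow> ('v \<Rightarrow> 'r) set \<Rightarrow> ('v \<Rightarrow> 'r) set" where
  "scal_change k A B h' \<phi> V = pres_map A \<phi> (scal k B h' V) (scal_gen k B h' V)"

text \<open>Local freeness of rank \<open>r\<close>: the elements \<open>f\<close> for which the localisation \<open>Q\<^sub>f\<close> is free of
  rank \<open>r\<close> generate the unit ideal. A basis of \<open>Q\<^sub>f\<close> can be taken to consist of images of
  elements \<open>b\<^sub>0, \<dots>, b\<^sub>n\<^sub>-\<^sub>1\<close> of \<open>Q\<close>.\<close>

definition free_at :: "'r ring \<Rightarrow> ('r, 'q) module \<Rightarrow> nat \<Rightarrow> 'r \<Rightarrow> bool" where
  "free_at A Q n f \<longleftrightarrow> (\<exists>b. b \<in> {..<n} \<rightarrow> carrier Q \<and>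
     (\<forall>q\<in>carrier Q. \<exists>(e::nat) c. c \<in> {..<n} \<rightarrow> carrier A \<and>
        (f [^]\<^bsub>A\<^esub> e) \<odot>\<^bsub>Q\<^esub> q = (\<Oplus>\<^bsub>Q\<^esub>j\<in>{..<n}. c j \<odot>\<^bsub>Q\<^esub> b j)) \<and>
     (\<forall>c. c \<in> {..<n} \<rightarrow> carrier A \<and> (\<Oplus>\<^bsub>Q\<^esub>j\<in>{..<n}. c j \<odot>\<^bsub>Q\<^esub> b j) = \<zero>\<^bsub>Q\<^esub> \<longrightarrow>
        (\<exists>e::nat. \<forall>j<n. f [^]\<^bsub>A\<^esub> e \<otimes>\<^bsub>A\<^esub> c j = \<zero>\<^bsub>A\<^esub>)))"

definition loc_free :: "'r ring \<Rightarrow> ('r, 'q) module \<Rightarrow> int \<Rightarrow> bool" where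
  "loc_free A Q r \<longleftrightarrow>
     Idl\<^bsub>A\<^esub> {f \<in> carrier A. \<exists>n. int n = r \<and> free_at A Q n f} = carrier A"

text \<open>The quiver Grassmannian of submodules of dimension vector \<open>d\<close> of a (pointwise
  finite-dimensional) \<open>C\<close>-module \<open>L\<close>. As usual for Grassmannians, an \<open>A\<close>-valued point is a
  subfunctor \<open>N\<close> of \<open>L \<otimes> A\<close> with \<open>(L \<otimes> A) / N\<close> locally free of rank \<open>dim L - d\<close>; for \<open>A = k\<close>
  these are the submodules of \<open>L\<close> of dimension vector \<open>d\<close>. A homomorphism from \<open>A\<close> to \<open>B\<close> takes
  \<open>N\<close> to the \<open>B\<close>-submodule of \<open>L \<otimes> B\<close> generated by its image.\<close>

definition quiver_Gr ::
  "'k ring \<Rightarrow> ('o, 'm, 'k) kcat \<Rightarrow> ('o, 'm, 'k, 'v) cmod \<Rightarrow> ('o \<Rightarrow> int)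
    \<Rightarrow> ('k, 'r, 'o \<Rightarrow> ('v \<Rightarrow> 'r) set set) kfun" where
  "quiver_Gr k C L d =
     \<lparr>pts = (\<lambda>A h. {N \<in> extensional (obj C).
         (\<forall>a\<in>obj C. submodule A (N a) (scal k A h (space L a)) \<and>
            loc_free A (quot_module (scal k A h (space L a)) (N a)) (dimv k L a - d a)) \<and>
         (\<forall>a\<in>obj C. \<forall>b\<in>obj C. \<forall>f\<in>carrier (homs C a b).
            scal_map k A h (space L a) (act L a b f) ` N b \<subseteq> N a)}),
      pull = (\<lambda>A h B h' \<phi> N. \<lambda>a\<in>obj C.
         LinearCombinations.module.span B (scal k B h' (space L a))
           (scal_change k A B h' \<phi> (space L a) ` N a))\<rparr>"

text \<open>The \<open>A\<close>-valued point defined by a submodule \<open>U\<close> of \<open>M\<close>.\<close>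

definition Gr_point ::
  "'k ring \<Rightarrow> ('o, 'm, 'k) kcat \<Rightarrow> ('o, 'm, 'k, 'v) cmod \<Rightarrow> ('o \<Rightarrow> 'v set)
    \<Rightarrow> 'r ring \<Rightarrow> ('k \<Rightarrow> 'r) \<Rightarrow> 'o \<Rightarrow> ('v \<Rightarrow> 'r) set set" where
  "Gr_point k C M U A h = (\<lambda>a\<in>obj C.
     LinearCombinations.module.span A (scal k A h (space M a)) (scal_gen k A h (space M a) ` U a))"

text \<open>The map from the Grassmannians of \<open>K\<^sub>L\<^sub>R M\<close> to those of \<open>M\<close>: restriction to the subcategory
  on \<open>S\<close>, followed by the canonical identification of \<open>res K\<^sub>L\<^sub>R M\<close> with \<open>M\<close>.\<close>

definition Gr_res ::
  "'k ring \<Rightarrow> ('o, 'm, 'k) kcat \<Rightarrow> 'o set \<Rightarrow> ('o, 'm, 'k, 'v) cmod \<Rightarrow> 'r ring \<Rightarrow> ('k \<Rightarrow> 'r)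
    \<Rightarrow> ('o \<Rightarrow> (('o \<Rightarrow> 'm \<Rightarrow> 'v) \<Rightarrow> 'r) set set) \<Rightarrow> 'o \<Rightarrow> ('v \<Rightarrow> 'r) set set" where
  "Gr_res k C S M A h N = (\<lambda>s\<in>S. scal_map k A h (space M s) (K_R_counit C s) ` N s)"


section \<open>Nakajima categories\<close>

text \<open>The framed quiver: \<open>Inr i\<close> is the additional vertex \<open>i'\<close>, and also the additional arrow
  from \<open>i\<close> to \<open>i'\<close>.\<close>

definition framed :: "('v, 'e) pre_digraph \<Rightarrow> ('v + 'v, 'e + 'v) pre_digraph" where
  "framed Q =
     \<lparr>verts = verts Q <+> verts Q, arcs = arcs Q <+> verts Q,
      tail = case_sum (\<lambda>e. Inl (tail Q e)) Inl,
      head = case_sum (\<lambda>e. Inl (head Q e)) Inr\<rparr>"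

text \<open>The repetition quiver: \<open>Inl (\<alpha>, p)\<close> is the arrow \<open>(\<alpha>, p)\<close>, and \<open>Inr (\<alpha>, p)\<close> is the arrow
  \<open>\<sigma>(\<alpha>, p)\<close>.\<close>

definition repetition :: "('a, 'b) pre_digraph \<Rightarrow> ('a \<times> int, 'b \<times> int + 'b \<times> int) pre_digraph" where
  "repetition G =
     \<lparr>verts = verts G \<times> UNIV, arcs = (arcs G \<times> UNIV) <+> (arcs G \<times> UNIV),
      tail = case_sum (\<lambda>(e, p). (tail G e, p)) (\<lambda>(e, p). (head G e, p - 1)),
      head = case_sum (\<lambda>(e, p). (head G e, p)) (\<lambda>(e, p). (tail G e, p))\<rparr>"

type_synonym 'v nvert = "('v + 'v) \<times> int"
type_synonym ('v, 'e) narrow = "('e + 'v) \<times> int + ('e + 'v) \<times> int"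
type_synonym ('v, 'e) npath = "('v, 'e) narrow list"

abbreviation Zframed :: "('v, 'e) pre_digraph \<Rightarrow> ('v nvert, ('v, 'e) narrow) pre_digraph" where
  "Zframed Q \<equiv> repetition (framed Q)"

definition nu_tau :: "'v nvert \<Rightarrow> 'v nvert" where
  "nu_tau = (\<lambda>(i, p). (i, p - 1))"

definition nu_sigma :: "'v nvert \<Rightarrow> 'v nvert" where
  "nu_sigma = (\<lambda>(i, p). case i of Inl j \<Rightarrow> (Inr j, p - 1) | Inr j \<Rightarrow> (Inl j, p))"

definition frozen :: "('v, 'e) pre_digraph \<Rightarrow> 'v nvert set" where
  "frozen Q = Inr ` verts Q \<times> UNIV"

definition nonfrozen :: "('v, 'e) pre_digraph \<Rightarrow> 'v nvert set" where
  "nonfrozen Q = Inl ` verts Q \<times> UNIV"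

definition sigma_inv :: "('v, 'e) pre_digraph \<Rightarrow> ('v \<times> int) set \<Rightarrow> 'v nvert set" where
  "sigma_inv Q C = {z \<in> verts (Zframed Q). nu_sigma z \<in> map_prod Inl id ` C}"

text \<open>The path category of a quiver; a path is the list of its arrows in the order in which they
  are traversed. Composition is the convolution of the coefficients over all decompositions of a
  path.\<close>

definition path_cat :: "'k ring \<Rightarrow> ('a, 'b) pre_digraph \<Rightarrow> ('a, 'b list \<Rightarrow> 'k, 'k) kcat" where
  "path_cat k G =
     \<lparr>obj = verts G,
      homs = (\<lambda>a b. free_module k {p. pre_digraph.awalk G a p b}),
      comp = (\<lambda>a b c g f p. \<Oplus>\<^bsub>k\<^esub>j\<in>{..length p}. g (drop j p) \<otimes>\<^bsub>k\<^esub> f (take j p)),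
      ident = (\<lambda>a. basis_elt k [])\<rparr>"

definition mesh :: "'k ring \<Rightarrow> ('v, 'e) pre_digraph \<Rightarrow> 'v nvert \<Rightarrow> ('v, 'e) npath \<Rightarrow> 'k" where
  "mesh k Q x = (\<lambda>p. if pre_digraph.awalk (Zframed Q) (nu_tau x) p x \<and> length p = 2
     then \<one>\<^bsub>k\<^esub> else \<zero>\<^bsub>k\<^esub>)"

definition mesh_ideal ::
  "'k ring \<Rightarrow> ('v, 'e) pre_digraph \<Rightarrow> 'v nvert \<Rightarrow> 'v nvert \<Rightarrow> (('v, 'e) npath \<Rightarrow> 'k) set" where
  "mesh_ideal k Q a b = (let P = path_cat k (Zframed Q) in
     LinearCombinations.module.span k (homs P a b)
       {comp P a x b (basis_elt k u) (comp P a (nu_tau x) x (mesh k Q x) (basis_elt k v)) | u x v.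
          x \<in> nonfrozen Q \<and> pre_digraph.awalk (Zframed Q) a v (nu_tau x) \<and>
          pre_digraph.awalk (Zframed Q) x u b})"

definition Nakajima :: "'k ring \<Rightarrow> ('v, 'e) pre_digraph \<Rightarrow> ('v nvert, (('v, 'e) npath \<Rightarrow> 'k) set, 'k) kcat" where
  "Nakajima k Q = quot_cat (path_cat k (Zframed Q)) (mesh_ideal k Q)"

definition Nakajima_C ::
  "'k ring \<Rightarrow> ('v, 'e) pre_digraph \<Rightarrow> ('v \<times> int) set
    \<Rightarrow> ('v nvert, (('v, 'e) npath \<Rightarrow> 'k) set set, 'k) kcat" where
  "Nakajima_C k Q C =
     quot_cat (Nakajima k Q) (ident_ideal k (Nakajima k Q) (frozen Q - sigma_inv Q C))"

definition Nakajima_S ::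
  "'k ring \<Rightarrow> ('v, 'e) pre_digraph \<Rightarrow> ('v \<times> int) set
    \<Rightarrow> ('v nvert, (('v, 'e) npath \<Rightarrow> 'k) set set, 'k) kcat" where
  "Nakajima_S k Q C = full_subcat (Nakajima_C k Q C) (sigma_inv Q C)"

definition arrow_mor ::
  "'k ring \<Rightarrow> ('v, 'e) pre_digraph \<Rightarrow> ('v \<times> int) set \<Rightarrow> ('v, 'e) narrow
    \<Rightarrow> (('v, 'e) npath \<Rightarrow> 'k) set set" where
  "arrow_mor k Q C \<alpha> =
     (let x = tail (Zframed Q) \<alpha>; y = head (Zframed Q) \<alpha> in
      ident_ideal k (Nakajima k Q) (frozen Q - sigma_inv Q C) x y
        +>\<^bsub>homs (Nakajima k Q) x y\<^esub>
        (mesh_ideal k Q x y +>\<^bsub>homs (path_cat k (Zframed Q)) x y\<^esub> basis_elt k [\<alpha>]))"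

definition assumption_E :: "'k ring \<Rightarrow> ('v, 'e) pre_digraph \<Rightarrow> ('v \<times> int) set \<Rightarrow> bool" where
  "assumption_E k Q C \<longleftrightarrow> (let R = Nakajima_C k Q C; G = Zframed Q in
     \<forall>x\<in>nonfrozen Q. \<forall>a\<in>obj R.
       inj_on (\<lambda>f. \<lambda>\<alpha>\<in>out_arcs G x. comp R a x (head G \<alpha>) (arrow_mor k Q C \<alpha>) f)
         (carrier (homs R a x)) \<and>
       inj_on (\<lambda>f. \<lambda>\<alpha>\<in>in_arcs G x. comp R (tail G \<alpha>) x a f (arrow_mor k Q C \<alpha>))
         (carrier (homs R x a)))"


section \<open>Presented modules\<close>

lemma free_module_module:
  assumes "cring R" shows "module R (free_module R X)"
proof -
  interpret cring R by fact
  show ?thesis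
  proof (rule moduleI[OF assms])
    show "abelian_group (free_module R X)"
    proof (rule abelian_groupI)
      fix c d assume "c \<in> carrier (free_module R X)" "d \<in> carrier (free_module R X)"
      then show "c \<oplus>\<^bsub>free_module R X\<^esub> d \<in> carrier (free_module R X)"
        unfolding free_module_def
        by (auto intro: finite_subset[of _ "{x. c x \<noteq> \<zero>\<^bsub>R\<^esub>} \<union> {x. d x \<noteq> \<zero>\<^bsub>R\<^esub>}"])
    next
      fix c assume c: "c \<in> carrier (free_module R X)"
      then have "(\<lambda>x. \<ominus>\<^bsub>R\<^esub> c x) \<in> carrier (free_module R X)"
        unfolding free_module_def
        by (auto intro: finite_subset[of _ "{x. c x \<noteq> \<zero>\<^bsub>R\<^esub>}"])
      moreover have "(\<lambda>x. \<ominus>\<^bsub>R\<^esub> c x) \<oplus>\<^bsub>free_module R X\<^esub> c = \<zero>\<^bsub>free_module R X\<^esub>"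
        using c by (auto simp: free_module_def l_neg)
      ultimately show "\<exists>y\<in>carrier (free_module R X).
          y \<oplus>\<^bsub>free_module R X\<^esub> c = \<zero>\<^bsub>free_module R X\<^esub>" by blast
    qed (auto simp: free_module_def a_ac)
  qed (auto simp: free_module_def l_distr r_distr m_assoc fun_eq_iff
        intro: finite_subset[of "{x. _ \<otimes>\<^bsub>R\<^esub> c x \<noteq> \<zero>\<^bsub>R\<^esub>}" "{x. c x \<noteq> \<zero>\<^bsub>R\<^esub>}" for c] 
        elim!: finite_subset[rotated])
qed

lemma basis_elt_closed:
  assumes "cring R" "x \<in> X" shows "basis_elt R x \<in> carrier (free_module R X)"
proof -
  interpret cring R by fact
  show ?thesis using assms(2)
    by (auto simp: free_module_def basis_elt_def intro: finite_subset[of _ "{x}"])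
qed

lemma submodule_abelian_subgroup:
  assumes "module R V" "submodule R W V" shows "abelian_subgroup W V"
proof -
  interpret module R V by fact
  interpret W: submodule R W V by fact
  have neg: "\<ominus>\<^bsub>V\<^esub> x \<in> W" if "x \<in> W" for x
  proof -
    have "\<ominus>\<^bsub>V\<^esub> x = (\<ominus>\<^bsub>R\<^esub> \<one>\<^bsub>R\<^esub>) \<odot>\<^bsub>V\<^esub> x" using that W.subset smult_minus_1 by auto
    then show ?thesis using that by auto
  qed
  show ?thesis
  proof (rule abelian_subgroupI3)
    show "additive_subgroup W V"
      by (rule additive_subgroup.intro, rule subgroup.intro)
        (use W.subset neg in \<open>auto simp: a_inv_def[symmetric]\<close>)
  qed unfold_locales
qed

lemma quot_smult:
  assumes "module R V" "submodule R W V" "r \<in> carrier R" "x \<in> carrier V"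
  shows "r \<odot>\<^bsub>quot_module V W\<^esub> (W +>\<^bsub>V\<^esub> x) = W +>\<^bsub>V\<^esub> (r \<odot>\<^bsub>V\<^esub> x)"
proof -
  interpret module R V by fact
  interpret W: submodule R W V by fact
  interpret W: abelian_subgroup W V by (rule submodule_abelian_subgroup[OF assms(1,2)])
  have "W +>\<^bsub>V\<^esub> (r \<odot>\<^bsub>V\<^esub> y) = W +>\<^bsub>V\<^esub> (r \<odot>\<^bsub>V\<^esub> x)" if y: "y \<in> W +>\<^bsub>V\<^esub> x" for y
  proof -
    obtain z where z: "z \<in> W" "y = z \<oplus>\<^bsub>V\<^esub> x" using y by (auto simp: a_r_coset_def')
    have "r \<odot>\<^bsub>V\<^esub> y = r \<odot>\<^bsub>V\<^esub> z \<oplus>\<^bsub>V\<^esub> r \<odot>\<^bsub>V\<^esub> x" using z assms W.subset by (auto simp: smult_r_distr)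
    then have "r \<odot>\<^bsub>V\<^esub> y \<in> W +>\<^bsub>V\<^esub> (r \<odot>\<^bsub>V\<^esub> x)" using z assms by (auto simp: a_r_coset_def')
    then show ?thesis
      by (rule M.a_repr_independence[symmetric]) (use assms W.a_subgroup in auto)
  qed
  note eq = this
  have "x \<in> W +>\<^bsub>V\<^esub> x" using W.a_rcos_self assms by auto
  then have "(\<Union>y\<in>W +>\<^bsub>V\<^esub> x. W +>\<^bsub>V\<^esub> (r \<odot>\<^bsub>V\<^esub> y)) = W +>\<^bsub>V\<^esub> (r \<odot>\<^bsub>V\<^esub> x)"
    using eq by blast
  then show ?thesis unfolding quot_module_def by simp
qed

lemma quot_add:
  assumes "module R V" "submodule R W V" "x \<in> carrier V" "y \<in> carrier V"
  shows "(W +>\<^bsub>V\<^esub> x) \<oplus>\<^bsub>quot_module V W\<^esub> (W +>\<^bsub>V\<^esub> y) = W +>\<^bsub>V\<^esub> (x \<oplus>\<^bsub>V\<^esub> y)"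
  using abelian_subgroup.a_rcos_sum[OF submodule_abelian_subgroup[OF assms(1,2)] assms(3,4)]
  by (simp add: quot_module_def)

lemma quot_zero:
  assumes "module R V" "submodule R W V"
  shows "\<zero>\<^bsub>quot_module V W\<^esub> = W +>\<^bsub>V\<^esub> \<zero>\<^bsub>V\<^esub>"
proof -
  interpret module R V by fact
  interpret W: submodule R W V by fact
  have "(\<Union>h\<in>W. {h \<oplus>\<^bsub>V\<^esub> \<zero>\<^bsub>V\<^esub>}) = (\<Union>h\<in>W. {h})"
    by (rule SUP_cong) (use W.subset in auto)
  then show ?thesis by (simp add: quot_module_def a_r_coset_def')
qed

lemma quot_carrier: "carrier (quot_module V W) = (\<lambda>x. W +>\<^bsub>V\<^esub> x) ` carrier V"
  by (auto simp: quot_module_def A_RCOSETS_def')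

lemma quot_module_module:
  assumes "module R V" "submodule R W V" shows "module R (quot_module V W)"
proof -
  interpret module R V by fact
  note [simp] = quot_carrier quot_add[OF assms] quot_smult[OF assms] quot_zero[OF assms]
  show ?thesis
  proof (rule moduleI)
    show "abelian_group (quot_module V W)"
    proof (rule abelian_groupI)
      fix x assume "x \<in> carrier (quot_module V W)"
      then obtain y where y: "x = W +>\<^bsub>V\<^esub> y" "y \<in> carrier V" by auto
      show "\<exists>z\<in>carrier (quot_module V W). z \<oplus>\<^bsub>quot_module V W\<^esub> x = \<zero>\<^bsub>quot_module V W\<^esub>"
        by (rule bexI[of _ "W +>\<^bsub>V\<^esub> (\<ominus>\<^bsub>V\<^esub> y)"]) (use y in \<open>auto simp: M.l_neg\<close>)
    qed (auto simp: M.a_ac)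
  qed (auto simp: smult_l_distr smult_r_distr smult_assoc1 R.cring_axioms R.is_cring)
qed

lemma quot_proj_hom:
  assumes "module R V" "submodule R W V"
  shows "(\<lambda>x. W +>\<^bsub>V\<^esub> x) \<in> module_hom R V (quot_module V W)"
  using assms by (auto simp: module_hom_def quot_carrier quot_add quot_smult)

lemma lin_ext_superset:
  assumes "module R N" "F \<in> X \<rightarrow> carrier N" "c \<in> carrier (free_module R X)"
    "finite T" "{x. c x \<noteq> \<zero>\<^bsub>R\<^esub>} \<subseteq> T" "T \<subseteq> X"
  shows "lin_ext R id N F c = (\<Oplus>\<^bsub>N\<^esub>x\<in>T. c x \<odot>\<^bsub>N\<^esub> F x)"
proof -
  interpret module R N by fact
  have c: "c x \<in> carrier R" for x using assms(3) by (auto simp: free_module_def)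
  have *: "(\<lambda>x. c x \<odot>\<^bsub>N\<^esub> F x) \<in> T \<rightarrow> carrier N" using assms(2,6) c by (auto simp: Pi_iff subset_iff)
  show ?thesis unfolding lin_ext_def id_def
    by (rule M.add.finprod_mono_neutral_cong_left) (use assms * c in \<open>auto simp: Pi_iff\<close>)
qed

lemma free_supp:
  assumes "c \<in> carrier (free_module R X)"
  shows "finite {x. c x \<noteq> \<zero>\<^bsub>R\<^esub>}" "{x. c x \<noteq> \<zero>\<^bsub>R\<^esub>} \<subseteq> X" "c x \<in> carrier R"
  using assms by (auto simp: free_module_def)

lemma lin_ext_hom:
  assumes "module R N" "F \<in> X \<rightarrow> carrier N"
  shows "lin_ext R id N F \<in> module_hom R (free_module R X) N"
proof -
  interpret module R N by fact
  interpret F: module R "free_module R X" by (rule free_module_module) unfold_locales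
  have cl: "lin_ext R id N F c \<in> carrier N" if "c \<in> carrier (free_module R X)" for c
    unfolding lin_ext_def using free_supp[OF that] assms by (intro M.finsum_closed) auto
  have add: "lin_ext R id N F (c \<oplus>\<^bsub>free_module R X\<^esub> d) = lin_ext R id N F c \<oplus>\<^bsub>N\<^esub> lin_ext R id N F d"
    if c: "c \<in> carrier (free_module R X)" and d: "d \<in> carrier (free_module R X)" for c d
  proof -
    let ?T = "{x. c x \<noteq> \<zero>\<^bsub>R\<^esub>} \<union> {x. d x \<noteq> \<zero>\<^bsub>R\<^esub>}"
    note fs = free_supp[OF c] free_supp[OF d]
    have T: "finite ?T" "?T \<subseteq> X" using fs by auto
    have cd: "c \<oplus>\<^bsub>free_module R X\<^esub> d \<in> carrier (free_module R X)" using c d by auto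
    have "{x. (c \<oplus>\<^bsub>free_module R X\<^esub> d) x \<noteq> \<zero>\<^bsub>R\<^esub>} \<subseteq> ?T" by (auto simp: free_module_def)
    then have "lin_ext R id N F (c \<oplus>\<^bsub>free_module R X\<^esub> d) = (\<Oplus>\<^bsub>N\<^esub>x\<in>?T. (c \<oplus>\<^bsub>free_module R X\<^esub> d) x \<odot>\<^bsub>N\<^esub> F x)"
      by (intro lin_ext_superset[OF assms cd]) (use T in auto)
    also have "\<dots> = (\<Oplus>\<^bsub>N\<^esub>x\<in>?T. c x \<odot>\<^bsub>N\<^esub> F x \<oplus>\<^bsub>N\<^esub> d x \<odot>\<^bsub>N\<^esub> F x)"
    proof (rule M.add.finprod_cong')
      fix x assume "x \<in> ?T"
      then have "F x \<in> carrier N" using T assms(2) by auto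
      then show "(c \<oplus>\<^bsub>free_module R X\<^esub> d) x \<odot>\<^bsub>N\<^esub> F x = c x \<odot>\<^bsub>N\<^esub> F x \<oplus>\<^bsub>N\<^esub> d x \<odot>\<^bsub>N\<^esub> F x"
        using fs(3,6) by (simp add: free_module_def smult_l_distr)
    qed (use T fs(3,6) assms(2) in \<open>auto simp: Pi_iff subset_iff\<close>)
    also have "\<dots> = (\<Oplus>\<^bsub>N\<^esub>x\<in>?T. c x \<odot>\<^bsub>N\<^esub> F x) \<oplus>\<^bsub>N\<^esub> (\<Oplus>\<^bsub>N\<^esub>x\<in>?T. d x \<odot>\<^bsub>N\<^esub> F x)"
      by (intro M.finsum_addf) (use T fs(3,6) assms(2) in \<open>auto simp: Pi_iff subset_iff\<close>)
    also have "(\<Oplus>\<^bsub>N\<^esub>x\<in>?T. c x \<odot>\<^bsub>N\<^esub> F x) = lin_ext R id N F c"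
      by (intro lin_ext_superset[OF assms c, symmetric]) (use T in auto)
    also have "(\<Oplus>\<^bsub>N\<^esub>x\<in>?T. d x \<odot>\<^bsub>N\<^esub> F x) = lin_ext R id N F d"
      by (intro lin_ext_superset[OF assms d, symmetric]) (use T in auto)
    finally show ?thesis .
  qed
  have sm: "lin_ext R id N F (r \<odot>\<^bsub>free_module R X\<^esub> c) = r \<odot>\<^bsub>N\<^esub> lin_ext R id N F c"
    if r: "r \<in> carrier R" and c: "c \<in> carrier (free_module R X)" for r c
  proof -
    let ?T = "{x. c x \<noteq> \<zero>\<^bsub>R\<^esub>}"
    note fs = free_supp[OF c]
    have rc: "r \<odot>\<^bsub>free_module R X\<^esub> c \<in> carrier (free_module R X)" using r c by auto
    have "{x. (r \<odot>\<^bsub>free_module R X\<^esub> c) x \<noteq> \<zero>\<^bsub>R\<^esub>} \<subseteq> ?T" using r by (auto simp: free_module_def)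
    then have "lin_ext R id N F (r \<odot>\<^bsub>free_module R X\<^esub> c) = (\<Oplus>\<^bsub>N\<^esub>x\<in>?T. (r \<odot>\<^bsub>free_module R X\<^esub> c) x \<odot>\<^bsub>N\<^esub> F x)"
      by (intro lin_ext_superset[OF assms rc]) (use fs in auto)
    also have "\<dots> = (\<Oplus>\<^bsub>N\<^esub>x\<in>?T. r \<odot>\<^bsub>N\<^esub> (c x \<odot>\<^bsub>N\<^esub> F x))"
    proof (rule M.add.finprod_cong')
      fix x assume "x \<in> ?T"
      then have "F x \<in> carrier N" using fs assms(2) by auto
      then show "(r \<odot>\<^bsub>free_module R X\<^esub> c) x \<odot>\<^bsub>N\<^esub> F x = r \<odot>\<^bsub>N\<^esub> (c x \<odot>\<^bsub>N\<^esub> F x)"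
        using fs(3) r by (simp add: free_module_def smult_assoc1)
    qed (use fs r assms(2) in \<open>auto simp: Pi_iff subset_iff\<close>)
    also have "\<dots> = r \<odot>\<^bsub>N\<^esub> (\<Oplus>\<^bsub>N\<^esub>x\<in>?T. c x \<odot>\<^bsub>N\<^esub> F x)"
      by (intro finsum_smult_ldistr[symmetric]) (use fs r assms(2) in \<open>auto simp: Pi_iff subset_iff\<close>)
    finally show ?thesis by (simp add: lin_ext_def)
  qed
  show ?thesis unfolding module_hom_def using cl add sm by auto
qed

lemma lin_ext_basis:
  assumes "module R N" "F \<in> X \<rightarrow> carrier N" "x \<in> X"
  shows "lin_ext R id N F (basis_elt R x) = F x"
proof -
  interpret module R N by fact
  have Fx: "F x \<in> carrier N" using assms by auto
  have "lin_ext R id N F (basis_elt R x) = (\<Oplus>\<^bsub>N\<^esub>y\<in>{x}. basis_elt R x y \<odot>\<^bsub>N\<^esub> F y)"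
    by (intro lin_ext_superset[OF assms(1,2)] basis_elt_closed R.is_cring assms)
      (auto simp: basis_elt_def assms)
  also have "\<dots> = F x" using Fx by (simp add: basis_elt_def)
  finally show ?thesis .
qed

lemma module_hom_finsum:
  assumes "module R M" "module R N" "f \<in> module_hom R M N" "finite T" "g \<in> T \<rightarrow> carrier M"
  shows "f (\<Oplus>\<^bsub>M\<^esub>x\<in>T. g x) = (\<Oplus>\<^bsub>N\<^esub>x\<in>T. f (g x))"
proof -
  interpret mod_hom R M N f using assms by (simp add: mod_hom_def mod_hom_axioms_def)
  show ?thesis using assms(4,5)
  proof (induction T)
    case (insert x T)
    then have "f (g x) \<in> carrier N" "(\<lambda>x. f (g x)) \<in> T \<rightarrow> carrier N"
      using f_hom by (auto simp: module_hom_def)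
    then show ?case using insert by simp
  qed simp
qed

lemma free_expand:
  assumes "cring R" "c \<in> carrier (free_module R X)"
  shows "c = lin_ext R id (free_module R X) (basis_elt R) c"
proof -
  interpret R: cring R by fact
  interpret F: module R "free_module R X" by (rule free_module_module) fact
  have key: "(\<Oplus>\<^bsub>free_module R X\<^esub>x\<in>T. c x \<odot>\<^bsub>free_module R X\<^esub> basis_elt R x) = (\<lambda>x. if x \<in> T then c x else \<zero>\<^bsub>R\<^esub>)"
    if "finite T" "T \<subseteq> X" for T using that
  proof (induction T)
    case empty then show ?case by (simp, simp add: free_module_def)
  next
    case (insert x T)
    note cR = free_supp(3)[OF assms(2)]
    have b: "(\<lambda>x. c x \<odot>\<^bsub>free_module R X\<^esub> basis_elt R x) \<in> T \<rightarrow> carrier (free_module R X)"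
      "c x \<odot>\<^bsub>free_module R X\<^esub> basis_elt R x \<in> carrier (free_module R X)"
      using insert cR by (auto intro!: F.smult_closed basis_elt_closed assms)
    show ?case using insert b cR
      by (simp add: F.finsum_insert) (auto simp: free_module_def basis_elt_def fun_eq_iff)
  qed
  show ?thesis unfolding lin_ext_def id_def
    using key[OF free_supp(1,2)[OF assms(2)]] by auto
qed

lemma free_hom_ext:
  assumes "module R N" "f \<in> module_hom R (free_module R X) N" "c \<in> carrier (free_module R X)"
  shows "f c = lin_ext R id N (\<lambda>x. f (basis_elt R x)) c"
proof -
  interpret module R N by fact
  interpret F: module R "free_module R X" by (rule free_module_module) unfold_locales
  note fs = free_supp[OF assms(3)]
  have "f c = f (lin_ext R id (free_module R X) (basis_elt R) c)"
    using free_expand[OF R.is_cring assms(3)] by simp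
  also have "\<dots> = (\<Oplus>\<^bsub>N\<^esub>x\<in>{x. c x \<noteq> \<zero>\<^bsub>R\<^esub>}. f (c x \<odot>\<^bsub>free_module R X\<^esub> basis_elt R x))"
    unfolding lin_ext_def id_def
    by (intro module_hom_finsum[OF F.module_axioms module_axioms assms(2)] fs)
      (use fs in \<open>auto intro!: F.smult_closed basis_elt_closed R.is_cring\<close>)
  also have "\<dots> = (\<Oplus>\<^bsub>N\<^esub>x\<in>{x. c x \<noteq> \<zero>\<^bsub>R\<^esub>}. c x \<odot>\<^bsub>N\<^esub> f (basis_elt R x))"
  proof (rule M.add.finprod_cong')
    fix x assume "x \<in> {x. c x \<noteq> \<zero>\<^bsub>R\<^esub>}"
    then have "basis_elt R x \<in> carrier (free_module R X)" using fs by (auto intro!: basis_elt_closed R.is_cring)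
    then show "f (c x \<odot>\<^bsub>free_module R X\<^esub> basis_elt R x) = c x \<odot>\<^bsub>N\<^esub> f (basis_elt R x)"
      using assms(2) fs(3) by (auto simp: module_hom_def)
  next
    show "(\<lambda>x. c x \<odot>\<^bsub>N\<^esub> f (basis_elt R x)) \<in> {x. c x \<noteq> \<zero>\<^bsub>R\<^esub>} \<rightarrow> carrier N"
    proof
      fix x assume "x \<in> {x. c x \<noteq> \<zero>\<^bsub>R\<^esub>}"
      then have "basis_elt R x \<in> carrier (free_module R X)" using fs by (auto intro!: basis_elt_closed R.is_cring)
      then show "c x \<odot>\<^bsub>N\<^esub> f (basis_elt R x) \<in> carrier N" using assms(2) fs(3) by (auto simp: module_hom_def)
    qed
  qed simp
  finally show ?thesis by (simp add: lin_ext_def)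
qed

lemma pres_rel_submodule:
  assumes "cring R" "P \<subseteq> carrier (free_module R X)"
  shows "submodule R (pres_rel R X P) (free_module R X)" "P \<subseteq> pres_rel R X P"
proof -
  interpret F: module R "free_module R X" by (rule free_module_module) fact
  show "submodule R (pres_rel R X P) (free_module R X)" "P \<subseteq> pres_rel R X P"
    unfolding pres_rel_def using F.span_is_submodule F.in_own_span assms by auto
qed

lemma pres_module:
  assumes "cring R" "P \<subseteq> carrier (free_module R X)"
  shows "module R (pres R X P)"
  unfolding pres_def
  by (intro quot_module_module free_module_module pres_rel_submodule assms)

lemma pres_gen_closed:
  assumes "cring R" "x \<in> X"
  shows "pres_gen R X P x \<in> carrier (pres R X P)"
  unfolding pres_gen_def pres_def quot_carrier using basis_elt_closed[OF assms] by auto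

lemma pres_map_coset:
  assumes "module R N" "F \<in> X \<rightarrow> carrier N" "P \<subseteq> carrier (free_module R X)"
    "\<And>p. p \<in> P \<Longrightarrow> lin_ext R id N F p = \<zero>\<^bsub>N\<^esub>" "c \<in> carrier (free_module R X)"
  shows "pres_map R id N F (pres_rel R X P +>\<^bsub>free_module R X\<^esub> c) = lin_ext R id N F c"
proof -
  interpret module R N by fact
  interpret F: module R "free_module R X" by (rule free_module_module) unfold_locales
  let ?f = "lin_ext R id N F"
  interpret f: mod_hom R "free_module R X" N ?f
    using lin_ext_hom[OF assms(1,2)] by unfold_locales
  interpret W: submodule R "pres_rel R X P" "free_module R X"
    by (rule pres_rel_submodule) (use R.is_cring assms in auto)
  have "pres_rel R X P \<subseteq> f.ker" unfolding pres_rel_def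
    by (rule F.span_is_subset) (use f.ker_is_submodule assms in \<open>auto simp: f.ker_def\<close>)
  then have W0: "?f x = \<zero>\<^bsub>N\<^esub>" if "x \<in> pres_rel R X P" for x using that by (auto simp: f.ker_def)
  have "?f ` (pres_rel R X P +>\<^bsub>free_module R X\<^esub> c) = (\<lambda>x. ?f (x \<oplus>\<^bsub>free_module R X\<^esub> c)) ` pres_rel R X P"
    by (auto simp: a_r_coset_def')
  also have "\<dots> = (\<lambda>x. ?f c) ` pres_rel R X P"
  proof (rule image_cong)
    fix x assume x: "x \<in> pres_rel R X P"
    then have xc: "x \<in> carrier (free_module R X)" using W.subset by auto
    have "?f (x \<oplus>\<^bsub>free_module R X\<^esub> c) = ?f x \<oplus>\<^bsub>N\<^esub> ?f c"
      using xc assms(5) f.f_hom by (simp add: module_hom_def)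
    also have "\<dots> = ?f c" using W0[OF x] assms(5) f.f_hom by (auto simp: module_hom_def)
    finally show "?f (x \<oplus>\<^bsub>free_module R X\<^esub> c) = ?f c" .
  qed simp
  also have "\<dots> = {?f c}" by (rule image_constant[OF W.zero_closed])
  finally show ?thesis by (simp add: pres_map_def)
qed

lemma pres_map:
  assumes "module R N" "F \<in> X \<rightarrow> carrier N" "P \<subseteq> carrier (free_module R X)"
    "\<And>p. p \<in> P \<Longrightarrow> lin_ext R id N F p = \<zero>\<^bsub>N\<^esub>"
  shows "pres_map R id N F \<in> module_hom R (pres R X P) N"
    "x \<in> X \<Longrightarrow> pres_map R id N F (pres_gen R X P x) = F x"
proof -
  interpret module R N by fact
  have F: "module R (free_module R X)" by (rule free_module_module) unfold_locales
  have W: "submodule R (pres_rel R X P) (free_module R X)"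
    by (rule pres_rel_submodule) (use R.is_cring assms in auto)
  have h: "lin_ext R id N F \<in> module_hom R (free_module R X) N" by (rule lin_ext_hom) fact+
  interpret F: module R "free_module R X" by fact
  show "pres_map R id N F \<in> module_hom R (pres R X P) N"
    unfolding module_hom_def pres_def quot_carrier using h
    by (auto simp: quot_add[OF F W] quot_smult[OF F W] pres_map_coset[OF assms] module_hom_def)
  show "pres_map R id N F (pres_gen R X P x) = F x" if "x \<in> X"
    unfolding pres_gen_def using that basis_elt_closed[OF R.is_cring that] lin_ext_basis[OF assms(1,2) that]
    by (simp add: pres_map_coset[OF assms])
qed

lemma pres_hom_eqI:
  fixes N :: "('r, 'n) module"
  assumes "module R N" "P \<subseteq> carrier (free_module R X)"
    "f \<in> module_hom R (pres R X P) N" "g \<in> module_hom R (pres R X P) N"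
    "\<And>x. x \<in> X \<Longrightarrow> f (pres_gen R X P x) = g (pres_gen R X P x)" "z \<in> carrier (pres R X P)"
  shows "f z = g z"
proof -
  interpret module R N by fact
  have F: "module R (free_module R X)" by (rule free_module_module) unfold_locales
  have W: "submodule R (pres_rel R X P) (free_module R X)"
    by (rule pres_rel_submodule) (use R.is_cring assms in auto)
  let ?q = "\<lambda>c. pres_rel R X P +>\<^bsub>free_module R X\<^esub> c"
  have q: "?q \<in> module_hom R (free_module R X) (pres R X P)"
    unfolding pres_def by (rule quot_proj_hom[OF F W])
  have comp: "(\<lambda>c. h (?q c)) \<in> module_hom R (free_module R X) N" if "h \<in> module_hom R (pres R X P) N" for h
    using that q unfolding module_hom_def by (auto simp: Pi_iff)
  obtain c where c: "c \<in> carrier (free_module R X)" "z = ?q c"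
    using assms(6) by (auto simp: pres_def quot_carrier)
  have eq: "f (?q (basis_elt R x)) = g (?q (basis_elt R x))" if "x \<in> X" for x
    using assms(5)[OF that] by (simp add: pres_gen_def)
  have "f z = lin_ext R id N (\<lambda>x. f (?q (basis_elt R x))) c"
    using free_hom_ext[OF assms(1) comp[OF assms(3)] c(1)] c(2) by simp
  also have "\<dots> = lin_ext R id N (\<lambda>x. g (?q (basis_elt R x))) c"
    unfolding lin_ext_def
  proof (rule M.add.finprod_cong')
    have "(\<lambda>x. g (?q (basis_elt R x))) \<in> X \<rightarrow> carrier N"
    proof
      fix x assume "x \<in> X"
      then show "g (?q (basis_elt R x)) \<in> carrier N"
        using comp[OF assms(4)] basis_elt_closed[OF R.is_cring, of x X]
        unfolding module_hom_def by blast
    qed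
    then show "(\<lambda>x. id (c x) \<odot>\<^bsub>N\<^esub> g (?q (basis_elt R x))) \<in> {x. c x \<noteq> \<zero>\<^bsub>R\<^esub>} \<rightarrow> carrier N"
      using free_supp[OF c(1)] by auto
  qed (use eq free_supp[OF c(1)] in auto)
  also have "\<dots> = g z"
    using free_hom_ext[OF assms(1) comp[OF assms(4)] c(1)] c(2) by simp
  finally show ?thesis .
qed


section \<open>The extension functors are adjoint to the restriction\<close>

lemma module_hom_in: "\<lbrakk>f \<in> module_hom R V W; x \<in> carrier V\<rbrakk> \<Longrightarrow> f x \<in> carrier W"
  by (auto simp: module_hom_def)

lemma module_hom_restrict:
  assumes "module R V" "f \<in> module_hom R V W"
  shows "restrict f (carrier V) \<in> module_hom R V W"
proof -
  interpret module R V by fact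
  show ?thesis using assms(2) by (auto simp: module_hom_def)
qed

lemma module_hom_add_hom:
  assumes "module R V" "module R W" "f \<in> module_hom R V W" "g \<in> module_hom R V W"
  shows "(\<lambda>x. f x \<oplus>\<^bsub>W\<^esub> g x) \<in> module_hom R V W"
proof -
  interpret V: module R V by fact
  interpret W: module R W by fact
  show ?thesis using assms(3,4)
    by (auto simp: module_hom_def W.smult_r_distr Pi_iff W.M.a_ac)
qed

lemma module_hom_smult_hom:
  assumes "module R V" "module R W" "f \<in> module_hom R V W" "r \<in> carrier R"
  shows "(\<lambda>x. r \<odot>\<^bsub>W\<^esub> f x) \<in> module_hom R V W"
proof -
  interpret V: module R V by fact
  interpret W: module R W by fact
  have "r \<odot>\<^bsub>W\<^esub> (s \<odot>\<^bsub>W\<^esub> y) = s \<odot>\<^bsub>W\<^esub> (r \<odot>\<^bsub>W\<^esub> y)"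
    if "s \<in> carrier R" "y \<in> carrier W" for s y
    using that assms(4) by (metis W.smult_assoc1 V.R.m_comm)
  then show ?thesis using assms(3,4)
    by (auto simp: module_hom_def W.smult_r_distr Pi_iff)
qed

lemma module_hom_zero:
  assumes "module R V" "module R W" "f \<in> module_hom R V W"
  shows "f \<zero>\<^bsub>V\<^esub> = \<zero>\<^bsub>W\<^esub>"
proof -
  interpret mod_hom R V W f using assms by (simp add: mod_hom_def mod_hom_axioms_def)
  show ?thesis by simp
qed

lemma module_hom_minus:
  assumes "module R V" "module R W" "f \<in> module_hom R V W" "x \<in> carrier V" "y \<in> carrier V"
  shows "f (x \<ominus>\<^bsub>V\<^esub> y) = f x \<ominus>\<^bsub>W\<^esub> f y"
proof -
  interpret mod_hom R V W f using assms by (simp add: mod_hom_def mod_hom_axioms_def)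
  show ?thesis using assms by simp
qed

locale kan_data = k_category k C for k :: "'k ring" and C :: "('o, 'm, 'k) kcat" +
  fixes S :: "'o set" and M :: "('o, 'm, 'k, 'v) cmod"
  assumes S: "S \<subseteq> obj C" and M: "cat_module k (full_subcat C S) M"
begin

lemma sub_simps [simp]:
  "obj (full_subcat C S) = S" "homs (full_subcat C S) = homs C" "comp (full_subcat C S) = comp C"
  "ident (full_subcat C S) = ident C"
  by (simp_all add: full_subcat_def)

lemma S_obj [simp, intro]: "s \<in> S \<Longrightarrow> s \<in> obj C"
  using S by auto

lemma cring_k: "x \<in> obj C \<Longrightarrow> cring k"
  using hom_vs[of x x] by (simp add: vectorspace_def module_def)

lemma hom_mod: "\<lbrakk>a \<in> obj C; b \<in> obj C\<rbrakk> \<Longrightarrow> module k (homs C a b)"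
  using hom_vs by (simp add: vectorspace_def)

lemma M_mod: "s \<in> S \<Longrightarrow> module k (space M s)"
  using cat_module.space_vs[OF M] by (simp add: vectorspace_def)

lemma M_hom: "\<lbrakk>a \<in> S; b \<in> S; f \<in> carrier (homs C a b)\<rbrakk>
    \<Longrightarrow> act M a b f \<in> module_hom k (space M b) (space M a)"
  using cat_module.act_hom[OF M] by simp

lemma M_linear: "\<lbrakk>a \<in> S; b \<in> S; x \<in> carrier (space M b)\<rbrakk>
    \<Longrightarrow> (\<lambda>f. act M a b f x) \<in> module_hom k (homs C a b) (space M a)"
  using cat_module.act_linear[OF M] by simp

lemma M_ident: "\<lbrakk>a \<in> S; x \<in> carrier (space M a)\<rbrakk> \<Longrightarrow> act M a a (ident C a) x = x"
  using cat_module.act_ident[OF M] by simp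

lemma M_comp: "\<lbrakk>a \<in> S; b \<in> S; c \<in> S; f \<in> carrier (homs C a b);
        g \<in> carrier (homs C b c); x \<in> carrier (space M c)\<rbrakk>
      \<Longrightarrow> act M a c (comp C a b c g f) x = act M a b f (act M b c g x)"
  using cat_module.act_comp[OF M] by simp

lemma M_closed [intro]: "\<lbrakk>a \<in> S; b \<in> S; f \<in> carrier (homs C a b); x \<in> carrier (space M b)\<rbrakk>
    \<Longrightarrow> act M a b f x \<in> carrier (space M a)"
  using module_hom_in[OF M_hom] by simp

lemma comp_closed [intro]: "\<lbrakk>a \<in> obj C; b \<in> obj C; c \<in> obj C; f \<in> carrier (homs C a b);
    g \<in> carrier (homs C b c)\<rbrakk> \<Longrightarrow> comp C a b c g f \<in> carrier (homs C a c)"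
  using module_hom_in[OF comp_left] by simp

subsection \<open>The right adjoint\<close>

abbreviation "KR x \<equiv> space (K_R k C S M) x"

lemma KR_memD:
  assumes "\<phi> \<in> carrier (KR x)"
  shows "s \<in> S \<Longrightarrow> \<phi> s \<in> module_hom k (homs C s x) (space M s)"
    and "\<lbrakk>s \<in> S; t \<in> S; f \<in> carrier (homs C s t); g \<in> carrier (homs C t x)\<rbrakk>
      \<Longrightarrow> \<phi> s (comp C s t x g f) = act M s t f (\<phi> t g)"
    and "\<lbrakk>s \<in> S; g \<in> carrier (homs C s x)\<rbrakk> \<Longrightarrow> \<phi> s g \<in> carrier (space M s)"
    and "\<phi> \<in> extensional S" "s \<in> S \<Longrightarrow> \<phi> s \<in> extensional (carrier (homs C s x))"
proof -
  show *: "s \<in> S \<Longrightarrow> \<phi> s \<in> module_hom k (homs C s x) (space M s)" for s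
    using assms by (auto simp: K_R_def cmod_hom_def rep_mod_def)
  show "\<lbrakk>s \<in> S; g \<in> carrier (homs C s x)\<rbrakk> \<Longrightarrow> \<phi> s g \<in> carrier (space M s)"
    using module_hom_in[OF *] by simp
qed (use assms in \<open>auto simp: K_R_def cmod_hom_def rep_mod_def\<close>)

lemma KR_memI:
  assumes x: "x \<in> obj C" and hom: "\<And>s. s \<in> S \<Longrightarrow> F s \<in> module_hom k (homs C s x) (space M s)"
    and nat: "\<And>s t f g. \<lbrakk>s \<in> S; t \<in> S; f \<in> carrier (homs C s t); g \<in> carrier (homs C t x)\<rbrakk>
      \<Longrightarrow> F s (comp C s t x g f) = act M s t f (F t g)"
  shows "(\<lambda>s\<in>S. \<lambda>g\<in>carrier (homs C s x). F s g) \<in> carrier (KR x)"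
proof -
  have "restrict (F s) (carrier (homs C s x)) \<in> module_hom k (homs C s x) (space M s)" if "s \<in> S" for s
    by (rule module_hom_restrict[OF hom_mod hom]) (use that x in auto)
  then show ?thesis
    using x nat by (auto simp: K_R_def cmod_hom_def rep_mod_def)
qed

lemma KR_eqI:
  assumes "\<phi> \<in> carrier (KR x)" "\<psi> \<in> carrier (KR x)"
    "\<And>s g. \<lbrakk>s \<in> S; g \<in> carrier (homs C s x)\<rbrakk> \<Longrightarrow> \<phi> s g = \<psi> s g"
  shows "\<phi> = \<psi>"
proof (rule extensionalityI[OF KR_memD(4)[OF assms(1)] KR_memD(4)[OF assms(2)]])
  fix s assume "s \<in> S"
  then show "\<phi> s = \<psi> s"
    using extensionalityI[OF KR_memD(5)[OF assms(1)] KR_memD(5)[OF assms(2)]] assms(3) by blast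
qed

lemma KR_apply:
  assumes "s \<in> S" "g \<in> carrier (homs C s x)"
  shows "(\<phi> \<oplus>\<^bsub>KR x\<^esub> \<psi>) s g = \<phi> s g \<oplus>\<^bsub>space M s\<^esub> \<psi> s g"
    and "(r \<odot>\<^bsub>KR x\<^esub> \<phi>) s g = r \<odot>\<^bsub>space M s\<^esub> \<phi> s g"
    and "\<zero>\<^bsub>KR x\<^esub> s g = \<zero>\<^bsub>space M s\<^esub>"
  using assms by (simp_all add: K_R_def)

lemma KR_closed:
  assumes x: "x \<in> obj C"
  shows "\<lbrakk>\<phi> \<in> carrier (KR x); \<psi> \<in> carrier (KR x)\<rbrakk> \<Longrightarrow> \<phi> \<oplus>\<^bsub>KR x\<^esub> \<psi> \<in> carrier (KR x)"
    and "\<lbrakk>r \<in> carrier k; \<phi> \<in> carrier (KR x)\<rbrakk> \<Longrightarrow> r \<odot>\<^bsub>KR x\<^esub> \<phi> \<in> carrier (KR x)"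
    and "\<zero>\<^bsub>KR x\<^esub> \<in> carrier (KR x)"
proof -
  assume p: "\<phi> \<in> carrier (KR x)"
  { assume q: "\<psi> \<in> carrier (KR x)"
    have "(\<lambda>s\<in>S. \<lambda>g\<in>carrier (homs C s x). \<phi> s g \<oplus>\<^bsub>space M s\<^esub> \<psi> s g) \<in> carrier (KR x)"
    proof (rule KR_memI[OF x])
      show "(\<lambda>g. \<phi> s g \<oplus>\<^bsub>space M s\<^esub> \<psi> s g) \<in> module_hom k (homs C s x) (space M s)" if "s \<in> S" for s
        using that x by (intro module_hom_add_hom hom_mod M_mod KR_memD(1)[OF p] KR_memD(1)[OF q]) auto
      fix s t f g assume a: "s \<in> S" "t \<in> S" "f \<in> carrier (homs C s t)" "g \<in> carrier (homs C t x)"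
      then show "\<phi> s (comp C s t x g f) \<oplus>\<^bsub>space M s\<^esub> \<psi> s (comp C s t x g f)
          = act M s t f (\<phi> t g \<oplus>\<^bsub>space M t\<^esub> \<psi> t g)"
        using KR_memD(2,3)[OF p] KR_memD(2,3)[OF q] M_hom[OF a(1,2,3)]
        by (simp add: module_hom_def)
    qed
    then show "\<phi> \<oplus>\<^bsub>KR x\<^esub> \<psi> \<in> carrier (KR x)" by (simp add: K_R_def) }
  { assume r: "r \<in> carrier k"
    have "(\<lambda>s\<in>S. \<lambda>g\<in>carrier (homs C s x). r \<odot>\<^bsub>space M s\<^esub> \<phi> s g) \<in> carrier (KR x)"
    proof (rule KR_memI[OF x])
      show "(\<lambda>g. r \<odot>\<^bsub>space M s\<^esub> \<phi> s g) \<in> module_hom k (homs C s x) (space M s)" if "s \<in> S" for s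
        using that x r by (intro module_hom_smult_hom hom_mod M_mod KR_memD(1)[OF p]) auto
      fix s t f g assume a: "s \<in> S" "t \<in> S" "f \<in> carrier (homs C s t)" "g \<in> carrier (homs C t x)"
      then show "r \<odot>\<^bsub>space M s\<^esub> \<phi> s (comp C s t x g f) = act M s t f (r \<odot>\<^bsub>space M t\<^esub> \<phi> t g)"
        using KR_memD(2,3)[OF p] M_hom[OF a(1,2,3)] r by (simp add: module_hom_def)
    qed
    then show "r \<odot>\<^bsub>KR x\<^esub> \<phi> \<in> carrier (KR x)" by (simp add: K_R_def) }
next
  have "(\<lambda>s\<in>S. \<lambda>g\<in>carrier (homs C s x). \<zero>\<^bsub>space M s\<^esub>) \<in> carrier (KR x)"
  proof (rule KR_memI[OF x])
    show "(\<lambda>g. \<zero>\<^bsub>space M s\<^esub>) \<in> module_hom k (homs C s x) (space M s)" if "s \<in> S" for s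
    proof -
      interpret module k "space M s" using M_mod that by simp
      show ?thesis by (auto simp: module_hom_def)
    qed
    fix s t f g assume a: "s \<in> S" "t \<in> S" "f \<in> carrier (homs C s t)" "g \<in> carrier (homs C t x)"
    show "\<zero>\<^bsub>space M s\<^esub> = act M s t f \<zero>\<^bsub>space M t\<^esub>"
      using module_hom_zero[OF M_mod M_mod M_hom] a by simp
  qed
  then show "\<zero>\<^bsub>KR x\<^esub> \<in> carrier (KR x)" by (simp add: K_R_def)
qed

lemma KR_module: assumes x: "x \<in> obj C" shows "module k (KR x)"
proof -
  interpret k: cring k using cring_k x by simp
  note mem = KR_closed[OF x]
  have Mod: "module k (space M s)" if "s \<in> S" for s using M_mod that .
  note ev = KR_apply KR_memD(3)
  have grp: "abelian_group (KR x)"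
  proof (rule abelian_groupI)
    show "\<phi> \<oplus>\<^bsub>KR x\<^esub> \<psi> \<oplus>\<^bsub>KR x\<^esub> \<chi> = \<phi> \<oplus>\<^bsub>KR x\<^esub> (\<psi> \<oplus>\<^bsub>KR x\<^esub> \<chi>)"
      if "\<phi> \<in> carrier (KR x)" "\<psi> \<in> carrier (KR x)" "\<chi> \<in> carrier (KR x)" for \<phi> \<psi> \<chi>
    proof (rule KR_eqI)
      fix s g assume s: "s \<in> S" and g: "g \<in> carrier (homs C s x)"
      interpret module k "space M s" using Mod s .
      show "(\<phi> \<oplus>\<^bsub>KR x\<^esub> \<psi> \<oplus>\<^bsub>KR x\<^esub> \<chi>) s g = (\<phi> \<oplus>\<^bsub>KR x\<^esub> (\<psi> \<oplus>\<^bsub>KR x\<^esub> \<chi>)) s g"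
        using that s g by (simp add: ev M.a_assoc)
    qed (use that mem in auto)
    show "\<phi> \<oplus>\<^bsub>KR x\<^esub> \<psi> = \<psi> \<oplus>\<^bsub>KR x\<^esub> \<phi>"
      if "\<phi> \<in> carrier (KR x)" "\<psi> \<in> carrier (KR x)" for \<phi> \<psi>
    proof (rule KR_eqI)
      fix s g assume s: "s \<in> S" and g: "g \<in> carrier (homs C s x)"
      interpret module k "space M s" using Mod s .
      show "(\<phi> \<oplus>\<^bsub>KR x\<^esub> \<psi>) s g = (\<psi> \<oplus>\<^bsub>KR x\<^esub> \<phi>) s g"
        using that s g by (simp add: ev M.a_comm)
    qed (use that mem in auto)
    show "\<zero>\<^bsub>KR x\<^esub> \<oplus>\<^bsub>KR x\<^esub> \<phi> = \<phi>" if "\<phi> \<in> carrier (KR x)" for \<phi>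
    proof (rule KR_eqI)
      fix s g assume s: "s \<in> S" and g: "g \<in> carrier (homs C s x)"
      interpret module k "space M s" using Mod s .
      show "(\<zero>\<^bsub>KR x\<^esub> \<oplus>\<^bsub>KR x\<^esub> \<phi>) s g = \<phi> s g"
        using that s g by (simp add: ev)
    qed (use that mem in auto)
    show "\<exists>\<psi>\<in>carrier (KR x). \<psi> \<oplus>\<^bsub>KR x\<^esub> \<phi> = \<zero>\<^bsub>KR x\<^esub>" if "\<phi> \<in> carrier (KR x)" for \<phi>
    proof (rule bexI[of _ "(\<ominus>\<^bsub>k\<^esub> \<one>\<^bsub>k\<^esub>) \<odot>\<^bsub>KR x\<^esub> \<phi>"], rule KR_eqI)
      fix s g assume s: "s \<in> S" and g: "g \<in> carrier (homs C s x)"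
      interpret module k "space M s" using Mod s .
      show "((\<ominus>\<^bsub>k\<^esub> \<one>\<^bsub>k\<^esub>) \<odot>\<^bsub>KR x\<^esub> \<phi> \<oplus>\<^bsub>KR x\<^esub> \<phi>) s g = \<zero>\<^bsub>KR x\<^esub> s g"
        using that s g by (simp add: ev smult_minus_1 M.l_neg)
    qed (use that mem in auto)
  qed (use mem in auto)
  show ?thesis
  proof (rule moduleI[OF k.is_cring grp])
    show "(a \<oplus>\<^bsub>k\<^esub> b) \<odot>\<^bsub>KR x\<^esub> \<phi> = a \<odot>\<^bsub>KR x\<^esub> \<phi> \<oplus>\<^bsub>KR x\<^esub> b \<odot>\<^bsub>KR x\<^esub> \<phi>"
      if "a \<in> carrier k" "b \<in> carrier k" "\<phi> \<in> carrier (KR x)" for a b \<phi>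
    proof (rule KR_eqI)
      fix s g assume s: "s \<in> S" and g: "g \<in> carrier (homs C s x)"
      interpret module k "space M s" using Mod s .
      show "((a \<oplus>\<^bsub>k\<^esub> b) \<odot>\<^bsub>KR x\<^esub> \<phi>) s g = (a \<odot>\<^bsub>KR x\<^esub> \<phi> \<oplus>\<^bsub>KR x\<^esub> b \<odot>\<^bsub>KR x\<^esub> \<phi>) s g"
        using that s g by (simp add: ev smult_l_distr)
    qed (use that mem in auto)
    show "a \<odot>\<^bsub>KR x\<^esub> (\<phi> \<oplus>\<^bsub>KR x\<^esub> \<psi>) = a \<odot>\<^bsub>KR x\<^esub> \<phi> \<oplus>\<^bsub>KR x\<^esub> a \<odot>\<^bsub>KR x\<^esub> \<psi>"
      if "a \<in> carrier k" "\<phi> \<in> carrier (KR x)" "\<psi> \<in> carrier (KR x)" for a \<phi> \<psi>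
    proof (rule KR_eqI)
      fix s g assume s: "s \<in> S" and g: "g \<in> carrier (homs C s x)"
      interpret module k "space M s" using Mod s .
      show "(a \<odot>\<^bsub>KR x\<^esub> (\<phi> \<oplus>\<^bsub>KR x\<^esub> \<psi>)) s g = (a \<odot>\<^bsub>KR x\<^esub> \<phi> \<oplus>\<^bsub>KR x\<^esub> a \<odot>\<^bsub>KR x\<^esub> \<psi>) s g"
        using that s g by (simp add: ev smult_r_distr)
    qed (use that mem in auto)
    show "(a \<otimes>\<^bsub>k\<^esub> b) \<odot>\<^bsub>KR x\<^esub> \<phi> = a \<odot>\<^bsub>KR x\<^esub> (b \<odot>\<^bsub>KR x\<^esub> \<phi>)"
      if "a \<in> carrier k" "b \<in> carrier k" "\<phi> \<in> carrier (KR x)" for a b \<phi>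
    proof (rule KR_eqI)
      fix s g assume s: "s \<in> S" and g: "g \<in> carrier (homs C s x)"
      interpret module k "space M s" using Mod s .
      show "((a \<otimes>\<^bsub>k\<^esub> b) \<odot>\<^bsub>KR x\<^esub> \<phi>) s g = (a \<odot>\<^bsub>KR x\<^esub> (b \<odot>\<^bsub>KR x\<^esub> \<phi>)) s g"
        using that s g by (simp add: ev smult_assoc1)
    qed (use that mem in auto)
    show "\<one>\<^bsub>k\<^esub> \<odot>\<^bsub>KR x\<^esub> \<phi> = \<phi>" if "\<phi> \<in> carrier (KR x)" for \<phi>
    proof (rule KR_eqI)
      fix s g assume s: "s \<in> S" and g: "g \<in> carrier (homs C s x)"
      interpret module k "space M s" using Mod s .
      show "(\<one>\<^bsub>k\<^esub> \<odot>\<^bsub>KR x\<^esub> \<phi>) s g = \<phi> s g"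
        using that s g by (simp add: ev)
    qed (use that mem in auto)
  qed (use mem in auto)
qed

lemma KR_act_closed:
  assumes "x \<in> obj C" "y \<in> obj C" "f \<in> carrier (homs C x y)" "\<phi> \<in> carrier (KR y)"
  shows "act (K_R k C S M) x y f \<phi> \<in> carrier (KR x)"
proof -
  have "(\<lambda>s\<in>S. \<lambda>g\<in>carrier (homs C s x). \<phi> s (comp C s x y f g)) \<in> carrier (KR x)"
  proof (rule KR_memI[OF assms(1)])
    show "(\<lambda>g. \<phi> s (comp C s x y f g)) \<in> module_hom k (homs C s x) (space M s)" if "s \<in> S" for s
      using comp_left[OF S_obj[OF that] assms(1,2,3)] KR_memD(1)[OF assms(4) that]
      by (auto simp: module_hom_def Pi_iff)
    fix s t h g assume a: "s \<in> S" "t \<in> S" "h \<in> carrier (homs C s t)" "g \<in> carrier (homs C t x)"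
    have "\<phi> s (comp C s x y f (comp C s t x g h)) = \<phi> s (comp C s t y (comp C t x y f g) h)"
      using comp_assoc[of s t x y h g f] a assms by simp
    also have "\<dots> = act M s t h (\<phi> t (comp C t x y f g))"
      using KR_memD(2)[OF assms(4) a(1,2,3), of "comp C t x y f g"] a assms by auto
    finally show "\<phi> s (comp C s x y f (comp C s t x g h)) = act M s t h (\<phi> t (comp C t x y f g))" .
  qed
  then show ?thesis by (simp add: K_R_def)
qed

lemma KR_act_apply:
  assumes "s \<in> S" "g \<in> carrier (homs C s x)"
  shows "act (K_R k C S M) x y f \<phi> s g = \<phi> s (comp C s x y f g)"
  using assms by (simp add: K_R_def)

lemma K_R_cat_module: "cat_module k C (K_R k C S M)"
proof (rule cat_module.intro)
  show "vectorspace k (KR x)" if "x \<in> obj C" for x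
    using KR_module[OF that] hom_vs[OF that that] by (simp add: vectorspace_def)
next
  fix x y f assume x: "x \<in> obj C" and y: "y \<in> obj C" and f: "f \<in> carrier (homs C x y)"
  note cl = KR_act_closed[OF x y f] and mx = KR_closed[OF x] and my = KR_closed[OF y]
  show "act (K_R k C S M) x y f \<in> module_hom k (KR y) (KR x)"
    unfolding module_hom_def
    using cl mx my x y f
    by (auto intro!: KR_eqI[of _ x] simp: KR_act_apply KR_apply comp_closed)
next
  fix x y \<phi> assume x: "x \<in> obj C" and y: "y \<in> obj C" and p: "\<phi> \<in> carrier (KR y)"
  note cl = KR_act_closed[OF x y _ p] and mx = KR_closed[OF x]
  interpret H: module k "homs C x y" using hom_mod x y by auto
  have "\<phi> s (comp C s x y (f \<oplus>\<^bsub>homs C x y\<^esub> f') g) = \<phi> s (comp C s x y f g) \<oplus>\<^bsub>space M s\<^esub> \<phi> s (comp C s x y f' g)"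
    "r \<in> carrier k \<Longrightarrow> \<phi> s (comp C s x y (r \<odot>\<^bsub>homs C x y\<^esub> f) g) = r \<odot>\<^bsub>space M s\<^esub> \<phi> s (comp C s x y f g)"
    if "s \<in> S" "g \<in> carrier (homs C s x)" "f \<in> carrier (homs C x y)" "f' \<in> carrier (homs C x y)" for s f f' g r
    using comp_right[OF S_obj[OF that(1)] x y that(2)] KR_memD(1)[OF p that(1)] that
    by (auto simp: module_hom_def Pi_iff)
  then show "(\<lambda>f. act (K_R k C S M) x y f \<phi>) \<in> module_hom k (homs C x y) (KR x)"
    unfolding module_hom_def
    using cl mx x y
    by (auto intro!: KR_eqI[of _ x] simp: KR_act_apply KR_apply comp_closed)
next
  fix x \<phi> assume x: "x \<in> obj C" and p: "\<phi> \<in> carrier (KR x)"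
  show "act (K_R k C S M) x x (ident C x) \<phi> = \<phi>"
    by (rule KR_eqI[of _ x]) (use x p KR_act_closed ident_closed ident_left in \<open>auto simp: KR_act_apply\<close>)
next
  fix x y z f g \<phi> assume x: "x \<in> obj C" and y: "y \<in> obj C" and z: "z \<in> obj C"
    and f: "f \<in> carrier (homs C x y)" and g: "g \<in> carrier (homs C y z)" and p: "\<phi> \<in> carrier (KR z)"
  show "act (K_R k C S M) x z (comp C x y z g f) \<phi> = act (K_R k C S M) x y f (act (K_R k C S M) y z g \<phi>)"
  proof (rule KR_eqI[of _ x])
    fix s h assume a: "s \<in> S" "h \<in> carrier (homs C s x)"
    then show "act (K_R k C S M) x z (comp C x y z g f) \<phi> s h =
        act (K_R k C S M) x y f (act (K_R k C S M) y z g \<phi>) s h"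
      using comp_assoc[of s x y z h f g] x y z f g by (simp add: KR_act_apply comp_closed)
  qed (use x y z f g p KR_act_closed comp_closed in auto)
qed

lemma K_R_counit_hom: "K_R_counit C \<in> cmod_hom k (full_subcat C S) (K_R k C S M) M"
proof -
  have "K_R_counit C s (act (K_R k C S M) s t f \<phi>) = act M s t f (K_R_counit C t \<phi>)"
    if "s \<in> S" "t \<in> S" "f \<in> carrier (homs C s t)" "\<phi> \<in> carrier (KR t)" for s t f \<phi>
    using KR_memD(2)[OF that(4,1,2,3), of "ident C t"] that ident_left ident_right ident_closed
    by (simp add: K_R_counit_def KR_act_apply)
  moreover have "K_R_counit C s \<in> module_hom k (KR s) (space M s)" if "s \<in> S" for s
    using that ident_closed KR_memD(3)[of _ s s "ident C s"]
    by (auto simp: module_hom_def K_R_counit_def KR_apply)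
  ultimately show ?thesis by (simp add: cmod_hom_def)
qed

text \<open>The universal property of the counit: \<open>K_R\<close> is right adjoint to the restriction.\<close>

theorem K_R_universal:
  assumes N: "cat_module k C N" and \<beta>: "\<beta> \<in> cmod_hom k (full_subcat C S) N M"
  shows "\<exists>\<alpha>\<in>cmod_hom k C N (K_R k C S M).
      \<forall>s\<in>S. \<forall>x\<in>carrier (space N s). K_R_counit C s (\<alpha> s x) = \<beta> s x"
    and "\<lbrakk>\<alpha> \<in> cmod_hom k C N (K_R k C S M); \<alpha>' \<in> cmod_hom k C N (K_R k C S M);
       \<forall>s\<in>S. \<forall>x\<in>carrier (space N s). K_R_counit C s (\<alpha> s x) = K_R_counit C s (\<alpha>' s x);
       a \<in> obj C; z \<in> carrier (space N a)\<rbrakk> \<Longrightarrow> \<alpha> a z = \<alpha>' a z"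
proof -
  interpret N: cat_module k C N by fact
  have \<beta>h: "\<beta> s \<in> module_hom k (space N s) (space M s)" if "s \<in> S" for s
    using \<beta> that by (simp add: cmod_hom_def)
  have \<beta>n: "\<beta> s (act N s t f z) = act M s t f (\<beta> t z)"
    if "s \<in> S" "t \<in> S" "f \<in> carrier (homs C s t)" "z \<in> carrier (space N t)" for s t f z
    using \<beta> that by (simp add: cmod_hom_def)
  define \<alpha> where "\<alpha> = (\<lambda>a z. \<lambda>s\<in>S. \<lambda>g\<in>carrier (homs C s a). \<beta> s (act N s a g z))"
  have \<alpha>_mem: "\<alpha> a z \<in> carrier (KR a)" if a: "a \<in> obj C" and z: "z \<in> carrier (space N a)" for a z
    unfolding \<alpha>_def
  proof (rule KR_memI[OF a])
    show "(\<lambda>g. \<beta> s (act N s a g z)) \<in> module_hom k (homs C s a) (space M s)" if "s \<in> S" for s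
      using N.act_linear[OF S_obj[OF that] a z] \<beta>h[OF that] by (auto simp: module_hom_def Pi_iff)
    fix s t f g assume b: "s \<in> S" "t \<in> S" "f \<in> carrier (homs C s t)" "g \<in> carrier (homs C t a)"
    have "act N t a g z \<in> carrier (space N t)"
      using module_hom_in[OF N.act_hom[of t a g]] b a z by auto
    then show "\<beta> s (act N s a (comp C s t a g f) z) = act M s t f (\<beta> t (act N t a g z))"
      using N.act_comp[of s t a f g z] b a z by (simp add: \<beta>n)
  qed
  have \<alpha>_ev: "\<alpha> a z s g = \<beta> s (act N s a g z)" if "s \<in> S" "g \<in> carrier (homs C s a)" for a z s g
    using that by (simp add: \<alpha>_def)
  have "\<alpha> \<in> cmod_hom k C N (K_R k C S M)"
    unfolding cmod_hom_def
  proof (intro CollectI conjI ballI)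
    fix a assume a: "a \<in> obj C"
    interpret Na: module k "space N a" using N.space_vs[OF a] by (simp add: vectorspace_def)
    have "\<beta> s (act N s a g (y \<oplus>\<^bsub>space N a\<^esub> z)) = \<beta> s (act N s a g y) \<oplus>\<^bsub>space M s\<^esub> \<beta> s (act N s a g z)"
      "r \<in> carrier k \<Longrightarrow> \<beta> s (act N s a g (r \<odot>\<^bsub>space N a\<^esub> z)) = r \<odot>\<^bsub>space M s\<^esub> \<beta> s (act N s a g z)"
      if "s \<in> S" "g \<in> carrier (homs C s a)" "y \<in> carrier (space N a)" "z \<in> carrier (space N a)" for s g y z r
      using N.act_hom[OF S_obj[OF that(1)] a that(2)] \<beta>h[OF that(1)] that
      by (auto simp: module_hom_def Pi_iff)
    then show "\<alpha> a \<in> module_hom k (space N a) (KR a)"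
      unfolding module_hom_def using \<alpha>_mem[OF a] KR_closed[OF a]
      by (auto intro!: KR_eqI[of _ a] simp: KR_apply \<alpha>_ev)
  next
    fix a b f z assume ab: "a \<in> obj C" "b \<in> obj C" "f \<in> carrier (homs C a b)" "z \<in> carrier (space N b)"
    have fz: "act N a b f z \<in> carrier (space N a)"
      using module_hom_in[OF N.act_hom[of a b f]] ab by auto
    show "\<alpha> a (act N a b f z) = act (K_R k C S M) a b f (\<alpha> b z)"
    proof (rule KR_eqI[of _ a])
      fix s g assume s: "s \<in> S" "g \<in> carrier (homs C s a)"
      then show "\<alpha> a (act N a b f z) s g = act (K_R k C S M) a b f (\<alpha> b z) s g"
        using N.act_comp[of s a b g f z] ab by (simp add: \<alpha>_ev KR_act_apply comp_closed)
    qed (use ab fz \<alpha>_mem KR_act_closed in auto)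
  qed
  moreover have "K_R_counit C s (\<alpha> s z) = \<beta> s z" if "s \<in> S" "z \<in> carrier (space N s)" for s z
    using that ident_closed N.act_ident by (simp add: K_R_counit_def \<alpha>_ev)
  ultimately show "\<exists>\<alpha>\<in>cmod_hom k C N (K_R k C S M).
      \<forall>s\<in>S. \<forall>x\<in>carrier (space N s). K_R_counit C s (\<alpha> s x) = \<beta> s x" by blast
next
  interpret N: cat_module k C N by fact
  assume h: "\<alpha> \<in> cmod_hom k C N (K_R k C S M)" "\<alpha>' \<in> cmod_hom k C N (K_R k C S M)"
    and eq: "\<forall>s\<in>S. \<forall>x\<in>carrier (space N s). K_R_counit C s (\<alpha> s x) = K_R_counit C s (\<alpha>' s x)"
    and a: "a \<in> obj C" "z \<in> carrier (space N a)"
  have mem: "\<gamma> a z \<in> carrier (KR a)" if "\<gamma> \<in> cmod_hom k C N (K_R k C S M)" for \<gamma>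
    using that a by (auto simp: cmod_hom_def module_hom_def)
  have ev: "\<gamma> a z s g = K_R_counit C s (\<gamma> s (act N s a g z))"
    if "\<gamma> \<in> cmod_hom k C N (K_R k C S M)" "s \<in> S" "g \<in> carrier (homs C s a)" for \<gamma> s g
    using that a ident_closed ident_right by (auto simp: cmod_hom_def K_R_counit_def KR_act_apply)
  show "\<alpha> a z = \<alpha>' a z"
  proof (rule KR_eqI[OF mem[OF h(1)] mem[OF h(2)]])
    fix s g assume s: "s \<in> S" "g \<in> carrier (homs C s a)"
    then have "act N s a g z \<in> carrier (space N s)"
      using module_hom_in[OF N.act_hom[of s a g]] a by auto
    then show "\<alpha> a z s g = \<alpha>' a z s g" using ev[OF h(1) s] ev[OF h(2) s] eq s by simp
  qed
qed

end

lemma module_hom_compose: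
  assumes "f \<in> module_hom R U V" "g \<in> module_hom R V W"
  shows "(\<lambda>x. g (f x)) \<in> module_hom R U W"
  using assms by (auto simp: module_hom_def Pi_iff)

lemma ball_comp4: "(\<forall>p\<in>{F a b c d |a b c d. P a b c d}. Q p) \<longleftrightarrow> (\<forall>a b c d. P a b c d \<longrightarrow> Q (F a b c d))"
  by blast

lemma ball_comp5: "(\<forall>p\<in>{F a b c d e |a b c d e. P a b c d e}. Q p) \<longleftrightarrow> (\<forall>a b c d e. P a b c d e \<longrightarrow> Q (F a b c d e))"
  by blast

context kan_data
begin

subsection \<open>The left adjoint\<close>

abbreviation "KLX x \<equiv> K_L_gens C S M x"
abbreviation "KLR x \<equiv> K_L_rels k C S M x"
abbreviation "KLF x \<equiv> free_module k (KLX x)"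
abbreviation "KL x \<equiv> space (K_L k C S M) x"
abbreviation "gen x \<equiv> K_L_gen k C S M x"

lemma KL_pres: "KL x = pres k (KLX x) (KLR x)"
  by (simp add: K_L_def)

lemma KLX_iff [simp]: "(s, g, m) \<in> KLX x \<longleftrightarrow> s \<in> S \<and> g \<in> carrier (homs C x s) \<and> m \<in> carrier (space M s)"
  by (simp add: K_L_gens_def)

lemma KLF_module: "x \<in> obj C \<Longrightarrow> module k (KLF x)"
  by (rule free_module_module[OF cring_k])

lemma e_closed: "\<lbrakk>x \<in> obj C; s \<in> S; g \<in> carrier (homs C x s); m \<in> carrier (space M s)\<rbrakk>
    \<Longrightarrow> basis_elt k (s, g, m) \<in> carrier (KLF x)"
  by (rule basis_elt_closed[OF cring_k]) auto

text \<open>The relations in the form in which a map out of the free module has to satisfy them.\<close>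

definition KL_bal :: "'o \<Rightarrow> ('k, 'n) module \<Rightarrow> ('o \<times> 'm \<times> 'v \<Rightarrow> 'n) \<Rightarrow> bool" where
  "KL_bal x N F \<longleftrightarrow>
     (\<forall>s\<in>S. \<forall>g\<in>carrier (homs C x s). (\<lambda>m. F (s, g, m)) \<in> module_hom k (space M s) N) \<and>
     (\<forall>s\<in>S. \<forall>m\<in>carrier (space M s). (\<lambda>g. F (s, g, m)) \<in> module_hom k (homs C x s) N) \<and>
     (\<forall>s\<in>S. \<forall>t\<in>S. \<forall>g\<in>carrier (homs C x s). \<forall>h\<in>carrier (homs C s t). \<forall>m\<in>carrier (space M t).
        F (t, comp C x s t h g, m) = F (s, g, act M s t h m))"

lemma KL_balD:
  assumes "KL_bal x N F"
  shows "\<lbrakk>s \<in> S; g \<in> carrier (homs C x s)\<rbrakk> \<Longrightarrow> (\<lambda>m. F (s, g, m)) \<in> module_hom k (space M s) N"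
    and "\<lbrakk>s \<in> S; m \<in> carrier (space M s)\<rbrakk> \<Longrightarrow> (\<lambda>g. F (s, g, m)) \<in> module_hom k (homs C x s) N"
    and "\<lbrakk>s \<in> S; t \<in> S; g \<in> carrier (homs C x s); h \<in> carrier (homs C s t); m \<in> carrier (space M t)\<rbrakk>
      \<Longrightarrow> F (t, comp C x s t h g, m) = F (s, g, act M s t h m)"
  using assms unfolding KL_bal_def by blast+

lemma KL_rels_hom:
  assumes x: "x \<in> obj C" and N: "module k N" and f: "f \<in> module_hom k (KLF x) N"
  shows "KLR x \<subseteq> carrier (KLF x)"
    and "(\<forall>p\<in>KLR x. f p = \<zero>\<^bsub>N\<^esub>) \<longleftrightarrow> KL_bal x N (\<lambda>t. f (basis_elt k t))"
proof -
  interpret F: module k "KLF x" by (rule KLF_module[OF x])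
  interpret N: module k N by fact
  let ?e = "basis_elt k :: 'o \<times> 'm \<times> 'v \<Rightarrow> 'o \<times> 'm \<times> 'v \<Rightarrow> 'k"
  have H: "module k (homs C x s)" if "s \<in> S" for s using hom_mod x that by auto
  have Mm: "module k (space M s)" if "s \<in> S" for s using M_mod that .
  note cl = module.smult_closed[OF H] module.smult_closed[OF Mm]
    abelian_monoid.a_closed[OF abelian_group.axioms(1)[OF module.axioms(2)[OF H]]]
    abelian_monoid.a_closed[OF abelian_group.axioms(1)[OF module.axioms(2)[OF Mm]]]
    M_closed comp_closed
  show "KLR x \<subseteq> carrier (KLF x)"
    unfolding K_L_rels_def Let_def using x
    by (auto intro!: F.minus_closed F.smult_closed F.M.a_closed e_closed cl)
  have fm: "f (a \<ominus>\<^bsub>KLF x\<^esub> b) = \<zero>\<^bsub>N\<^esub> \<longleftrightarrow> f a = f b"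
    if "a \<in> carrier (KLF x)" "b \<in> carrier (KLF x)" for a b
    using module_hom_minus[OF F.module_axioms N f that] module_hom_in[OF f] that
    by (metis N.M.add.inv_closed N.M.add.inv_equality N.M.minus_eq N.M.minus_minus N.M.r_neg)
  have fa: "f (a \<oplus>\<^bsub>KLF x\<^esub> b) = f a \<oplus>\<^bsub>N\<^esub> f b"
    if "a \<in> carrier (KLF x)" "b \<in> carrier (KLF x)" for a b
    using f that by (simp add: module_hom_def)
  have fs: "f (r \<odot>\<^bsub>KLF x\<^esub> a) = r \<odot>\<^bsub>N\<^esub> f a" if "r \<in> carrier k" "a \<in> carrier (KLF x)" for r a
    using f that by (simp add: module_hom_def)
  let ?G = "\<lambda>t. f (?e t)"
  have Gcl: "?G (s, g, m) \<in> carrier N"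
    if "s \<in> S" "g \<in> carrier (homs C x s)" "m \<in> carrier (space M s)" for s g m
    by (rule module_hom_in[OF f e_closed[OF x that]])
  have "(\<forall>p\<in>KLR x. f p = \<zero>\<^bsub>N\<^esub>) \<longleftrightarrow>
     (\<forall>s g g' m. s \<in> S \<and> g \<in> carrier (homs C x s) \<and> g' \<in> carrier (homs C x s) \<and> m \<in> carrier (space M s)
        \<longrightarrow> f (?e (s, g \<oplus>\<^bsub>homs C x s\<^esub> g', m) \<ominus>\<^bsub>KLF x\<^esub> (?e (s, g, m) \<oplus>\<^bsub>KLF x\<^esub> ?e (s, g', m))) = \<zero>\<^bsub>N\<^esub>) \<and>
     (\<forall>s g m m'. s \<in> S \<and> g \<in> carrier (homs C x s) \<and> m \<in> carrier (space M s) \<and> m' \<in> carrier (space M s)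
        \<longrightarrow> f (?e (s, g, m \<oplus>\<^bsub>space M s\<^esub> m') \<ominus>\<^bsub>KLF x\<^esub> (?e (s, g, m) \<oplus>\<^bsub>KLF x\<^esub> ?e (s, g, m'))) = \<zero>\<^bsub>N\<^esub>) \<and>
     (\<forall>s r g m. s \<in> S \<and> r \<in> carrier k \<and> g \<in> carrier (homs C x s) \<and> m \<in> carrier (space M s)
        \<longrightarrow> f (?e (s, r \<odot>\<^bsub>homs C x s\<^esub> g, m) \<ominus>\<^bsub>KLF x\<^esub> r \<odot>\<^bsub>KLF x\<^esub> ?e (s, g, m)) = \<zero>\<^bsub>N\<^esub>) \<and>
     (\<forall>s r g m. s \<in> S \<and> r \<in> carrier k \<and> g \<in> carrier (homs C x s) \<and> m \<in> carrier (space M s)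
        \<longrightarrow> f (?e (s, g, r \<odot>\<^bsub>space M s\<^esub> m) \<ominus>\<^bsub>KLF x\<^esub> r \<odot>\<^bsub>KLF x\<^esub> ?e (s, g, m)) = \<zero>\<^bsub>N\<^esub>) \<and>
     (\<forall>s t g h m. s \<in> S \<and> t \<in> S \<and> g \<in> carrier (homs C x s) \<and> h \<in> carrier (homs C s t) \<and> m \<in> carrier (space M t)
        \<longrightarrow> f (?e (t, comp C x s t h g, m) \<ominus>\<^bsub>KLF x\<^esub> ?e (s, g, act M s t h m)) = \<zero>\<^bsub>N\<^esub>)"
    by (simp only: K_L_rels_def Let_def ball_Un ball_comp4 ball_comp5 conj_assoc)
  also have "\<dots> \<longleftrightarrow>
     (\<forall>s g g' m. s \<in> S \<and> g \<in> carrier (homs C x s) \<and> g' \<in> carrier (homs C x s) \<and> m \<in> carrier (space M s)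
        \<longrightarrow> ?G (s, g \<oplus>\<^bsub>homs C x s\<^esub> g', m) = ?G (s, g, m) \<oplus>\<^bsub>N\<^esub> ?G (s, g', m)) \<and>
     (\<forall>s g m m'. s \<in> S \<and> g \<in> carrier (homs C x s) \<and> m \<in> carrier (space M s) \<and> m' \<in> carrier (space M s)
        \<longrightarrow> ?G (s, g, m \<oplus>\<^bsub>space M s\<^esub> m') = ?G (s, g, m) \<oplus>\<^bsub>N\<^esub> ?G (s, g, m')) \<and>
     (\<forall>s r g m. s \<in> S \<and> r \<in> carrier k \<and> g \<in> carrier (homs C x s) \<and> m \<in> carrier (space M s)
        \<longrightarrow> ?G (s, r \<odot>\<^bsub>homs C x s\<^esub> g, m) = r \<odot>\<^bsub>N\<^esub> ?G (s, g, m)) \<and>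
     (\<forall>s r g m. s \<in> S \<and> r \<in> carrier k \<and> g \<in> carrier (homs C x s) \<and> m \<in> carrier (space M s)
        \<longrightarrow> ?G (s, g, r \<odot>\<^bsub>space M s\<^esub> m) = r \<odot>\<^bsub>N\<^esub> ?G (s, g, m)) \<and>
     (\<forall>s t g h m. s \<in> S \<and> t \<in> S \<and> g \<in> carrier (homs C x s) \<and> h \<in> carrier (homs C s t) \<and> m \<in> carrier (space M t)
        \<longrightarrow> ?G (t, comp C x s t h g, m) = ?G (s, g, act M s t h m))"
  proof -
    have 1: "(f (?e (s, g \<oplus>\<^bsub>homs C x s\<^esub> g', m) \<ominus>\<^bsub>KLF x\<^esub> (?e (s, g, m) \<oplus>\<^bsub>KLF x\<^esub> ?e (s, g', m))) = \<zero>\<^bsub>N\<^esub>)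
        = (?G (s, g \<oplus>\<^bsub>homs C x s\<^esub> g', m) = ?G (s, g, m) \<oplus>\<^bsub>N\<^esub> ?G (s, g', m))"
      if "s \<in> S \<and> g \<in> carrier (homs C x s) \<and> g' \<in> carrier (homs C x s) \<and> m \<in> carrier (space M s)" for s g g' m
      using that x by (subst fm) (auto simp: fa e_closed intro!: F.M.a_closed e_closed cl)
    have 2: "(f (?e (s, g, m \<oplus>\<^bsub>space M s\<^esub> m') \<ominus>\<^bsub>KLF x\<^esub> (?e (s, g, m) \<oplus>\<^bsub>KLF x\<^esub> ?e (s, g, m'))) = \<zero>\<^bsub>N\<^esub>)
        = (?G (s, g, m \<oplus>\<^bsub>space M s\<^esub> m') = ?G (s, g, m) \<oplus>\<^bsub>N\<^esub> ?G (s, g, m'))"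
      if "s \<in> S \<and> g \<in> carrier (homs C x s) \<and> m \<in> carrier (space M s) \<and> m' \<in> carrier (space M s)" for s g m m'
      using that x by (subst fm) (auto simp: fa e_closed intro!: F.M.a_closed e_closed cl)
    have 3: "(f (?e (s, r \<odot>\<^bsub>homs C x s\<^esub> g, m) \<ominus>\<^bsub>KLF x\<^esub> r \<odot>\<^bsub>KLF x\<^esub> ?e (s, g, m)) = \<zero>\<^bsub>N\<^esub>)
        = (?G (s, r \<odot>\<^bsub>homs C x s\<^esub> g, m) = r \<odot>\<^bsub>N\<^esub> ?G (s, g, m))"
      if "s \<in> S \<and> r \<in> carrier k \<and> g \<in> carrier (homs C x s) \<and> m \<in> carrier (space M s)" for s r g m
      using that x by (subst fm) (auto simp: fs e_closed intro!: F.smult_closed e_closed cl)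
    have 4: "(f (?e (s, g, r \<odot>\<^bsub>space M s\<^esub> m) \<ominus>\<^bsub>KLF x\<^esub> r \<odot>\<^bsub>KLF x\<^esub> ?e (s, g, m)) = \<zero>\<^bsub>N\<^esub>)
        = (?G (s, g, r \<odot>\<^bsub>space M s\<^esub> m) = r \<odot>\<^bsub>N\<^esub> ?G (s, g, m))"
      if "s \<in> S \<and> r \<in> carrier k \<and> g \<in> carrier (homs C x s) \<and> m \<in> carrier (space M s)" for s r g m
      using that x by (subst fm) (auto simp: fs e_closed intro!: F.smult_closed e_closed cl)
    have 5: "(f (?e (t, comp C x s t h g, m) \<ominus>\<^bsub>KLF x\<^esub> ?e (s, g, act M s t h m)) = \<zero>\<^bsub>N\<^esub>)
        = (?G (t, comp C x s t h g, m) = ?G (s, g, act M s t h m))"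
      if "s \<in> S \<and> t \<in> S \<and> g \<in> carrier (homs C x s) \<and> h \<in> carrier (homs C s t) \<and> m \<in> carrier (space M t)" for s t g h m
      using that x by (subst fm) (auto intro!: e_closed cl)
    show ?thesis
      by (intro conj_cong all_cong1 imp_cong refl) (rule 1 2 3 4 5, assumption)+
  qed
  also have "\<dots> \<longleftrightarrow> KL_bal x N ?G"
  proof (rule iffI, goal_cases)
    case 1
    then show ?case unfolding KL_bal_def module_hom_def mem_Collect_eq
      by (elim conjE, intro conjI ballI allI impI Pi_I Gcl; simp)
  next
    case 2
    note b = KL_balD[OF 2]
    show ?case
    proof (intro conjI allI impI; elim conjE)
      fix s g g' m assume "s \<in> S" "g \<in> carrier (homs C x s)" "g' \<in> carrier (homs C x s)" "m \<in> carrier (space M s)"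
      then show "?G (s, g \<oplus>\<^bsub>homs C x s\<^esub> g', m) = ?G (s, g, m) \<oplus>\<^bsub>N\<^esub> ?G (s, g', m)"
        using b(2)[of s m] by (simp add: module_hom_def)
    next
      fix s g m m' assume "s \<in> S" "g \<in> carrier (homs C x s)" "m \<in> carrier (space M s)" "m' \<in> carrier (space M s)"
      then show "?G (s, g, m \<oplus>\<^bsub>space M s\<^esub> m') = ?G (s, g, m) \<oplus>\<^bsub>N\<^esub> ?G (s, g, m')"
        using b(1)[of s g] by (simp add: module_hom_def)
    next
      fix s r g m assume "s \<in> S" "r \<in> carrier k" "g \<in> carrier (homs C x s)" "m \<in> carrier (space M s)"
      then show "?G (s, r \<odot>\<^bsub>homs C x s\<^esub> g, m) = r \<odot>\<^bsub>N\<^esub> ?G (s, g, m)"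
        using b(2)[of s m] by (simp add: module_hom_def)
    next
      fix s r g m assume "s \<in> S" "r \<in> carrier k" "g \<in> carrier (homs C x s)" "m \<in> carrier (space M s)"
      then show "?G (s, g, r \<odot>\<^bsub>space M s\<^esub> m) = r \<odot>\<^bsub>N\<^esub> ?G (s, g, m)"
        using b(1)[of s g] by (simp add: module_hom_def)
    next
      fix s t g h m assume "s \<in> S" "t \<in> S" "g \<in> carrier (homs C x s)" "h \<in> carrier (homs C s t)" "m \<in> carrier (space M t)"
      then show "?G (t, comp C x s t h g, m) = ?G (s, g, act M s t h m)" by (rule b(3))
    qed
  qed
  finally show "(\<forall>p\<in>KLR x. f p = \<zero>\<^bsub>N\<^esub>) \<longleftrightarrow> KL_bal x N ?G" .
qed

lemma KL_rels_sub: assumes "x \<in> obj C" shows "KLR x \<subseteq> carrier (KLF x)"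
proof -
  interpret F: module k "KLF x" by (rule KLF_module[OF assms])
  show ?thesis
    by (rule KL_rels_hom(1)[OF assms F.module_axioms, of "\<lambda>x. x"]) (simp add: module_hom_def)
qed

lemma KL_module: "x \<in> obj C \<Longrightarrow> module k (KL x)"
  unfolding KL_pres by (rule pres_module[OF cring_k KL_rels_sub])

lemma gen_closed: "\<lbrakk>x \<in> obj C; s \<in> S; g \<in> carrier (homs C x s); m \<in> carrier (space M s)\<rbrakk>
    \<Longrightarrow> gen x (s, g, m) \<in> carrier (KL x)"
  unfolding KL_pres K_L_gen_def by (rule pres_gen_closed[OF cring_k]) auto

lemma gen_bal: assumes x: "x \<in> obj C" shows "KL_bal x (KL x) (gen x)"
proof -
  let ?q = "\<lambda>c. pres_rel k (KLX x) (KLR x) +>\<^bsub>KLF x\<^esub> c"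
  note W = pres_rel_submodule[OF cring_k[OF x] KL_rels_sub[OF x]]
  have q: "?q \<in> module_hom k (KLF x) (KL x)"
    unfolding KL_pres pres_def by (rule quot_proj_hom[OF KLF_module[OF x] W(1)])
  interpret F: module k "KLF x" by (rule KLF_module[OF x])
  interpret W: abelian_subgroup "pres_rel k (KLX x) (KLR x)" "KLF x"
    by (rule submodule_abelian_subgroup[OF F.module_axioms W(1)])
  have "?q p = \<zero>\<^bsub>KL x\<^esub>" if "p \<in> KLR x" for p
    using W.a_subgroup that W(2) KL_rels_sub[OF x]
    by (auto simp: KL_pres pres_def quot_module_def F.a_coset_join2)
  then have "KL_bal x (KL x) (\<lambda>t. ?q (basis_elt k t))"
    using KL_rels_hom(2)[OF x KL_module[OF x] q] by blast
  moreover have "gen x = (\<lambda>t. ?q (basis_elt k t))"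
    by (rule ext) (simp add: K_L_gen_def pres_gen_def)
  ultimately show ?thesis by simp
qed

lemma KL_bal_cong:
  assumes "x \<in> obj C"
    and "\<And>s g m. \<lbrakk>s \<in> S; g \<in> carrier (homs C x s); m \<in> carrier (space M s)\<rbrakk> \<Longrightarrow> F (s, g, m) = G (s, g, m)"
    and "KL_bal x N G"
  shows "KL_bal x N F"
proof -
  have H: "module k (homs C x s)" if "s \<in> S" for s using hom_mod assms that by auto
  have Mm: "module k (space M s)" if "s \<in> S" for s using M_mod that .
  note cl = module.smult_closed[OF H] module.smult_closed[OF Mm]
    abelian_monoid.a_closed[OF abelian_group.axioms(1)[OF module.axioms(2)[OF H]]]
    abelian_monoid.a_closed[OF abelian_group.axioms(1)[OF module.axioms(2)[OF Mm]]]
    M_closed comp_closed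
  show ?thesis using assms
    unfolding KL_bal_def module_hom_def by (simp add: Pi_iff cl)
qed

lemma KL_map:
  assumes x: "x \<in> obj C" and N: "module k N" and F: "KL_bal x N F"
  shows "pres_map k id N F \<in> module_hom k (KL x) N"
    and "\<lbrakk>s \<in> S; g \<in> carrier (homs C x s); m \<in> carrier (space M s)\<rbrakk>
      \<Longrightarrow> pres_map k id N F (gen x (s, g, m)) = F (s, g, m)"
proof -
  have FX: "F \<in> KLX x \<rightarrow> carrier N"
  proof
    fix t assume "t \<in> KLX x"
    then obtain s g m where t: "t = (s, g, m)" "s \<in> S" "g \<in> carrier (homs C x s)" "m \<in> carrier (space M s)"
      by (auto simp: K_L_gens_def)
    then have "(\<lambda>m. F (s, g, m)) \<in> module_hom k (space M s) N" using F by (simp add: KL_bal_def)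
    from module_hom_in[OF this t(4)] show "F t \<in> carrier N" by (simp add: t(1))
  qed
  have h: "lin_ext k id N F \<in> module_hom k (KLF x) N" by (rule lin_ext_hom[OF N FX])
  have "KL_bal x N (\<lambda>t. lin_ext k id N F (basis_elt k t))"
    by (rule KL_bal_cong[OF x _ F]) (use lin_ext_basis[OF N FX] in auto)
  then have "\<forall>p\<in>KLR x. lin_ext k id N F p = \<zero>\<^bsub>N\<^esub>" using KL_rels_hom(2)[OF x N h] by blast
  note pm = pres_map[OF N FX KL_rels_sub[OF x] this[rule_format]]
  show "pres_map k id N F \<in> module_hom k (KL x) N" unfolding KL_pres by (rule pm(1))
  show "pres_map k id N F (gen x (s, g, m)) = F (s, g, m)"
    if "s \<in> S" "g \<in> carrier (homs C x s)" "m \<in> carrier (space M s)"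
    unfolding K_L_gen_def by (rule pm(2)) (use that in auto)
qed

lemma KL_eqI:
  fixes N :: "('k, 'n) module"
  assumes "x \<in> obj C" "module k N" "f \<in> module_hom k (KL x) N" "f' \<in> module_hom k (KL x) N"
    "\<And>s g m. \<lbrakk>s \<in> S; g \<in> carrier (homs C x s); m \<in> carrier (space M s)\<rbrakk>
      \<Longrightarrow> f (gen x (s, g, m)) = f' (gen x (s, g, m))"
    "z \<in> carrier (KL x)"
  shows "f z = f' z"
  by (rule pres_hom_eqI[OF assms(2) KL_rels_sub[OF assms(1)], of f f'])
    (use assms in \<open>auto simp: KL_pres K_L_gen_def K_L_gens_def\<close>)

lemma KL_act_bal:
  assumes x: "x \<in> obj C" and y: "y \<in> obj C" and f: "f \<in> carrier (homs C x y)"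
  shows "KL_bal y (KL x) (\<lambda>(s, g, m). gen x (s, comp C x y s g f, m))"
  unfolding KL_bal_def
proof (intro conjI ballI)
  fix s g assume s: "s \<in> S" and g: "g \<in> carrier (homs C y s)"
  show "(\<lambda>m. case (s, g, m) of (s, g, m) \<Rightarrow> gen x (s, comp C x y s g f, m)) \<in> module_hom k (space M s) (KL x)"
    using KL_balD(1)[OF gen_bal[OF x] s comp_closed[OF x y S_obj[OF s] f g]] by simp
next
  fix s m assume s: "s \<in> S" and m: "m \<in> carrier (space M s)"
  have "(\<lambda>g. gen x (s, comp C x y s g f, m)) \<in> module_hom k (homs C y s) (KL x)"
    by (rule module_hom_compose[OF comp_right[OF x y S_obj[OF s] f], of "\<lambda>g. gen x (s, g, m)"])
      (rule KL_balD(2)[OF gen_bal[OF x] s m])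
  then show "(\<lambda>g. case (s, g, m) of (s, g, m) \<Rightarrow> gen x (s, comp C x y s g f, m)) \<in> module_hom k (homs C y s) (KL x)"
    by simp
next
  fix s t g h m assume a: "s \<in> S" "t \<in> S" "g \<in> carrier (homs C y s)" "h \<in> carrier (homs C s t)" "m \<in> carrier (space M t)"
  have "gen x (t, comp C x y t (comp C y s t h g) f, m) = gen x (t, comp C x s t h (comp C x y s g f), m)"
    using comp_assoc[of x y s t f g h] a x y f by simp
  also have "\<dots> = gen x (s, comp C x y s g f, act M s t h m)"
    by (rule KL_balD(3)[OF gen_bal[OF x]])
      (use a comp_closed[OF x y S_obj[OF a(1)] f a(3)] in auto)
  finally show "(case (t, comp C y s t h g, m) of (s, g, m) \<Rightarrow> gen x (s, comp C x y s g f, m)) =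
      (case (s, g, act M s t h m) of (s, g, m) \<Rightarrow> gen x (s, comp C x y s g f, m))" by simp
qed

lemma KL_act_hom:
  assumes "x \<in> obj C" "y \<in> obj C" "f \<in> carrier (homs C x y)"
  shows "act (K_L k C S M) x y f \<in> module_hom k (KL y) (KL x)"
  using KL_map(1)[OF assms(2) KL_module[OF assms(1)] KL_act_bal[OF assms]] by (simp add: K_L_def)

lemma KL_act_gen:
  assumes "x \<in> obj C" "y \<in> obj C" "f \<in> carrier (homs C x y)"
    "s \<in> S" "g \<in> carrier (homs C y s)" "m \<in> carrier (space M s)"
  shows "act (K_L k C S M) x y f (gen y (s, g, m)) = gen x (s, comp C x y s g f, m)"
  using KL_map(2)[OF assms(2) KL_module[OF assms(1)] KL_act_bal[OF assms(1,2,3)] assms(4-6)]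
  by (simp add: K_L_def)

lemma K_L_cat_module: "cat_module k C (K_L k C S M)"
proof (rule cat_module.intro)
  show "vectorspace k (KL x)" if "x \<in> obj C" for x
    using KL_module[OF that] hom_vs[OF that that] by (simp add: vectorspace_def)
next
  fix x y f assume x: "x \<in> obj C" and y: "y \<in> obj C" and f: "f \<in> carrier (homs C x y)"
  show "act (K_L k C S M) x y f \<in> module_hom k (KL y) (KL x)" by (rule KL_act_hom[OF x y f])
next
  fix x y z assume x: "x \<in> obj C" and y: "y \<in> obj C" and z: "z \<in> carrier (KL y)"
  interpret H: module k "homs C x y" using hom_mod x y by auto
  interpret K: module k "KL x" using KL_module x .
  have lin: "(\<lambda>f. gen x (s, comp C x y s g f, m)) \<in> module_hom k (homs C x y) (KL x)"
    if "s \<in> S" "g \<in> carrier (homs C y s)" "m \<in> carrier (space M s)" for s g m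
    by (rule module_hom_compose[OF comp_left[OF x y S_obj[OF that(1)] that(2)], of "\<lambda>g. gen x (s, g, m)"])
      (rule KL_balD(2)[OF gen_bal[OF x] that(1,3)])
  have 1: "act (K_L k C S M) x y (f \<oplus>\<^bsub>homs C x y\<^esub> f') z
      = act (K_L k C S M) x y f z \<oplus>\<^bsub>KL x\<^esub> act (K_L k C S M) x y f' z"
    if f: "f \<in> carrier (homs C x y)" "f' \<in> carrier (homs C x y)" for f f'
    using KL_eqI[OF y K.module_axioms KL_act_hom[OF x y] module_hom_add_hom[OF KL_module[OF y] K.module_axioms
        KL_act_hom[OF x y f(1)] KL_act_hom[OF x y f(2)]], of "f \<oplus>\<^bsub>homs C x y\<^esub> f'" z] lin f z
    by (simp add: KL_act_gen x y module_hom_def)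
  have 2: "act (K_L k C S M) x y (r \<odot>\<^bsub>homs C x y\<^esub> f) z = r \<odot>\<^bsub>KL x\<^esub> act (K_L k C S M) x y f z"
    if f: "f \<in> carrier (homs C x y)" "r \<in> carrier k" for f r
    using KL_eqI[OF y K.module_axioms KL_act_hom[OF x y] module_hom_smult_hom[OF KL_module[OF y] K.module_axioms
        KL_act_hom[OF x y f(1)] f(2)], of "r \<odot>\<^bsub>homs C x y\<^esub> f" z] lin f z
    by (simp add: KL_act_gen x y module_hom_def)
  show "(\<lambda>f. act (K_L k C S M) x y f z) \<in> module_hom k (homs C x y) (KL x)"
    unfolding module_hom_def using 1 2 module_hom_in[OF KL_act_hom[OF x y] z] by auto
next
  fix x z assume x: "x \<in> obj C" and z: "z \<in> carrier (KL x)"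
  interpret K: module k "KL x" using KL_module x .
  have "(\<lambda>z. z) \<in> module_hom k (KL x) (KL x)" by (simp add: module_hom_def)
  from KL_eqI[OF x K.module_axioms KL_act_hom[OF x x ident_closed[OF x]] this _ z]
  show "act (K_L k C S M) x x (ident C x) z = z"
    using KL_act_gen[OF x x ident_closed[OF x]] ident_right[OF x] by simp
next
  fix x y w f g z assume x: "x \<in> obj C" and y: "y \<in> obj C" and w: "w \<in> obj C"
    and f: "f \<in> carrier (homs C x y)" and g: "g \<in> carrier (homs C y w)" and z: "z \<in> carrier (KL w)"
  note gf = comp_closed[OF x y w f g]
  show "act (K_L k C S M) x w (comp C x y w g f) z = act (K_L k C S M) x y f (act (K_L k C S M) y w g z)"
    by (rule KL_eqI[OF w KL_module[OF x] KL_act_hom[OF x w gf]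
          module_hom_compose[OF KL_act_hom[OF y w g] KL_act_hom[OF x y f]] _ z])
      (use x y w f g gf comp_assoc[OF x y w _ f g] in \<open>simp add: KL_act_gen comp_closed\<close>)
qed


end

context kan_data
begin

lemma K_L_unit_hom: "K_L_unit k C S M \<in> cmod_hom k (full_subcat C S) M (K_L k C S M)"
proof -
  have "K_L_unit k C S M s \<in> module_hom k (space M s) (KL s)" if "s \<in> S" for s
    unfolding K_L_unit_def
    by (rule KL_balD(1)[OF gen_bal[OF S_obj[OF that]] that ident_closed[OF S_obj[OF that]]])
  moreover have "K_L_unit k C S M s (act M s t h m) = act (K_L k C S M) s t h (K_L_unit k C S M t m)"
    if a: "s \<in> S" "t \<in> S" "h \<in> carrier (homs C s t)" "m \<in> carrier (space M t)" for s t h m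
  proof -
    have "gen s (s, ident C s, act M s t h m) = gen s (t, comp C s s t h (ident C s), m)"
      by (rule KL_balD(3)[OF gen_bal[OF S_obj[OF a(1)]], symmetric])
        (use a ident_closed in auto)
    also have "\<dots> = gen s (t, comp C s t t (ident C t) h, m)"
      using ident_left[of s t h] ident_right[of s t h] a by simp
    also have "\<dots> = act (K_L k C S M) s t h (gen t (t, ident C t, m))"
      by (rule KL_act_gen[symmetric]) (use a ident_closed in auto)
    finally show ?thesis by (simp add: K_L_unit_def)
  qed
  ultimately show ?thesis by (simp add: cmod_hom_def)
qed

lemma gen_unit:
  assumes "x \<in> obj C" "s \<in> S" "g \<in> carrier (homs C x s)" "m \<in> carrier (space M s)"
  shows "gen x (s, g, m) = act (K_L k C S M) x s g (K_L_unit k C S M s m)"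
  using KL_act_gen[OF assms(1) S_obj[OF assms(2)] assms(3,2) ident_closed[OF S_obj[OF assms(2)]] assms(4)]
    ident_left[OF assms(1) S_obj[OF assms(2)] assms(3)]
  by (simp add: K_L_unit_def)

text \<open>The universal property of the unit: \<open>K_L\<close> is left adjoint to the restriction.\<close>

theorem K_L_universal:
  fixes N :: "('o, 'm, 'k, 'n) cmod"
  assumes N: "cat_module k C N"
  shows "\<beta> \<in> cmod_hom k (full_subcat C S) M N \<Longrightarrow> \<exists>\<alpha>\<in>cmod_hom k C (K_L k C S M) N.
      \<forall>s\<in>S. \<forall>m\<in>carrier (space M s). \<alpha> s (K_L_unit k C S M s m) = \<beta> s m"
    and "\<lbrakk>\<alpha> \<in> cmod_hom k C (K_L k C S M) N; \<alpha>' \<in> cmod_hom k C (K_L k C S M) N;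
       \<forall>s\<in>S. \<forall>m\<in>carrier (space M s). \<alpha> s (K_L_unit k C S M s m) = \<alpha>' s (K_L_unit k C S M s m);
       a \<in> obj C; z \<in> carrier (KL a)\<rbrakk> \<Longrightarrow> \<alpha> a z = \<alpha>' a z"
proof -
  interpret N: cat_module k C N by fact
  have Nm: "module k (space N x)" if "x \<in> obj C" for x
    using N.space_vs[OF that] by (simp add: vectorspace_def)
  assume \<beta>: "\<beta> \<in> cmod_hom k (full_subcat C S) M N"
  have \<beta>h: "\<beta> s \<in> module_hom k (space M s) (space N s)" if "s \<in> S" for s
    using \<beta> that by (simp add: cmod_hom_def)
  have \<beta>n: "\<beta> s (act M s t f z) = act N s t f (\<beta> t z)"
    if "s \<in> S" "t \<in> S" "f \<in> carrier (homs C s t)" "z \<in> carrier (space M t)" for s t f z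
    using \<beta> that by (simp add: cmod_hom_def)
  let ?F = "\<lambda>x. \<lambda>(s, g, m). act N x s g (\<beta> s m)"
  have bal: "KL_bal x (space N x) (?F x)" if x: "x \<in> obj C" for x
    unfolding KL_bal_def
  proof (intro conjI ballI)
    fix s g assume "s \<in> S" "g \<in> carrier (homs C x s)"
    then show "(\<lambda>m. case (s, g, m) of (s, g, m) \<Rightarrow> act N x s g (\<beta> s m)) \<in> module_hom k (space M s) (space N x)"
      using module_hom_compose[OF \<beta>h N.act_hom, of s x g] x by simp
  next
    fix s m assume "s \<in> S" "m \<in> carrier (space M s)"
    then show "(\<lambda>g. case (s, g, m) of (s, g, m) \<Rightarrow> act N x s g (\<beta> s m)) \<in> module_hom k (homs C x s) (space N x)"
      using N.act_linear[of x s "\<beta> s m"] module_hom_in[OF \<beta>h] x by simp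
  next
    fix s t g h m assume a: "s \<in> S" "t \<in> S" "g \<in> carrier (homs C x s)" "h \<in> carrier (homs C s t)" "m \<in> carrier (space M t)"
    then show "(case (t, comp C x s t h g, m) of (s, g, m) \<Rightarrow> act N x s g (\<beta> s m)) =
        (case (s, g, act M s t h m) of (s, g, m) \<Rightarrow> act N x s g (\<beta> s m))"
      using N.act_comp[of x s t g h "\<beta> t m"] module_hom_in[OF \<beta>h] x by (simp add: \<beta>n)
  qed
  define \<alpha> where "\<alpha> = (\<lambda>x. pres_map k id (space N x) (?F x))"
  have h: "\<alpha> x \<in> module_hom k (KL x) (space N x)" if "x \<in> obj C" for x
    unfolding \<alpha>_def by (rule KL_map(1)[OF that Nm[OF that] bal[OF that]])
  have g: "\<alpha> x (gen x (s, g, m)) = act N x s g (\<beta> s m)"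
    if "x \<in> obj C" "s \<in> S" "g \<in> carrier (homs C x s)" "m \<in> carrier (space M s)" for x s g m
    unfolding \<alpha>_def using KL_map(2)[OF that(1) Nm[OF that(1)] bal[OF that(1)] that(2-4)] by simp
  have "\<alpha> \<in> cmod_hom k C (K_L k C S M) N"
    unfolding cmod_hom_def
  proof (intro CollectI conjI ballI)
    fix x y f z assume a: "x \<in> obj C" "y \<in> obj C" "f \<in> carrier (homs C x y)" "z \<in> carrier (KL y)"
    show "\<alpha> x (act (K_L k C S M) x y f z) = act N x y f (\<alpha> y z)"
    proof (rule KL_eqI[OF a(2) Nm[OF a(1)] module_hom_compose[OF KL_act_hom[OF a(1-3)] h[OF a(1)]]
          module_hom_compose[OF h[OF a(2)] N.act_hom[OF a(1-3)]] _ a(4)])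
      fix s g' m assume b: "s \<in> S" "g' \<in> carrier (homs C y s)" "m \<in> carrier (space M s)"
      then show "\<alpha> x (act (K_L k C S M) x y f (gen y (s, g', m))) = act N x y f (\<alpha> y (gen y (s, g', m)))"
        using N.act_comp[of x y s f g' "\<beta> s m"] module_hom_in[OF \<beta>h] a
        by (simp add: KL_act_gen g comp_closed)
    qed
  qed (use h in auto)
  moreover have "\<alpha> s (K_L_unit k C S M s m) = \<beta> s m" if "s \<in> S" "m \<in> carrier (space M s)" for s m
    using that g[of s s "ident C s" m] ident_closed N.act_ident module_hom_in[OF \<beta>h] by (simp add: K_L_unit_def)
  ultimately show "\<exists>\<alpha>\<in>cmod_hom k C (K_L k C S M) N.
      \<forall>s\<in>S. \<forall>m\<in>carrier (space M s). \<alpha> s (K_L_unit k C S M s m) = \<beta> s m" by blast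
next
  interpret N: cat_module k C N by fact
  assume h: "\<alpha> \<in> cmod_hom k C (K_L k C S M) N" "\<alpha>' \<in> cmod_hom k C (K_L k C S M) N"
    and eq: "\<forall>s\<in>S. \<forall>m\<in>carrier (space M s). \<alpha> s (K_L_unit k C S M s m) = \<alpha>' s (K_L_unit k C S M s m)"
    and a: "a \<in> obj C" and z: "z \<in> carrier (KL a)"
  have Na: "module k (space N a)" using N.space_vs[OF a] by (simp add: vectorspace_def)
  have hm: "\<gamma> a \<in> module_hom k (KL a) (space N a)" if "\<gamma> \<in> cmod_hom k C (K_L k C S M) N" for \<gamma>
    using that a by (simp add: cmod_hom_def)
  show "\<alpha> a z = \<alpha>' a z"
  proof (rule KL_eqI[OF a Na hm[OF h(1)] hm[OF h(2)] _ z])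
    fix s g m assume b: "s \<in> S" "g \<in> carrier (homs C a s)" "m \<in> carrier (space M s)"
    have u: "K_L_unit k C S M s m \<in> carrier (KL s)"
      using b ident_closed by (simp add: K_L_unit_def gen_closed)
    have "\<gamma> a (gen a (s, g, m)) = act N a s g (\<gamma> s (K_L_unit k C S M s m))"
      if "\<gamma> \<in> cmod_hom k C (K_L k C S M) N" for \<gamma>
      using that a b u by (simp add: cmod_hom_def gen_unit)
    from this[OF h(1)] this[OF h(2)]
    show "\<alpha> a (gen a (s, g, m)) = \<alpha>' a (gen a (s, g, m))" using eq b by simp
  qed
qed

subsection \<open>The canonical morphism\<close>

lemma K_can_bal:
  assumes x: "x \<in> obj C"
  shows "KL_bal x (KR x) (\<lambda>(s, g, m). \<lambda>t\<in>S. \<lambda>h\<in>carrier (homs C t x). act M t s (comp C t x s g h) m)"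
proof -
  let ?F = "\<lambda>(s, g, m). \<lambda>t\<in>S. \<lambda>h\<in>carrier (homs C t x). act M t s (comp C t x s g h) m"
  have mem: "?F (s, g, m) \<in> carrier (KR x)"
    if a: "s \<in> S" "g \<in> carrier (homs C x s)" "m \<in> carrier (space M s)" for s g m
    unfolding prod.case
  proof (rule KR_memI[OF x])
    fix t assume t: "t \<in> S"
    show "(\<lambda>h. act M t s (comp C t x s g h) m) \<in> module_hom k (homs C t x) (space M t)"
      using module_hom_compose[OF comp_left[of t x s g] M_linear[of t s m]] t a x by simp
  next
    fix t t' f h assume b: "t \<in> S" "t' \<in> S" "f \<in> carrier (homs C t t')" "h \<in> carrier (homs C t' x)"
    then show "act M t s (comp C t x s g (comp C t t' x h f)) m = act M t t' f (act M t' s (comp C t' x s g h) m)"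
      using comp_assoc[of t t' x s f h g] M_comp[of t t' s f "comp C t' x s g h" m] a x
      by (simp add: comp_closed)
  qed
  have ev: "?F (s, g, m) t h = act M t s (comp C t x s g h) m"
    if "t \<in> S" "h \<in> carrier (homs C t x)" for s g m t h using that by simp
  show ?thesis
    unfolding KL_bal_def
  proof (intro conjI ballI)
    fix s g assume a: "s \<in> S" "g \<in> carrier (homs C x s)"
    interpret Ms: module k "space M s" using M_mod a by simp
    show "(\<lambda>m. ?F (s, g, m)) \<in> module_hom k (space M s) (KR x)"
      unfolding module_hom_def
    proof (intro CollectI conjI allI impI)
      fix m m' assume m: "m \<in> carrier (space M s) \<and> m' \<in> carrier (space M s)"
      show "?F (s, g, m \<oplus>\<^bsub>space M s\<^esub> m') = ?F (s, g, m) \<oplus>\<^bsub>KR x\<^esub> ?F (s, g, m')"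
        by (rule KR_eqI[of _ x])
          (use mem a m KR_closed[OF x] x M_hom in \<open>auto simp: KR_apply comp_closed module_hom_def\<close>)
    next
      fix r m assume m: "r \<in> carrier k \<and> m \<in> carrier (space M s)"
      show "?F (s, g, r \<odot>\<^bsub>space M s\<^esub> m) = r \<odot>\<^bsub>KR x\<^esub> ?F (s, g, m)"
        by (rule KR_eqI[of _ x])
          (use mem a m KR_closed[OF x] x M_hom in \<open>auto simp: KR_apply comp_closed module_hom_def\<close>)
    qed (use mem a in auto)
  next
    fix s m assume a: "s \<in> S" "m \<in> carrier (space M s)"
    interpret H: module k "homs C x s" using hom_mod a x by simp
    have lin: "(\<lambda>g. act M t s (comp C t x s g h) m) \<in> module_hom k (homs C x s) (space M t)"
      if "t \<in> S" "h \<in> carrier (homs C t x)" for t h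
      using module_hom_compose[OF comp_right[of t x s h] M_linear[of t s m]] that a x by simp
    show "(\<lambda>g. ?F (s, g, m)) \<in> module_hom k (homs C x s) (KR x)"
      unfolding module_hom_def
    proof (intro CollectI conjI allI impI)
      fix g g' assume g: "g \<in> carrier (homs C x s) \<and> g' \<in> carrier (homs C x s)"
      show "?F (s, g \<oplus>\<^bsub>homs C x s\<^esub> g', m) = ?F (s, g, m) \<oplus>\<^bsub>KR x\<^esub> ?F (s, g', m)"
        by (rule KR_eqI[of _ x])
          (use mem a g KR_closed[OF x] x lin in \<open>auto simp: KR_apply module_hom_def\<close>)
    next
      fix r g assume g: "r \<in> carrier k \<and> g \<in> carrier (homs C x s)"
      show "?F (s, r \<odot>\<^bsub>homs C x s\<^esub> g, m) = r \<odot>\<^bsub>KR x\<^esub> ?F (s, g, m)"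
        by (rule KR_eqI[of _ x])
          (use mem a g KR_closed[OF x] x lin in \<open>auto simp: KR_apply module_hom_def\<close>)
    qed (use mem a in auto)
  next
    fix s t g h m assume a: "s \<in> S" "t \<in> S" "g \<in> carrier (homs C x s)" "h \<in> carrier (homs C s t)" "m \<in> carrier (space M t)"
    show "?F (t, comp C x s t h g, m) = ?F (s, g, act M s t h m)"
    proof (rule KR_eqI[OF mem mem])
      fix u l assume b: "u \<in> S" "l \<in> carrier (homs C u x)"
      then show "?F (t, comp C x s t h g, m) u l = ?F (s, g, act M s t h m) u l"
        using a x comp_assoc[of u x s t l g h] M_comp[of u s t "comp C u x s g l" h m]
        by (simp add: comp_closed)
    qed (use a x in \<open>auto intro: comp_closed\<close>)
  qed
qed

lemma K_can_gen:
  assumes "x \<in> obj C" "s \<in> S" "g \<in> carrier (homs C x s)" "m \<in> carrier (space M s)"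
    "t \<in> S" "h \<in> carrier (homs C t x)"
  shows "K_can k C S M x (gen x (s, g, m)) t h = act M t s (comp C t x s g h) m"
  using KL_map(2)[OF assms(1) KR_module[OF assms(1)] K_can_bal[OF assms(1)] assms(2-4)] assms(5,6)
  by (simp add: K_can_def)

lemma K_can_module_hom: "x \<in> obj C \<Longrightarrow> K_can k C S M x \<in> module_hom k (KL x) (KR x)"
  unfolding K_can_def by (rule KL_map(1)[OF _ KR_module K_can_bal])

theorem K_can_hom: "K_can k C S M \<in> cmod_hom k C (K_L k C S M) (K_R k C S M)"
  unfolding cmod_hom_def
proof (intro CollectI conjI ballI)
  fix x y f z assume a: "x \<in> obj C" "y \<in> obj C" "f \<in> carrier (homs C x y)" "z \<in> carrier (KL y)"
  interpret R: cat_module k C "K_R k C S M" by (rule K_R_cat_module)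
  show "K_can k C S M x (act (K_L k C S M) x y f z) = act (K_R k C S M) x y f (K_can k C S M y z)"
  proof (rule KL_eqI[OF a(2) KR_module[OF a(1)]
        module_hom_compose[OF KL_act_hom[OF a(1-3)] K_can_module_hom[OF a(1)]]
        module_hom_compose[OF K_can_module_hom[OF a(2)] R.act_hom[OF a(1-3)]] _ a(4)])
    fix s g m assume b: "s \<in> S" "g \<in> carrier (homs C y s)" "m \<in> carrier (space M s)"
    show "K_can k C S M x (act (K_L k C S M) x y f (gen y (s, g, m)))
        = act (K_R k C S M) x y f (K_can k C S M y (gen y (s, g, m)))"
    proof (rule KR_eqI[of _ x])
      fix t h assume c: "t \<in> S" "h \<in> carrier (homs C t x)"
      then show "K_can k C S M x (act (K_L k C S M) x y f (gen y (s, g, m))) t h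
          = act (K_R k C S M) x y f (K_can k C S M y (gen y (s, g, m))) t h"
        using a b comp_assoc[of t x y s h f g] by (simp add: KL_act_gen KR_act_apply K_can_gen comp_closed)
    qed (use a b gen_closed module_hom_in[OF KL_act_hom[OF a(1-3)]] module_hom_in[OF K_can_module_hom]
        KR_act_closed in auto)
  qed
qed (use K_can_module_hom in auto)

text \<open>By the two universal properties there is exactly one morphism \<open>K_L M \<rightarrow> K_R M\<close> that
  corresponds by adjunction to the inverse of the unit \<open>M \<rightarrow> res K_L M\<close>; it is \<open>K_can\<close>.\<close>

theorem K_can_adjoint:
  assumes "s \<in> S" "m \<in> carrier (space M s)"
  shows "K_R_counit C s (K_can k C S M s (K_L_unit k C S M s m)) = m"
  using assms K_can_gen[of s s "ident C s" m s "ident C s"] ident_closed ident_left M_ident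
  by (simp add: K_R_counit_def K_L_unit_def)

end


section \<open>The Nakajima categories are \<open>k\<close>-linear categories\<close>

lemma span_into:
  assumes "module R V" "module R W" "f \<in> module_hom R V W" "submodule R X W"
    "P \<subseteq> carrier V" "\<And>p. p \<in> P \<Longrightarrow> f p \<in> X" "z \<in> LinearCombinations.module.span R V P"
  shows "f z \<in> X"
proof -
  interpret V: module R V by fact
  interpret W: module R W by fact
  interpret X: submodule R X W by fact
  interpret mod_hom R V W f using assms by (simp add: mod_hom_def mod_hom_axioms_def)
  have "submodule R {v \<in> carrier V. f v \<in> X} V"
    by (rule submodule.intro) (use V.module_axioms in auto)
  from V.span_is_subset[OF _ this, of P] show ?thesis using assms by auto
qed

locale k_ideal = k_category k C for k :: "'k ring" and C :: "('o, 'm, 'k) kcat" +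
  fixes I :: "'o \<Rightarrow> 'o \<Rightarrow> 'm set"
  assumes sub: "\<lbrakk>a \<in> obj C; b \<in> obj C\<rbrakk> \<Longrightarrow> submodule k (I a b) (homs C a b)"
    and left: "\<lbrakk>a \<in> obj C; b \<in> obj C; c \<in> obj C; f \<in> I a b; g \<in> carrier (homs C b c)\<rbrakk>
      \<Longrightarrow> comp C a b c g f \<in> I a c"
    and right: "\<lbrakk>a \<in> obj C; b \<in> obj C; c \<in> obj C; f \<in> carrier (homs C a b); g \<in> I b c\<rbrakk>
      \<Longrightarrow> comp C a b c g f \<in> I a c"
begin

lemma hmod: "\<lbrakk>a \<in> obj C; b \<in> obj C\<rbrakk> \<Longrightarrow> module k (homs C a b)"
  using hom_vs by (simp add: vectorspace_def)

lemma ccl: "\<lbrakk>a \<in> obj C; b \<in> obj C; c \<in> obj C; f \<in> carrier (homs C a b);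
    g \<in> carrier (homs C b c)\<rbrakk> \<Longrightarrow> comp C a b c g f \<in> carrier (homs C a c)"
  using module_hom_in[OF comp_left] by simp

lemma comp_coset:
  assumes o: "a \<in> obj C" "b \<in> obj C" "c \<in> obj C"
    and f: "f \<in> carrier (homs C a b)" and g: "g \<in> carrier (homs C b c)"
  shows "comp (quot_cat C I) a b c (I b c +>\<^bsub>homs C b c\<^esub> g) (I a b +>\<^bsub>homs C a b\<^esub> f)
    = I a c +>\<^bsub>homs C a c\<^esub> comp C a b c g f"
proof -
  interpret ab: module k "homs C a b" using hmod o by simp
  interpret bc: module k "homs C b c" using hmod o by simp
  interpret ac: module k "homs C a c" using hmod o by simp
  interpret Iab: submodule k "I a b" "homs C a b" using sub o by simp
  interpret Ibc: submodule k "I b c" "homs C b c" using sub o by simp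
  interpret Iac: submodule k "I a c" "homs C a c" using sub o by simp
  interpret Aab: abelian_subgroup "I a b" "homs C a b"
    by (rule submodule_abelian_subgroup[OF ab.module_axioms Iab.submodule_axioms])
  interpret Abc: abelian_subgroup "I b c" "homs C b c"
    by (rule submodule_abelian_subgroup[OF bc.module_axioms Ibc.submodule_axioms])
  interpret Aac: abelian_subgroup "I a c" "homs C a c"
    by (rule submodule_abelian_subgroup[OF ac.module_axioms Iac.submodule_axioms])
  have eq: "I a c +>\<^bsub>homs C a c\<^esub> comp C a b c g' f' = I a c +>\<^bsub>homs C a c\<^esub> comp C a b c g f"
    if g': "g' \<in> I b c +>\<^bsub>homs C b c\<^esub> g" and f': "f' \<in> I a b +>\<^bsub>homs C a b\<^esub> f" for g' f'
  proof -
    obtain i where i: "i \<in> I b c" "g' = i \<oplus>\<^bsub>homs C b c\<^esub> g" using g' by (auto simp: a_r_coset_def')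
    obtain j where j: "j \<in> I a b" "f' = j \<oplus>\<^bsub>homs C a b\<^esub> f" using f' by (auto simp: a_r_coset_def')
    have ij: "i \<in> carrier (homs C b c)" "j \<in> carrier (homs C a b)" using i j Iab.subset Ibc.subset by auto
    have f'c: "f' \<in> carrier (homs C a b)" using j ij f by simp
    have "comp C a b c g' f' = comp C a b c i f' \<oplus>\<^bsub>homs C a c\<^esub> comp C a b c g f'"
      using comp_right[OF o f'c] ij g by (simp add: module_hom_def i(2))
    also have "comp C a b c g f' = comp C a b c g j \<oplus>\<^bsub>homs C a c\<^esub> comp C a b c g f"
      using comp_left[OF o g] ij f by (simp add: module_hom_def j(2))
    also have "comp C a b c i f' \<oplus>\<^bsub>homs C a c\<^esub> (comp C a b c g j \<oplus>\<^bsub>homs C a c\<^esub> comp C a b c g f)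
        = (comp C a b c i f' \<oplus>\<^bsub>homs C a c\<^esub> comp C a b c g j) \<oplus>\<^bsub>homs C a c\<^esub> comp C a b c g f"
      using ccl o f g f'c ij by (intro ac.M.a_assoc[symmetric]) auto
    finally have "comp C a b c g' f' \<in> I a c +>\<^bsub>homs C a c\<^esub> comp C a b c g f"
      using Iac.m_closed[OF right[OF o f'c i(1)] left[OF o j(1) g]] by (auto simp: a_r_coset_def')
    then show ?thesis
      by (rule ac.M.a_repr_independence[symmetric]) (use ccl o f g Aac.a_subgroup in auto)
  qed
  have "g \<in> I b c +>\<^bsub>homs C b c\<^esub> g" "f \<in> I a b +>\<^bsub>homs C a b\<^esub> f"
    using Abc.a_rcos_self[OF g] Aab.a_rcos_self[OF f] by auto
  then have "(\<Union>g'\<in>I b c +>\<^bsub>homs C b c\<^esub> g. \<Union>f'\<in>I a b +>\<^bsub>homs C a b\<^esub> f. I a c +>\<^bsub>homs C a c\<^esub> comp C a b c g' f')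
      = I a c +>\<^bsub>homs C a c\<^esub> comp C a b c g f"
    using eq by blast
  then show ?thesis by (simp add: quot_cat_def)
qed

lemma quot_cat_sel [simp]:
  "obj (quot_cat C I) = obj C" "homs (quot_cat C I) a b = quot_module (homs C a b) (I a b)"
  "ident (quot_cat C I) a = I a a +>\<^bsub>homs C a a\<^esub> ident C a"
  by (simp_all add: quot_cat_def)

theorem k_category_quot: "k_category k (quot_cat C I)"
proof (rule k_category.intro, unfold quot_cat_sel)
  show "vectorspace k (quot_module (homs C a b) (I a b))" if "a \<in> obj C" "b \<in> obj C" for a b
    using quot_module_module[OF hmod sub] hom_vs that by (simp add: vectorspace_def)
next
  fix a assume "a \<in> obj C"
  then show "I a a +>\<^bsub>homs C a a\<^esub> ident C a \<in> carrier (quot_module (homs C a a) (I a a))"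
    using ident_closed by (simp add: quot_carrier)
next
  fix a b c F assume o: "a \<in> obj C" "b \<in> obj C" "c \<in> obj C"
    and F: "F \<in> carrier (quot_module (homs C a b) (I a b))"
  then obtain f where f: "f \<in> carrier (homs C a b)" "F = I a b +>\<^bsub>homs C a b\<^esub> f" by (auto simp: quot_carrier)
  interpret bc: module k "homs C b c" using hmod o by simp
  show "(\<lambda>G. comp (quot_cat C I) a b c G F)
      \<in> module_hom k (quot_module (homs C b c) (I b c)) (quot_module (homs C a c) (I a c))"
    using comp_right[OF o f(1)] o f ccl
    by (auto simp: module_hom_def quot_carrier quot_add[OF hmod sub] quot_smult[OF hmod sub] comp_coset)
next
  fix a b c G assume o: "a \<in> obj C" "b \<in> obj C" "c \<in> obj C"
    and G: "G \<in> carrier (quot_module (homs C b c) (I b c))"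
  then obtain g where g: "g \<in> carrier (homs C b c)" "G = I b c +>\<^bsub>homs C b c\<^esub> g" by (auto simp: quot_carrier)
  interpret ab: module k "homs C a b" using hmod o by simp
  show "comp (quot_cat C I) a b c G
      \<in> module_hom k (quot_module (homs C a b) (I a b)) (quot_module (homs C a c) (I a c))"
    using comp_left[OF o g(1)] o g ccl
    by (auto simp: module_hom_def quot_carrier quot_add[OF hmod sub] quot_smult[OF hmod sub] comp_coset)
next
  fix a b F assume o: "a \<in> obj C" "b \<in> obj C" and F: "F \<in> carrier (quot_module (homs C a b) (I a b))"
  then obtain f where f: "f \<in> carrier (homs C a b)" "F = I a b +>\<^bsub>homs C a b\<^esub> f" by (auto simp: quot_carrier)
  show "comp (quot_cat C I) a b b (I b b +>\<^bsub>homs C b b\<^esub> ident C b) F = F"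
    using comp_coset[OF o o(2) f(1) ident_closed[OF o(2)]] ident_left[OF o f(1)] f(2) by simp
  show "comp (quot_cat C I) a a b F (I a a +>\<^bsub>homs C a a\<^esub> ident C a) = F"
    using comp_coset[OF o(1) o ident_closed[OF o(1)] f(1)] ident_right[OF o f(1)] f(2) by simp
next
  fix a b c d F G H assume o: "a \<in> obj C" "b \<in> obj C" "c \<in> obj C" "d \<in> obj C"
    and "F \<in> carrier (quot_module (homs C a b) (I a b))" "G \<in> carrier (quot_module (homs C b c) (I b c))"
      "H \<in> carrier (quot_module (homs C c d) (I c d))"
  then obtain f g h where
    f: "f \<in> carrier (homs C a b)" "F = I a b +>\<^bsub>homs C a b\<^esub> f" and
    g: "g \<in> carrier (homs C b c)" "G = I b c +>\<^bsub>homs C b c\<^esub> g" and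
    h: "h \<in> carrier (homs C c d)" "H = I c d +>\<^bsub>homs C c d\<^esub> h" by (auto simp: quot_carrier)
  show "comp (quot_cat C I) a c d H (comp (quot_cat C I) a b c G F)
      = comp (quot_cat C I) a b d (comp (quot_cat C I) b c d H G) F"
    using o f g h ccl comp_assoc[OF o f(1) g(1) h(1)] by (simp add: comp_coset)
qed

end

lemma ident_ideal_k_ideal:
  assumes "k_category k C" "Z \<subseteq> obj C"
  shows "k_ideal k C (ident_ideal k C Z)"
proof -
  interpret k_category k C by fact
  have hmod: "module k (homs C a b)" if "a \<in> obj C" "b \<in> obj C" for a b
    using hom_vs that by (simp add: vectorspace_def)
  have ccl: "comp C a b c g f \<in> carrier (homs C a c)" if "a \<in> obj C" "b \<in> obj C" "c \<in> obj C"
    "f \<in> carrier (homs C a b)" "g \<in> carrier (homs C b c)" for a b c f g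
    using module_hom_in[OF comp_left] that by simp
  let ?P = "\<lambda>a b. {comp C a z b u (comp C a z z (ident C z) v) | z u v.
        z \<in> Z \<and> u \<in> carrier (homs C z b) \<and> v \<in> carrier (homs C a z)}"
  have P: "?P a b \<subseteq> carrier (homs C a b)" if "a \<in> obj C" "b \<in> obj C" for a b
    using assms(2) that by (auto intro!: ccl ident_closed)
  have S: "submodule k (ident_ideal k C Z a b) (homs C a b)" "?P a b \<subseteq> ident_ideal k C Z a b"
    if "a \<in> obj C" "b \<in> obj C" for a b
    using module.span_is_submodule[OF hmod P, OF that that] module.in_own_span[OF hmod P, OF that that]
    by (simp_all add: ident_ideal_def)
  show ?thesis
  proof (rule k_ideal.intro[OF assms(1) k_ideal_axioms.intro])
    show "submodule k (ident_ideal k C Z a b) (homs C a b)" if "a \<in> obj C" "b \<in> obj C" for a b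
      by (rule S(1)[OF that])
  next
    fix a b c f g assume o: "a \<in> obj C" "b \<in> obj C" "c \<in> obj C"
      and f: "f \<in> ident_ideal k C Z a b" and g: "g \<in> carrier (homs C b c)"
    show "comp C a b c g f \<in> ident_ideal k C Z a c"
    proof (rule span_into[OF hmod hmod comp_left[OF o g] S(1) P])
      fix p assume "p \<in> ?P a b"
      then obtain z u v where z: "z \<in> Z" "u \<in> carrier (homs C z b)" "v \<in> carrier (homs C a z)"
        "p = comp C a z b u (comp C a z z (ident C z) v)" by blast
      then have zo: "z \<in> obj C" using assms(2) by auto
      have "comp C a b c g p = comp C a z c (comp C z b c g u) (comp C a z z (ident C z) v)"
        unfolding z(4) by (rule comp_assoc) (use o zo z g ccl ident_closed in auto)
      then have "comp C a b c g p \<in> ?P a c" using z(1,3) ccl[OF zo o(2,3) z(2) g] by blast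
      then show "comp C a b c g p \<in> ident_ideal k C Z a c" using S(2) o by blast
    qed (use o f in \<open>auto simp: ident_ideal_def\<close>)
  next
    fix a b c f g assume o: "a \<in> obj C" "b \<in> obj C" "c \<in> obj C"
      and f: "f \<in> carrier (homs C a b)" and g: "g \<in> ident_ideal k C Z b c"
    show "comp C a b c g f \<in> ident_ideal k C Z a c"
    proof (rule span_into[OF hmod hmod comp_right[OF o f] S(1) P])
      fix p assume "p \<in> ?P b c"
      then obtain z u v where z: "z \<in> Z" "u \<in> carrier (homs C z c)" "v \<in> carrier (homs C b z)"
        "p = comp C b z c u (comp C b z z (ident C z) v)" by blast
      then have zo: "z \<in> obj C" using assms(2) by auto
      have "comp C a b c p f = comp C a z c u (comp C a b z (comp C b z z (ident C z) v) f)"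
        unfolding z(4) by (rule comp_assoc[symmetric]) (use o zo z f ccl ident_closed in auto)
      also have "comp C a b z (comp C b z z (ident C z) v) f = comp C a z z (ident C z) (comp C a b z v f)"
        by (rule comp_assoc[symmetric]) (use o zo z f ccl ident_closed in auto)
      finally have "comp C a b c p f \<in> ?P a c" using z(1,2) ccl[OF o(1,2) zo f z(3)] by blast
      then show "comp C a b c p f \<in> ident_ideal k C Z a c" using S(2) o by blast
    qed (use o g in \<open>auto simp: ident_ideal_def\<close>)
  qed
qed

subsection \<open>The path category\<close>

definition conv :: "'k ring \<Rightarrow> ('b list \<Rightarrow> 'k) \<Rightarrow> ('b list \<Rightarrow> 'k) \<Rightarrow> 'b list \<Rightarrow> 'k" where
  "conv k g f p = (\<Oplus>\<^bsub>k\<^esub>j\<in>{..length p}. g (drop j p) \<otimes>\<^bsub>k\<^esub> f (take j p))"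

locale conv_ring = cring R for R :: "'k ring" (structure)
begin

lemma conv_closed: "\<lbrakk>\<And>p. f p \<in> carrier R; \<And>p. g p \<in> carrier R\<rbrakk> \<Longrightarrow> conv R g f p \<in> carrier R"
  unfolding conv_def by (intro finsum_closed) auto

lemma conv_Nil: "\<lbrakk>\<And>p. f p \<in> carrier R; \<And>p. g p \<in> carrier R\<rbrakk> \<Longrightarrow> conv R g f [] = g [] \<otimes> f []"
  unfolding conv_def by simp

lemma conv_Cons:
  assumes "\<And>p. f p \<in> carrier R" "\<And>p. g p \<in> carrier R"
  shows "conv R g f (x # p) = g (x # p) \<otimes> f [] \<oplus> conv R g (\<lambda>q. f (x # q)) p"
  unfolding conv_def using assms by (simp add: finsum_Suc2 Pi_iff add.m_comm del: finsum_Suc)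

lemma conv_add_right:
  assumes "\<And>p. f p \<in> carrier R" "\<And>p. f' p \<in> carrier R" "\<And>p. g p \<in> carrier R"
  shows "conv R g (\<lambda>p. f p \<oplus> f' p) p = conv R g f p \<oplus> conv R g f' p"
proof -
  have "conv R g (\<lambda>p. f p \<oplus> f' p) p
      = (\<Oplus>j\<in>{..length p}. g (drop j p) \<otimes> f (take j p) \<oplus> g (drop j p) \<otimes> f' (take j p))"
    unfolding conv_def using assms by (intro finsum_cong') (auto simp: r_distr)
  also have "\<dots> = conv R g f p \<oplus> conv R g f' p"
    unfolding conv_def using assms by (intro finsum_addf) auto
  finally show ?thesis .
qed

lemma conv_add_left:
  assumes "\<And>p. f p \<in> carrier R" "\<And>p. g p \<in> carrier R" "\<And>p. g' p \<in> carrier R"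
  shows "conv R (\<lambda>p. g p \<oplus> g' p) f p = conv R g f p \<oplus> conv R g' f p"
proof -
  have "conv R (\<lambda>p. g p \<oplus> g' p) f p
      = (\<Oplus>j\<in>{..length p}. g (drop j p) \<otimes> f (take j p) \<oplus> g' (drop j p) \<otimes> f (take j p))"
    unfolding conv_def using assms by (intro finsum_cong') (auto simp: l_distr)
  also have "\<dots> = conv R g f p \<oplus> conv R g' f p"
    unfolding conv_def using assms by (intro finsum_addf) auto
  finally show ?thesis .
qed

lemma conv_smult_right:
  assumes "\<And>p. f p \<in> carrier R" "\<And>p. g p \<in> carrier R" "r \<in> carrier R"
  shows "conv R g (\<lambda>p. r \<otimes> f p) p = r \<otimes> conv R g f p"
  unfolding conv_def using assms
  by (subst finsum_rdistr) (auto intro!: finsum_cong' simp: m_ac)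

lemma conv_smult_left:
  assumes "\<And>p. f p \<in> carrier R" "\<And>p. g p \<in> carrier R" "r \<in> carrier R"
  shows "conv R (\<lambda>p. r \<otimes> g p) f p = r \<otimes> conv R g f p"
  unfolding conv_def using assms
  by (subst finsum_rdistr) (auto intro!: finsum_cong' simp: m_ac)

lemma conv_assoc:
  assumes "\<And>p. f p \<in> carrier R" "\<And>p. g p \<in> carrier R" "\<And>p. h p \<in> carrier R"
  shows "conv R h (conv R g f) p = conv R (conv R h g) f p"
  using assms
proof (induction p arbitrary: f g)
  case Nil
  then show ?case by (simp add: conv_Nil conv_closed m_assoc)
next
  case (Cons x p)
  have "conv R h (conv R g f) (x # p) = h (x # p) \<otimes> (g [] \<otimes> f [])
      \<oplus> conv R h (\<lambda>q. f [] \<otimes> g (x # q) \<oplus> conv R g (\<lambda>q. f (x # q)) q) p"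
    using Cons.prems by (simp add: conv_Cons conv_Nil conv_closed m_comm)
  also have "\<dots> = h (x # p) \<otimes> (g [] \<otimes> f [])
      \<oplus> (f [] \<otimes> conv R h (\<lambda>q. g (x # q)) p \<oplus> conv R h (conv R g (\<lambda>q. f (x # q))) p)"
    using Cons.prems by (simp add: conv_add_right conv_smult_right conv_closed)
  also have "conv R h (conv R g (\<lambda>q. f (x # q))) p = conv R (conv R h g) (\<lambda>q. f (x # q)) p"
    using Cons by simp
  also have "h (x # p) \<otimes> (g [] \<otimes> f [])
      \<oplus> (f [] \<otimes> conv R h (\<lambda>q. g (x # q)) p \<oplus> conv R (conv R h g) (\<lambda>q. f (x # q)) p)
      = conv R (conv R h g) f (x # p)"
    using Cons.prems by (simp add: conv_Cons conv_closed l_distr r_distr m_ac a_ac)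
  finally show ?case .
qed

lemma conv_basis:
  "conv R (basis_elt R v) (basis_elt R u) = basis_elt R (u @ v)"
proof
  fix p
  have j: "take j p = u \<and> drop j p = v \<longleftrightarrow> length u = j" if "p = u @ v" "j \<le> length p" for j
    using that by (metis append_eq_conv_conj length_take min.absorb2)
  show "conv R (basis_elt R v) (basis_elt R u) p = basis_elt R (u @ v) p"
  proof (cases "p = u @ v")
    case True
    have "conv R (basis_elt R v) (basis_elt R u) p = (\<Oplus>j\<in>{..length p}. if length u = j then \<one> else \<zero>)"
      unfolding conv_def using j[OF True] by (intro finsum_cong') (auto simp: basis_elt_def)
    also have "\<dots> = \<one>" using True by (subst finsum_singleton[of "length u" "{..length p}" "\<lambda>_. \<one>"]) auto
    finally show ?thesis using True by (simp add: basis_elt_def)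
  next
    case False
    have "conv R (basis_elt R v) (basis_elt R u) p = (\<Oplus>j\<in>{..length p}. \<zero>)"
      unfolding conv_def
    proof (rule finsum_cong')
      fix j assume "j \<in> {..length p}"
      have "take j p \<noteq> u \<or> drop j p \<noteq> v" using False by (metis append_take_drop_id)
      then show "basis_elt R v (drop j p) \<otimes> basis_elt R u (take j p) = \<zero>"
        by (auto simp: basis_elt_def)
    qed auto
    then show ?thesis using False by (simp add: basis_elt_def)
  qed
qed

lemma conv_Nil_left:
  assumes "\<And>p. f p \<in> carrier R"
  shows "conv R (basis_elt R []) f p = f p"
proof -
  have "conv R (basis_elt R []) f p = (\<Oplus>j\<in>{..length p}. if length p = j then f p else \<zero>)"
    unfolding conv_def using assms by (intro finsum_cong') (auto simp: basis_elt_def)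
  also have "\<dots> = f p" using assms by (subst finsum_singleton[of "length p" "{..length p}" "\<lambda>_. f p"]) auto
  finally show ?thesis .
qed

lemma conv_Nil_right:
  assumes "\<And>p. f p \<in> carrier R"
  shows "conv R f (basis_elt R []) p = f p"
proof -
  have "conv R f (basis_elt R []) p = (\<Oplus>j\<in>{..length p}. if 0 = j then f p else \<zero>)"
    unfolding conv_def using assms by (intro finsum_cong') (auto simp: basis_elt_def)
  also have "\<dots> = f p" using assms by (subst finsum_singleton[of 0 "{..length p}" "\<lambda>_. f p"]) auto
  finally show ?thesis .
qed

lemma conv_free:
  assumes "wf_digraph G"
    "f \<in> carrier (free_module R {p. pre_digraph.awalk G a p b})"
    "g \<in> carrier (free_module R {p. pre_digraph.awalk G b p c})"
  shows "conv R g f \<in> carrier (free_module R {p. pre_digraph.awalk G a p c})"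
proof -
  interpret wf_digraph G by fact
  note F = free_supp[OF assms(2)] and H = free_supp[OF assms(3)]
  have split: "\<exists>u v. p = u @ v \<and> f u \<noteq> \<zero> \<and> g v \<noteq> \<zero>" if "conv R g f p \<noteq> \<zero>" for p
  proof (rule ccontr)
    assume "\<not> ?thesis"
    then have "g (drop j p) \<otimes> f (take j p) = \<zero>" for j
      using F(3) H(3) by (metis append_take_drop_id l_null r_null)
    then have "conv R g f p = \<zero>" unfolding conv_def by simp
    with that show False by simp
  qed
  have "{p. conv R g f p \<noteq> \<zero>} \<subseteq> (\<lambda>(u, v). u @ v) ` ({u. f u \<noteq> \<zero>} \<times> {v. g v \<noteq> \<zero>})"
    using split by force
  then have "finite {p. conv R g f p \<noteq> \<zero>}" by (rule finite_subset) (use F(1) H(1) in auto)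
  moreover have "awalk a p c" if p: "conv R g f p \<noteq> \<zero>" for p
  proof -
    obtain u v where "p = u @ v" "f u \<noteq> \<zero>" "g v \<noteq> \<zero>" using split[OF p] by blast
    then have "p = u @ v" "awalk a u b" "awalk b v c" using F(2) H(2) by auto
    then show ?thesis by (simp add: awalk_appendI)
  qed
  ultimately show ?thesis using conv_closed[of f g] F(3) H(3) by (auto simp: free_module_def)
qed

end

lemma path_cat_sel:
  "obj (path_cat k G) = verts G" "homs (path_cat k G) a b = free_module k {p. pre_digraph.awalk G a p b}"
  "comp (path_cat k G) a b c = conv k" "ident (path_cat k G) a = basis_elt k []"
  by (auto simp: path_cat_def conv_def fun_eq_iff)

theorem k_category_path_cat:
  assumes "field k" "wf_digraph G"
  shows "k_category k (path_cat k G)"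
proof (rule k_category.intro, unfold path_cat_sel)
  interpret k: field k by fact
  interpret k: conv_ring k by unfold_locales
  interpret G: wf_digraph G by fact
  note cl = free_supp(3) and ev = free_module_def
  show "vectorspace k (free_module k {p. G.awalk a p b})" for a b
    using free_module_module[OF k.is_cring] k.field_axioms by (simp add: vectorspace_def)
  show "basis_elt k [] \<in> carrier (free_module k {p. G.awalk a p a})" if "a \<in> verts G" for a
    by (rule basis_elt_closed[OF k.is_cring]) (simp add: G.awalk_Nil_iff that)
  { fix a b c f assume f: "f \<in> carrier (free_module k {p. G.awalk a p b})"
    have "conv k (g \<oplus>\<^bsub>free_module k {p. G.awalk b p c}\<^esub> g') f
        = conv k g f \<oplus>\<^bsub>free_module k {p. G.awalk a p c}\<^esub> conv k g' f"
      if "g \<in> carrier (free_module k {p. G.awalk b p c})" "g' \<in> carrier (free_module k {p. G.awalk b p c})" for g g'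
      using k.conv_add_left[of f g g', OF cl[OF f] cl[OF that(1)] cl[OF that(2)]] by (simp add: ev fun_eq_iff)
    moreover have "conv k (r \<odot>\<^bsub>free_module k {p. G.awalk b p c}\<^esub> g) f
        = r \<odot>\<^bsub>free_module k {p. G.awalk a p c}\<^esub> conv k g f"
      if "g \<in> carrier (free_module k {p. G.awalk b p c})" "r \<in> carrier k" for g r
      using k.conv_smult_left[of f g r, OF cl[OF f] cl[OF that(1)] that(2)] by (simp add: ev fun_eq_iff)
    ultimately show "(\<lambda>g. conv k g f) \<in> module_hom k (free_module k {p. G.awalk b p c}) (free_module k {p. G.awalk a p c})"
      unfolding module_hom_def using k.conv_free[OF assms(2) f] by auto }
  { fix a b c g assume g: "g \<in> carrier (free_module k {p. G.awalk b p c})"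
    have "conv k g (f \<oplus>\<^bsub>free_module k {p. G.awalk a p b}\<^esub> f')
        = conv k g f \<oplus>\<^bsub>free_module k {p. G.awalk a p c}\<^esub> conv k g f'"
      if "f \<in> carrier (free_module k {p. G.awalk a p b})" "f' \<in> carrier (free_module k {p. G.awalk a p b})" for f f'
      using k.conv_add_right[of f f' g, OF cl[OF that(1)] cl[OF that(2)] cl[OF g]] by (simp add: ev fun_eq_iff)
    moreover have "conv k g (r \<odot>\<^bsub>free_module k {p. G.awalk a p b}\<^esub> f)
        = r \<odot>\<^bsub>free_module k {p. G.awalk a p c}\<^esub> conv k g f"
      if "f \<in> carrier (free_module k {p. G.awalk a p b})" "r \<in> carrier k" for f r
      using k.conv_smult_right[of f g r, OF cl[OF that(1)] cl[OF g] that(2)] by (simp add: ev fun_eq_iff)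
    ultimately show "conv k g \<in> module_hom k (free_module k {p. G.awalk a p b}) (free_module k {p. G.awalk a p c})"
      unfolding module_hom_def using k.conv_free[OF assms(2) _ g] by auto }
  { fix a b f assume f: "f \<in> carrier (free_module k {p. G.awalk a p b})"
    show "conv k (basis_elt k []) f = f" using k.conv_Nil_left[of f, OF cl[OF f]] by auto
    show "conv k f (basis_elt k []) = f" using k.conv_Nil_right[of f, OF cl[OF f]] by auto }
  fix a b c d f g h assume "f \<in> carrier (free_module k {p. G.awalk a p b})"
    "g \<in> carrier (free_module k {p. G.awalk b p c})" "h \<in> carrier (free_module k {p. G.awalk c p d})"
  from k.conv_assoc[of f g h, OF cl[OF this(1)] cl[OF this(2)] cl[OF this(3)]]
  show "conv k h (conv k g f) = conv k (conv k h g) f" by auto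
qed


lemma submodule_finsum:
  assumes "module R V" "submodule R W V" "finite T" "g \<in> T \<rightarrow> W"
  shows "(\<Oplus>\<^bsub>V\<^esub>x\<in>T. g x) \<in> W"
proof -
  interpret V: module R V by fact
  interpret W: submodule R W V by fact
  show ?thesis using assms(3,4)
  proof (induction T)
    case (insert x T)
    then have "g x \<in> carrier V" "g \<in> T \<rightarrow> carrier V" using W.subset by auto
    then show ?case using insert by (simp add: W.m_closed)
  qed simp
qed

lemma free_hom_into:
  fixes V :: "('r, 'v) module"
  assumes "module R V" "f \<in> module_hom R (free_module R X) V" "submodule R W V"
    "\<And>x. x \<in> X \<Longrightarrow> f (basis_elt R x) \<in> W" "c \<in> carrier (free_module R X)"
  shows "f c \<in> W"
proof -
  interpret W: submodule R W V by fact
  note fs = free_supp[OF assms(5)]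
  show ?thesis
    unfolding free_hom_ext[OF assms(1,2,5)] lin_ext_def id_def
    by (rule submodule_finsum[OF assms(1,3) fs(1)]) (use fs assms(4) in auto)
qed

lemma wf_Zframed:
  assumes "fin_digraph Q" shows "wf_digraph (Zframed Q)"
proof -
  interpret fin_digraph Q by fact
  show ?thesis
    by unfold_locales (auto simp: repetition_def framed_def split: sum.splits prod.splits)
qed

lemma finite_out_arcs_Zframed:
  assumes "fin_digraph Q" shows "finite (out_arcs (Zframed Q) x)"
proof -
  interpret fin_digraph Q by fact
  have "out_arcs (Zframed Q) x \<subseteq> Inl ` (arcs (framed Q) \<times> {snd x}) \<union> Inr ` (arcs (framed Q) \<times> {snd x + 1})"
    by (auto simp: repetition_def out_arcs_def)
  moreover have "finite (arcs (framed Q))" by (simp add: framed_def)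
  ultimately show ?thesis by (elim finite_subset) auto
qed

lemma mesh_closed:
  assumes "field k" "fin_digraph Q"
  shows "mesh k Q x \<in> carrier (free_module k {p. pre_digraph.awalk (Zframed Q) (nu_tau x) p x})"
proof -
  interpret k: field k by fact
  interpret G: wf_digraph "Zframed Q" by (rule wf_Zframed[OF assms(2)])
  let ?A = "\<lambda>y. out_arcs (Zframed Q) y"
  have "{p. G.awalk (nu_tau x) p x \<and> length p = 2}
      \<subseteq> (\<Union>e\<in>?A (nu_tau x). (\<lambda>e'. [e, e']) ` ?A (head (Zframed Q) e))"
    by (auto simp: numeral_2_eq_2 length_Suc_conv G.awalk_Cons_iff)
  moreover have "finite \<dots>" using finite_out_arcs_Zframed[OF assms(2)] by auto
  ultimately have "finite {p. G.awalk (nu_tau x) p x \<and> length p = 2}" by (rule finite_subset)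
  then show ?thesis
    by (auto simp: free_module_def mesh_def elim: finite_subset[rotated])
qed

lemma mesh_ideal_k_ideal:
  assumes "field k" "fin_digraph Q"
  shows "k_ideal k (path_cat k (Zframed Q)) (mesh_ideal k Q)"
proof -
  interpret k: field k by fact
  interpret k: conv_ring k by unfold_locales
  interpret G: wf_digraph "Zframed Q" by (rule wf_Zframed[OF assms(2)])
  note kc = k_category_path_cat[OF assms(1) G.wf_digraph]
  interpret P: k_category k "path_cat k (Zframed Q)" by (rule kc)
  let ?H = "\<lambda>a b. free_module k {p. G.awalk a p b}"
  let ?e = "basis_elt k :: _ list \<Rightarrow> _"
  have H: "module k (?H a b)" for a b by (rule free_module_module[OF k.is_cring])
  let ?gens = "\<lambda>a b. {conv k (?e u) (conv k (mesh k Q x) (?e v)) | u x v.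
     x \<in> nonfrozen Q \<and> G.awalk a v (nu_tau x) \<and> G.awalk x u b}"
  have mi: "mesh_ideal k Q a b = LinearCombinations.module.span k (?H a b) (?gens a b)" for a b
    by (simp add: mesh_ideal_def path_cat_sel Let_def)
  have e: "?e p \<in> carrier (?H a b)" if "G.awalk a p b" for a p b
    by (rule basis_elt_closed[OF k.is_cring]) (use that in simp)
  have gens: "?gens a b \<subseteq> carrier (?H a b)" for a b
    using k.conv_free[OF G.wf_digraph k.conv_free[OF G.wf_digraph e mesh_closed[OF assms]] e] by blast
  have S: "submodule k (mesh_ideal k Q a b) (?H a b)" "?gens a b \<subseteq> mesh_ideal k Q a b" for a b
    unfolding mi using module.span_is_submodule[OF H gens] module.in_own_span[OF H gens] by auto
  have as: "conv k h (conv k g f) = conv k (conv k h g) f"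
    if "f \<in> carrier (?H a b)" "g \<in> carrier (?H b c)" "h \<in> carrier (?H c d)" for a b c d f g h
    using k.conv_assoc[of f g h, OF free_supp(3)[OF that(1)] free_supp(3)[OF that(2)] free_supp(3)[OF that(3)]]
    by auto
  have L: "conv k g p \<in> mesh_ideal k Q a c"
    if g: "g \<in> carrier (?H b c)" and p: "p \<in> ?gens a b" and v: "a \<in> verts (Zframed Q)" "b \<in> verts (Zframed Q)"
      "c \<in> verts (Zframed Q)" for a b c g p
  proof -
    obtain u x v where x: "x \<in> nonfrozen Q" "G.awalk a v (nu_tau x)" "G.awalk x u b"
      "p = conv k (?e u) (conv k (mesh k Q x) (?e v))" using p by blast
    have pc: "p \<in> carrier (?H a b)" using p gens by blast
    have m: "(\<lambda>g. conv k g p) \<in> module_hom k (?H b c) (?H a c)"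
      using P.comp_right[of a b c p] v pc by (simp add: path_cat_sel)
    show ?thesis
    proof (rule free_hom_into[OF H m S(1) _ g])
      fix q assume "q \<in> {p. G.awalk b p c}"
      then have q: "G.awalk b q c" by simp
      have "conv k (?e q) p = conv k (?e (u @ q)) (conv k (mesh k Q x) (?e v))"
        unfolding x(4)
        by (subst as[OF k.conv_free[OF G.wf_digraph e[OF x(2)] mesh_closed[OF assms]] e[OF x(3)] e[OF q]])
          (simp add: k.conv_basis)
      moreover have "G.awalk x (u @ q) c" using x(3) q by (rule G.awalk_appendI)
      ultimately have "conv k (?e q) p \<in> ?gens a c" using x(1,2) by blast
      then show "conv k (?e q) p \<in> mesh_ideal k Q a c" using S(2) by blast
    qed
  qed
  have Rt: "conv k p f \<in> mesh_ideal k Q a c"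
    if f: "f \<in> carrier (?H a b)" and p: "p \<in> ?gens b c" and v: "a \<in> verts (Zframed Q)" "b \<in> verts (Zframed Q)"
      "c \<in> verts (Zframed Q)" for a b c f p
  proof -
    obtain u x v where x: "x \<in> nonfrozen Q" "G.awalk b v (nu_tau x)" "G.awalk x u c"
      "p = conv k (?e u) (conv k (mesh k Q x) (?e v))" using p by blast
    have pc: "p \<in> carrier (?H b c)" using p gens by blast
    have m: "conv k p \<in> module_hom k (?H a b) (?H a c)"
      using P.comp_left[of a b c p] v pc by (simp add: path_cat_sel)
    show ?thesis
    proof (rule free_hom_into[OF H m S(1) _ f])
      fix q assume "q \<in> {p. G.awalk a p b}"
      then have q: "G.awalk a q b" by simp
      have "conv k p (?e q) = conv k (?e u) (conv k (conv k (mesh k Q x) (?e v)) (?e q))"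
        unfolding x(4)
        by (rule as[symmetric, OF e[OF q] k.conv_free[OF G.wf_digraph e[OF x(2)] mesh_closed[OF assms]] e[OF x(3)]])
      also have "conv k (conv k (mesh k Q x) (?e v)) (?e q) = conv k (mesh k Q x) (?e (q @ v))"
        by (subst as[symmetric, OF e[OF q] e[OF x(2)] mesh_closed[OF assms]]) (simp add: k.conv_basis)
      finally have eq: "conv k p (?e q) = conv k (?e u) (conv k (mesh k Q x) (?e (q @ v)))" .
      have "G.awalk a (q @ v) (nu_tau x)" using q x(2) by (rule G.awalk_appendI)
      then have "conv k p (?e q) \<in> ?gens a c" using x(1,3) eq by blast
      then show "conv k p (?e q) \<in> mesh_ideal k Q a c" using S(2) by blast
    qed
  qed
  show ?thesis
  proof (rule k_ideal.intro[OF kc k_ideal_axioms.intro], unfold path_cat_sel)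
    show "submodule k (mesh_ideal k Q a b) (?H a b)" for a b by (rule S(1))
  next
    fix a b c f g assume v: "a \<in> verts (Zframed Q)" "b \<in> verts (Zframed Q)" "c \<in> verts (Zframed Q)"
      and f: "f \<in> mesh_ideal k Q a b" and g: "g \<in> carrier (?H b c)"
    have m: "conv k g \<in> module_hom k (?H a b) (?H a c)"
      using P.comp_left[of a b c g] v g by (simp add: path_cat_sel)
    show "conv k g f \<in> mesh_ideal k Q a c"
      by (rule span_into[OF H H m S(1) gens L[OF g _ v] f[unfolded mi]])
  next
    fix a b c f g assume v: "a \<in> verts (Zframed Q)" "b \<in> verts (Zframed Q)" "c \<in> verts (Zframed Q)"
      and f: "f \<in> carrier (?H a b)" and g: "g \<in> mesh_ideal k Q b c"
    have m: "(\<lambda>g. conv k g f) \<in> module_hom k (?H b c) (?H a c)"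
      using P.comp_right[of a b c f] v f by (simp add: path_cat_sel)
    show "conv k g f \<in> mesh_ideal k Q a c"
      by (rule span_into[OF H H m S(1) gens Rt[OF f _ v] g[unfolded mi]])
  qed
qed

theorem k_category_Nakajima:
  assumes "field k" "fin_digraph Q"
  shows "k_category k (Nakajima k Q)"
  unfolding Nakajima_def
  by (rule k_ideal.k_category_quot[OF mesh_ideal_k_ideal[OF assms]])

theorem k_category_Nakajima_C:
  assumes "field k" "fin_digraph Q"
  shows "k_category k (Nakajima_C k Q C)"
  unfolding Nakajima_C_def
proof (rule k_ideal.k_category_quot[OF ident_ideal_k_ideal[OF k_category_Nakajima[OF assms]]])
  show "frozen Q - sigma_inv Q C \<subseteq> obj (Nakajima k Q)"
    by (auto simp: Nakajima_def quot_cat_def path_cat_def repetition_def framed_def frozen_def)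
qed

theorem kan_data_Nakajima:
  assumes "field k" "fin_digraph Q" "cat_module k (Nakajima_S k Q C) M"
  shows "kan_data k (Nakajima_C k Q C) (sigma_inv Q C) M"
proof (rule kan_data.intro[OF k_category_Nakajima_C[OF assms(1,2)] kan_data_axioms.intro])
  show "sigma_inv Q C \<subseteq> obj (Nakajima_C k Q C)"
    by (auto simp: Nakajima_C_def Nakajima_def quot_cat_def path_cat_def sigma_inv_def)
  show "cat_module k (full_subcat (Nakajima_C k Q C) (sigma_inv Q C)) M"
    using assms(3) by (simp add: Nakajima_S_def)
qed


section \<open>The intermediate extension\<close>

lemma pres_hom_into:
  fixes V :: "('r, 'v) module"
  assumes "module R V" "P \<subseteq> carrier (free_module R X)" "f \<in> module_hom R (pres R X P) V"
    "submodule R W V" "\<And>x. x \<in> X \<Longrightarrow> f (pres_gen R X P x) \<in> W" "z \<in> carrier (pres R X P)"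
  shows "f z \<in> W"
proof -
  interpret module R V by fact
  have F: "module R (free_module R X)" by (rule free_module_module) unfold_locales
  let ?q = "\<lambda>c. pres_rel R X P +>\<^bsub>free_module R X\<^esub> c"
  have q: "?q \<in> module_hom R (free_module R X) (pres R X P)"
    unfolding pres_def by (rule quot_proj_hom[OF F pres_rel_submodule(1)[OF R.is_cring assms(2)]])
  obtain c where c: "c \<in> carrier (free_module R X)" "z = ?q c"
    using assms(6) by (auto simp: pres_def quot_carrier)
  show ?thesis unfolding c(2)
    by (rule free_hom_into[OF assms(1) module_hom_compose[OF q assms(3)] assms(4) _ c(1)])
      (use assms(5) in \<open>simp add: pres_gen_def\<close>)
qed

lemma module_hom_image_submodule:
  assumes "module R V" "module R W" "f \<in> module_hom R V W"
  shows "submodule R (f ` carrier V) W"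
proof -
  interpret mod_hom R V W f using assms by (simp add: mod_hom_def mod_hom_axioms_def)
  show ?thesis using im_is_submodule by (simp add: im_def)
qed

lemma sub_mod_cat_module:
  assumes "cat_module k C M" "is_submod k C M U"
  shows "cat_module k C (sub_mod M U)"
proof -
  interpret cat_module k C M by fact
  have U: "submodule k (U a) (space M a)" if "a \<in> obj C" for a using assms(2) that by (simp add: is_submod_def)
  have st: "act M a b f x \<in> U a" if "a \<in> obj C" "b \<in> obj C" "f \<in> carrier (homs C a b)" "x \<in> U b" for a b f x
    using assms(2) that unfolding is_submod_def by blast
  have sub: "x \<in> carrier (space M a)" if "x \<in> U a" "a \<in> obj C" for x a
    using submodule.subset[OF U[OF that(2)]] that by auto
  show ?thesis
  proof (rule cat_module.intro)
    fix a assume a: "a \<in> obj C"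
    interpret v: vectorspace k "space M a" by (rule space_vs[OF a])
    show "vectorspace k (space (sub_mod M U) a)"
      using v.submodule_is_module[OF U[OF a]] v.field_axioms by (simp add: sub_mod_def vectorspace_def)
  next
    fix a b f assume o: "a \<in> obj C" "b \<in> obj C" "f \<in> carrier (homs C a b)"
    show "act (sub_mod M U) a b f \<in> module_hom k (space (sub_mod M U) b) (space (sub_mod M U) a)"
      using act_hom[OF o] st[OF o] sub o by (auto simp: sub_mod_def module_hom_def)
  next
    fix a b x assume o: "a \<in> obj C" "b \<in> obj C" and x: "x \<in> carrier (space (sub_mod M U) b)"
    show "(\<lambda>f. act (sub_mod M U) a b f x) \<in> module_hom k (homs C a b) (space (sub_mod M U) a)"
      using act_linear[OF o, of x] st[OF o] sub o x by (auto simp: sub_mod_def module_hom_def)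
  qed (use act_ident act_comp sub in \<open>auto simp: sub_mod_def\<close>)
qed

context kan_data
begin

theorem K_LR_submod: "is_submod k C (K_R k C S M) (K_LR_carrier k C S M)"
proof -
  have "act (K_R k C S M) a b f ` K_LR_carrier k C S M b \<subseteq> K_LR_carrier k C S M a"
    if o: "a \<in> obj C" "b \<in> obj C" "f \<in> carrier (homs C a b)" for a b f
  proof
    fix z assume "z \<in> act (K_R k C S M) a b f ` K_LR_carrier k C S M b"
    then obtain y where y: "y \<in> carrier (KL b)" "z = act (K_R k C S M) a b f (K_can k C S M b y)"
      using o by (auto simp: K_LR_carrier_def)
    then have "z = K_can k C S M a (act (K_L k C S M) a b f y)"
      using K_can_hom o by (simp add: cmod_hom_def)
    then show "z \<in> K_LR_carrier k C S M a"
      using module_hom_in[OF KL_act_hom[OF o] y(1)] o by (simp add: K_LR_carrier_def)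
  qed
  moreover have "submodule k (K_LR_carrier k C S M a) (KR a)" if "a \<in> obj C" for a
    using module_hom_image_submodule[OF KL_module KR_module K_can_module_hom] that
    by (simp add: K_LR_carrier_def)
  ultimately show ?thesis by (simp add: is_submod_def K_LR_carrier_def)
qed

theorem K_LR_cat_module: "cat_module k C (K_LR k C S M)"
  unfolding K_LR_def by (rule sub_mod_cat_module[OF K_R_cat_module K_LR_submod])

text \<open>The canonical inclusion of \<open>K_LR U\<close> into \<open>K_LR M\<close> is an inclusion of sets.\<close>

theorem K_LR_mono:
  assumes U: "is_submod k (full_subcat C S) M U"
  shows "is_submod k C (K_LR k C S M) (K_LR_carrier k C S (sub_mod M U))"
proof -
  interpret U: kan_data k C S "sub_mod M U"
    by (rule kan_data.intro[OF k_category_axioms kan_data_axioms.intro[OF S sub_mod_cat_module[OF M U]]])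
  have Us: "U s \<subseteq> carrier (space M s)" if "s \<in> S" for s
    using U that by (auto simp: is_submod_def dest: submodule.subset)
  have KRc: "carrier (U.KR x) \<subseteq> carrier (KR x)" if x: "x \<in> obj C" for x
    using Us by (auto simp: K_R_def cmod_hom_def rep_mod_def sub_mod_def module_hom_def Pi_iff) blast
  have KRops: "U.KR x = KR x\<lparr>carrier := carrier (U.KR x)\<rparr>" for x
    by (simp add: K_R_def sub_mod_def)
  have KRact: "act (K_R k C S (sub_mod M U)) = act (K_R k C S M)"
    by (simp add: K_R_def)
  have incl: "K_LR_carrier k C S (sub_mod M U) x \<subseteq> K_LR_carrier k C S M x" if x: "x \<in> obj C" for x
  proof
    fix z assume "z \<in> K_LR_carrier k C S (sub_mod M U) x"
    then obtain y where y: "y \<in> carrier (U.KL x)" "z = K_can k C S (sub_mod M U) x y"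
      using x by (auto simp: K_LR_carrier_def)
    have "K_can k C S (sub_mod M U) x \<in> module_hom k (U.KL x) (KR x)"
      using U.K_can_module_hom[OF x] KRc[OF x] by (subst (asm) KRops) (auto simp: module_hom_def)
    then have h: "K_can k C S (sub_mod M U) x \<in> module_hom k (pres k (U.KLX x) (U.KLR x)) (KR x)"
      by (simp add: U.KL_pres)
    have sm: "submodule k (K_LR_carrier k C S M x) (KR x)"
      using K_LR_submod x by (simp add: is_submod_def)
    have "K_can k C S (sub_mod M U) x (pres_gen k (U.KLX x) (U.KLR x) t) \<in> K_LR_carrier k C S M x"
      if t: "t \<in> U.KLX x" for t
    proof -
      obtain s g m where t': "t = (s, g, m)" "s \<in> S" "g \<in> carrier (homs C x s)" "m \<in> U s"
        using t by (auto simp: K_L_gens_def sub_mod_def)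
      have m: "m \<in> carrier (space (sub_mod M U) s)" "m \<in> carrier (space M s)"
        using t' Us by (auto simp: sub_mod_def)
      have "K_can k C S (sub_mod M U) x (U.gen x (s, g, m)) = K_can k C S M x (gen x (s, g, m))"
      proof (rule KR_eqI[of _ x])
        show "K_can k C S (sub_mod M U) x (U.gen x (s, g, m)) \<in> carrier (KR x)"
          using KRc[OF x] module_hom_in[OF U.K_can_module_hom[OF x] U.gen_closed[OF x t'(2,3) m(1)]] by auto
        show "K_can k C S M x (gen x (s, g, m)) \<in> carrier (KR x)"
          by (rule module_hom_in[OF K_can_module_hom[OF x] gen_closed[OF x t'(2,3) m(2)]])
        fix u h assume "u \<in> S" "h \<in> carrier (homs C u x)"
        then show "K_can k C S (sub_mod M U) x (U.gen x (s, g, m)) u h = K_can k C S M x (gen x (s, g, m)) u h"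
          using K_can_gen[OF x t'(2,3) m(2)] U.K_can_gen[OF x t'(2,3) m(1)] by (simp add: sub_mod_def)
      qed
      then show ?thesis
        using gen_closed[OF x t'(2,3) m(2)] x t'(1) by (simp add: K_LR_carrier_def K_L_gen_def)
    qed
    from pres_hom_into[OF KR_module[OF x] U.KL_rels_sub[OF x] h sm this y(1)[unfolded U.KL_pres]]
    show "z \<in> K_LR_carrier k C S M x" by (simp add: y(2))
  qed
  have sub: "submodule k (K_LR_carrier k C S (sub_mod M U) x) (space (K_LR k C S M) x)" if x: "x \<in> obj C" for x
  proof -
    have 1: "submodule k (K_LR_carrier k C S (sub_mod M U) x) (U.KR x)"
      using U.K_LR_submod x by (simp add: is_submod_def)
    interpret W: submodule k "K_LR_carrier k C S (sub_mod M U) x" "KR x\<lparr>carrier := carrier (U.KR x)\<rparr>"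
      using 1 KRops by simp
    interpret L: cat_module k C "K_LR k C S M" by (rule K_LR_cat_module)
    have "module k (space (K_LR k C S M) x)" using L.space_vs[OF x] by (simp add: vectorspace_def)
    then show ?thesis
      by (rule submodule.intro)
        (use incl[OF x] W.m_closed W.zero_closed W.smult_closed in \<open>auto simp: K_LR_def sub_mod_def\<close>)
  qed
  have "act (K_LR k C S M) a b f ` K_LR_carrier k C S (sub_mod M U) b \<subseteq> K_LR_carrier k C S (sub_mod M U) a"
    if "a \<in> obj C" "b \<in> obj C" "f \<in> carrier (homs C a b)" for a b f
    using U.K_LR_submod that KRact by (simp add: is_submod_def K_LR_def sub_mod_def)
  with sub show ?thesis by (simp add: is_submod_def K_LR_carrier_def)
qed

end

end

theory Submission
  imports Defs
begin

text \<open>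
  Write \<open>L\<close> for \<open>K\<^sub>L\<^sub>R(M)\<close> and \<open>L'\<close> for its submodule \<open>K\<^sub>L\<^sub>R(U)\<close>. The isomorphism sends a submodule
  \<open>N\<close> of \<open>L\<close> in the fibre to its image in \<open>L / L'\<close>; its inverse takes preimages. Schemes being
  functors of points, this has to be done for submodules \<open>N\<close> of \<open>L \<otimes> A\<close> with locally free quotient,
  naturally in the commutative \<open>k\<close>-algebra \<open>A\<close>.

  The canonical identification of \<open>res L\<close> with \<open>M\<close> takes \<open>res L'\<close> to \<open>U\<close> (\<open>K_LR_counit\<close>, \<open>counit_L'\<close>).
  So \<open>N\<close> lies over \<open>U\<close> if and only if it agrees with the image of \<open>L' \<otimes> A\<close> at all objects of the
  subcategory (\<open>fibre_condition\<close>). As a quotient of \<open>K\<^sub>L(U)\<close>, the module \<open>L'\<close> is generated by its values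
  on the subcategory (\<open>L'_generated\<close>). Hence every such \<open>N\<close> contains the image of \<open>L' \<otimes> A\<close> everywhere
  (\<open>fibre_contains_kernel\<close>). By right exactness of the tensor product this image is the kernel of
  \<open>L \<otimes> A \<rightarrow> (L / L') \<otimes> A\<close> (\<open>scal_map_ker\<close>). Therefore \<open>N\<close> is determined by its image \<open>P\<close>, and
  \<open>(L \<otimes> A) / N\<close> is isomorphic to \<open>((L / L') \<otimes> A) / P\<close> (\<open>loc_free_quotient_preimage\<close>). The ranks
  prescribed on the two sides coincide because dimensions are additive (\<open>dim_quotient\<close>). This uses that
  the spaces \<open>L(x)\<close> are finite-dimensional (\<open>K_LR_fin_dim\<close>): since \<open>Q\<close> is finite and acyclic, there are
  only finitely many paths between two vertices of the repetition quiver (\<open>finite_awalks_Zframed\<close>).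

  It remains to see that the preimage of a point \<open>P\<close> of the second Grassmannian lies over \<open>U\<close>, that is,
  that \<open>P\<close> vanishes on the subcategory. There, the dimension vector \<open>(v, w) - dim L'\<close> is zero. So the
  quotient of \<open>(L / L')(s) \<otimes> A\<close> by \<open>P(s)\<close> is locally free of a rank that equals the number of generators
  of \<open>(L / L')(s) \<otimes> A\<close>, and such a quotient map is injective (\<open>full_rank_quotient_imp_zero\<close>). The last
  fact is the theorem that a one-sided inverse of a square matrix over a commutative ring is two-sided,
  in a form that works up to powers of a ring element (\<open>left_inverse_up_to_scalar\<close>).
\<close>

(* Otherwise every sum in a ring would have a second parse as a join of vertex walks. *)
no_notation vwalk_join (infixr "\<oplus>" 65)


section \<open>Torsion with respect to the powers of a ring element\<close>

context cring
begin

text \<open>The elements that vanish in the localisation at \<open>r\<close>. Stating this with powers of \<open>r\<close> makes it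
  possible to argue about localisations without constructing them.\<close>

definition power_torsion :: "'a \<Rightarrow> 'a set" where
  "power_torsion r = {z \<in> carrier R. \<exists>n::nat. r [^] n \<otimes> z = \<zero>}"

lemma power_torsion_closed: "z \<in> power_torsion r \<Longrightarrow> z \<in> carrier R"
  by (simp add: power_torsion_def)

lemma power_torsion_smult:
  assumes "r \<in> carrier R" "z \<in> power_torsion r" "s \<in> carrier R"
  shows "s \<otimes> z \<in> power_torsion r"
proof -
  obtain n :: nat where n: "r [^] n \<otimes> z = \<zero>" and z: "z \<in> carrier R"
    using assms(2) by (auto simp: power_torsion_def)
  have "r [^] n \<otimes> (s \<otimes> z) = s \<otimes> (r [^] n \<otimes> z)" using assms z by (simp add: m_lcomm)
  then show ?thesis using n z assms by (auto simp: power_torsion_def)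
qed

lemma power_torsion_add:
  assumes "r \<in> carrier R" "z \<in> power_torsion r" "z' \<in> power_torsion r"
  shows "z \<oplus> z' \<in> power_torsion r"
proof -
  obtain n m :: nat where n: "r [^] n \<otimes> z = \<zero>" "r [^] m \<otimes> z' = \<zero>" and z: "z \<in> carrier R" "z' \<in> carrier R"
    using assms(2,3) by (auto simp: power_torsion_def)
  have "r [^] (n + m) \<otimes> (z \<oplus> z') = r [^] m \<otimes> (r [^] n \<otimes> z) \<oplus> r [^] n \<otimes> (r [^] m \<otimes> z')"
    using assms z by (simp add: nat_pow_mult[symmetric] r_distr m_ac)
  then show ?thesis using n z assms by (auto simp: power_torsion_def)
qed

lemma power_torsion_finsum:
  assumes "r \<in> carrier R" "finite T" "g \<in> T \<rightarrow> power_torsion r"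
  shows "(\<Oplus>x\<in>T. g x) \<in> power_torsion r"
  using assms(2,3)
proof (induction T)
  case empty then show ?case using assms by (auto simp: power_torsion_def)
next
  case (insert x T)
  then have "g x \<in> carrier R" "g \<in> T \<rightarrow> carrier R" by (auto dest: power_torsion_closed)
  then show ?case using insert power_torsion_add[OF assms(1)] by simp
qed

lemma power_torsion_cancel:
  assumes "r \<in> carrier R" "s \<in> carrier R" "z \<in> carrier R" "s \<otimes> z \<in> power_torsion (r \<otimes> s)"
  shows "z \<in> power_torsion (r \<otimes> s)"
proof -
  obtain n :: nat where n: "(r \<otimes> s) [^] n \<otimes> (s \<otimes> z) = \<zero>" using assms(4) by (auto simp: power_torsion_def)
  have "(r \<otimes> s) [^] Suc n \<otimes> z = r \<otimes> ((r \<otimes> s) [^] n \<otimes> (s \<otimes> z))"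
    using assms by (simp add: m_ac)
  also have "\<dots> = \<zero>" using n assms by simp
  finally show ?thesis using assms(3) unfolding power_torsion_def by blast
qed

lemma power_torsion_base_mult:
  assumes "r \<in> carrier R" "s \<in> carrier R" "z \<in> power_torsion r"
  shows "z \<in> power_torsion (s \<otimes> r)"
proof -
  obtain n :: nat where n: "r [^] n \<otimes> z = \<zero>" and z: "z \<in> carrier R" using assms(3) by (auto simp: power_torsion_def)
  have "(s \<otimes> r) [^] n \<otimes> z = s [^] n \<otimes> (r [^] n \<otimes> z)"
    using assms z by (simp add: nat_pow_distrib m_ac)
  then show ?thesis using n z assms by (auto simp: power_torsion_def)
qed

lemma power_torsion_base_pow:
  assumes "r \<in> carrier R" "z \<in> power_torsion (r [^] (m::nat))"
  shows "z \<in> power_torsion r"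
  using assms by (auto simp: power_torsion_def nat_pow_pow)

lemma power_torsion_pow:
  assumes "r \<in> carrier R" "z \<in> carrier R" "r [^] (n::nat) \<otimes> z \<in> power_torsion r"
  shows "z \<in> power_torsion r"
proof -
  obtain m :: nat where "r [^] m \<otimes> (r [^] n \<otimes> z) = \<zero>" using assms(3) by (auto simp: power_torsion_def)
  then have "r [^] (m + n) \<otimes> z = \<zero>" using assms by (simp add: nat_pow_mult[symmetric] m_assoc)
  then show ?thesis using assms(2) unfolding power_torsion_def by blast
qed

text \<open>Together with \<open>power_torsion_base_mult\<close> this makes the elements some power of which kills \<open>z\<close> an
  ideal. The proof is the usual binomial argument, organised as an induction on the sum of the two
  exponents that replaces \<open>z\<close> by \<open>r z\<close> or by \<open>s z\<close>.\<close>

lemma power_torsion_base_add: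
  assumes "r \<in> carrier R" "s \<in> carrier R" "z \<in> power_torsion r" "z \<in> power_torsion s"
  shows "z \<in> power_torsion (r \<oplus> s)"
proof -
  have key: "(r \<oplus> s) [^] (n + m) \<otimes> z = \<zero>"
    if "z \<in> carrier R" "r [^] n \<otimes> z = \<zero>" "s [^] m \<otimes> z = \<zero>" for n m :: nat and z
    using that
  proof (induction "n + m" arbitrary: n m z)
    case 0 then show ?case by simp
  next
    case (Suc l)
    show ?case
    proof (cases "n = 0 \<or> m = 0")
      case True
      then have "z = \<zero>" using Suc.prems by auto
      then show ?thesis using assms by simp
    next
      case False
      then obtain n' m' where nm: "n = Suc n'" "m = Suc m'" by (metis not0_implies_Suc)
      have "(r \<oplus> s) [^] (n' + m) \<otimes> (r \<otimes> z) = \<zero>"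
      proof (rule Suc.hyps(1))
        have "s [^] m \<otimes> (r \<otimes> z) = r \<otimes> (s [^] m \<otimes> z)" using Suc.prems assms by (simp add: m_lcomm)
        then show "s [^] m \<otimes> (r \<otimes> z) = \<zero>" using Suc.prems assms by simp
      qed (use Suc nm assms in \<open>auto simp: m_assoc\<close>)
      moreover have "(r \<oplus> s) [^] (n + m') \<otimes> (s \<otimes> z) = \<zero>"
      proof (rule Suc.hyps(1))
        have "r [^] n \<otimes> (s \<otimes> z) = s \<otimes> (r [^] n \<otimes> z)" using Suc.prems assms by (simp add: m_lcomm)
        then show "r [^] n \<otimes> (s \<otimes> z) = \<zero>" using Suc.prems assms by simp
      qed (use Suc nm assms in \<open>auto simp: m_assoc\<close>)
      moreover have "(r \<oplus> s) [^] (n + m) \<otimes> z = (r \<oplus> s) [^] (n' + m) \<otimes> (r \<otimes> z) \<oplus> (r \<oplus> s) [^] (n + m') \<otimes> (s \<otimes> z)"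
        using nm Suc.prems assms by (simp add: m_assoc r_distr l_distr)
      ultimately show ?thesis by simp
    qed
  qed
  show ?thesis using assms(3,4) key by (auto simp: power_torsion_def)
qed

lemma power_torsion_base_ideal:
  assumes "z \<in> carrier R"
  shows "ideal {r \<in> carrier R. z \<in> power_torsion r} R"
proof (rule idealI)
  show "subgroup {r \<in> carrier R. z \<in> power_torsion r} (add_monoid R)"
  proof (rule group.subgroupI)
    have "\<zero> [^] (Suc 0) \<otimes> z = \<zero>" using assms by simp
    then show "{r \<in> carrier R. z \<in> power_torsion r} \<noteq> {}" using assms unfolding power_torsion_def by blast
  next
    fix r assume "r \<in> {r \<in> carrier R. z \<in> power_torsion r}"
    then have r: "r \<in> carrier R" "z \<in> power_torsion r" by auto
    then show "inv\<^bsub>add_monoid R\<^esub> r \<in> {r \<in> carrier R. z \<in> power_torsion r}"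
      using power_torsion_base_mult[OF r(1) _ r(2), of "\<ominus> \<one>"]
      by (simp add: a_inv_def[symmetric] l_minus)
  qed (use add.group_axioms power_torsion_base_add in auto)
qed (use power_torsion_base_mult m_comm in \<open>auto intro: ring_axioms\<close>)

lemma power_torsion_base_finsum:
  assumes "z \<in> carrier R" "finite T" "g \<in> T \<rightarrow> carrier R" "\<And>x. x \<in> T \<Longrightarrow> z \<in> power_torsion (g x)"
  shows "z \<in> power_torsion (\<Oplus>x\<in>T. g x)"
  using assms(2-4)
proof (induction T)
  case empty
  have "\<zero> [^] (Suc 0) \<otimes> z = \<zero>" using assms by simp
  then have "z \<in> power_torsion \<zero>" using assms unfolding power_torsion_def by blast
  then show ?case by simp
next
  case (insert x T) then show ?case using power_torsion_base_add[of "g x" "\<Oplus>x\<in>T. g x" z] by auto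
qed

text \<open>Where \<open>a\<close> is invertible, the square matrix \<open>c\<close> has the left inverse \<open>a\<inverse> X\<close>, and the claim is that
  the only row vector \<open>y\<close> with \<open>y c = 0\<close> is zero. The proof is by elimination. Choose a column \<open>j0\<close>. If an
  entry of this column is taken as a pivot, clearing its row leaves a smaller matrix that has a left inverse
  up to the scalar \<open>a\<close> times the pivot; by induction, powers of this product kill \<open>y\<close>. Now
  \<open>a\<^sup>2 = \<Sum>k. X j0 k (a c k j0)\<close> is a combination of these products, so that powers of \<open>a\<close> kill \<open>y\<close> as well.
  Rows and columns are indexed by arbitrary finite sets to avoid renumbering them.\<close>

lemma left_inverse_up_to_scalar:
  assumes "finite I" "finite J" "card I = card J" "a \<in> carrier R"
    "\<And>i k. \<lbrakk>i \<in> J; k \<in> I\<rbrakk> \<Longrightarrow> X i k \<in> carrier R" "\<And>k j. \<lbrakk>k \<in> I; j \<in> J\<rbrakk> \<Longrightarrow> c k j \<in> carrier R"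
    "\<And>k. k \<in> I \<Longrightarrow> y k \<in> carrier R"
    "\<And>i j. \<lbrakk>i \<in> J; j \<in> J\<rbrakk> \<Longrightarrow> (\<Oplus>k\<in>I. X i k \<otimes> c k j) = (if i = j then a else \<zero>)"
    "\<And>j. j \<in> J \<Longrightarrow> (\<Oplus>k\<in>I. c k j \<otimes> y k) = \<zero>" "k \<in> I"
  shows "y k \<in> power_torsion a"
  using assms
proof (induction "card I" arbitrary: I J a c k)
  case 0 then show ?case by simp
next
  case (Suc n)
  note fin = Suc.prems(1,2) and a = Suc.prems(4) and X = Suc.prems(5) and c = Suc.prems(6) and y = Suc.prems(7)
    and inv = Suc.prems(8) and ker = Suc.prems(9)
  have "J \<noteq> {}" using Suc by auto
  then obtain j0 where j0: "j0 \<in> J" by auto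
  have step: "y l \<in> power_torsion (a \<otimes> c k0 j0)" if k0: "k0 \<in> I" and l: "l \<in> I" for k0 l
  proof -
    let ?I = "I - {k0}" and ?J = "J - {j0}" and ?p = "c k0 j0"
    \<comment> \<open>The row \<open>k0\<close> is cleared by column operations that multiply by the pivot instead of dividing by it.\<close>
    let ?c = "\<lambda>k j. ?p \<otimes> c k j \<ominus> c k0 j \<otimes> c k j0"
    have p: "?p \<in> carrier R" using c k0 j0 by simp
    have cc: "?c k j \<in> carrier R" if "k \<in> I" "j \<in> J" for k j using that c k0 j0 by simp
    have c0: "?c k0 j = \<zero>" if "j \<in> J" for j using that c k0 j0 by (simp add: m_comm r_neg minus_eq)
    have drop: "(\<Oplus>k\<in>?I. g k) = (\<Oplus>k\<in>I. g k)" if "g \<in> I \<rightarrow> carrier R" "g k0 = \<zero>" for g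
      by (rule add.finprod_mono_neutral_cong_left) (use that fin in \<open>auto simp: Pi_iff\<close>)
    have lin: "(\<Oplus>k\<in>I. X' k \<otimes> ?c k j) = ?p \<otimes> (\<Oplus>k\<in>I. X' k \<otimes> c k j) \<ominus> c k0 j \<otimes> (\<Oplus>k\<in>I. X' k \<otimes> c k j0)"
      if j: "j \<in> J" and X': "\<And>k. k \<in> I \<Longrightarrow> X' k \<in> carrier R" for X' j
    proof -
      have q: "c k0 j \<in> carrier R" using c j k0 by simp
      have "(\<Oplus>k\<in>I. X' k \<otimes> ?c k j) = (\<Oplus>k\<in>I. ?p \<otimes> (X' k \<otimes> c k j) \<oplus> (\<ominus> c k0 j) \<otimes> (X' k \<otimes> c k j0))"
        by (rule add.finprod_cong') (use X' c k0 j0 j p q in \<open>auto simp: r_distr l_minus r_minus m_ac minus_eq\<close>)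
      also have "\<dots> = (\<Oplus>k\<in>I. ?p \<otimes> (X' k \<otimes> c k j)) \<oplus> (\<Oplus>k\<in>I. (\<ominus> c k0 j) \<otimes> (X' k \<otimes> c k j0))"
        by (rule finsum_addf) (use X' c k0 j0 j in auto)
      also have "(\<Oplus>k\<in>I. ?p \<otimes> (X' k \<otimes> c k j)) = ?p \<otimes> (\<Oplus>k\<in>I. X' k \<otimes> c k j)"
        by (rule finsum_rdistr[symmetric]) (use X' c k0 j0 j fin in auto)
      also have "(\<Oplus>k\<in>I. (\<ominus> c k0 j) \<otimes> (X' k \<otimes> c k j0)) = (\<ominus> c k0 j) \<otimes> (\<Oplus>k\<in>I. X' k \<otimes> c k j0)"
        by (rule finsum_rdistr[symmetric]) (use X' c k0 j0 j fin in auto)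
      finally show ?thesis using q X' c j0 by (simp add: minus_eq l_minus)
    qed
    have others: "y k \<in> power_torsion (a \<otimes> ?p)" if k: "k \<in> ?I" for k
    proof (rule Suc.hyps(1)[of ?I ?J _ ?c])
      show "n = card ?I" "card ?I = card ?J" using Suc.hyps(2) Suc.prems(1-3) k0 j0 by simp_all
    next
      fix i j assume ij: "i \<in> ?J" "j \<in> ?J"
      have "(\<Oplus>k\<in>?I. X i k \<otimes> ?c k j) = (\<Oplus>k\<in>I. X i k \<otimes> ?c k j)"
        by (rule drop) (use X cc c0 ij k0 in auto)
      also have "\<dots> = ?p \<otimes> (if i = j then a else \<zero>) \<ominus> c k0 j \<otimes> \<zero>"
        using lin[of j "X i"] inv[of i j] inv[of i j0] X ij j0 by auto
      also have "\<dots> = (if i = j then a \<otimes> ?p else \<zero>)"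
        using p a c k0 ij by (simp add: m_comm minus_eq)
      finally show "(\<Oplus>k\<in>?I. X i k \<otimes> ?c k j) = (if i = j then a \<otimes> ?p else \<zero>)" .
    next
      fix j assume j: "j \<in> ?J"
      have comm: "(\<Oplus>k\<in>I. y k \<otimes> c k j) = \<zero>" if "j \<in> J" for j
        by (subst ker[OF that, symmetric], rule add.finprod_cong') (use y c that in \<open>auto simp: m_comm\<close>)
      have "(\<Oplus>k\<in>?I. ?c k j \<otimes> y k) = (\<Oplus>k\<in>I. ?c k j \<otimes> y k)"
        by (rule drop) (use y cc c0 j k0 in auto)
      also have "\<dots> = (\<Oplus>k\<in>I. y k \<otimes> ?c k j)"
        by (rule add.finprod_cong') (use y cc j in \<open>auto simp: m_comm\<close>)
      also have "\<dots> = \<zero>"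
        using lin[of j y] comm[of j] comm[of j0] y j j0 p c k0 by (simp add: minus_eq)
      finally show "(\<Oplus>k\<in>?I. ?c k j \<otimes> y k) = \<zero>" .
    qed (use fin X y cc k p a in auto)
    show ?thesis
    proof (cases "l = k0")
      case True
      \<comment> \<open>The remaining coordinate is recovered, up to the pivot, from the equation of the column \<open>j0\<close>.\<close>
      have split: "?p \<otimes> y k0 \<oplus> (\<Oplus>k\<in>?I. c k j0 \<otimes> y k) = \<zero>"
        using ker[OF j0] finsum_insert[of ?I k0 "\<lambda>k. c k j0 \<otimes> y k"] fin k0 c j0 y
        by (simp add: insert_absorb)
      have S: "(\<Oplus>k\<in>?I. c k j0 \<otimes> y k) \<in> power_torsion (a \<otimes> ?p)"
        by (rule power_torsion_finsum) (use fin a p others power_torsion_smult c j0 in auto)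
      have "?p \<otimes> y k0 = (\<ominus> \<one>) \<otimes> (\<Oplus>k\<in>?I. c k j0 \<otimes> y k)"
        using split p y k0 power_torsion_closed[OF S] by (simp add: l_minus) (metis m_closed minus_equality minus_minus)
      then have "?p \<otimes> y k0 \<in> power_torsion (a \<otimes> ?p)"
        using power_torsion_smult[OF _ S, of "\<ominus> \<one>"] a p by simp
      then show ?thesis using power_torsion_cancel[OF a p y[OF k0]] True by simp
    qed (use others l in auto)
  qed
  have k: "k \<in> I" by fact
  have "y k \<in> power_torsion (\<Oplus>k0\<in>I. X j0 k0 \<otimes> (a \<otimes> c k0 j0))"
    by (rule power_torsion_base_finsum)
      (use y fin X c a j0 k in \<open>auto intro!: power_torsion_base_mult step\<close>)
  also have "(\<Oplus>k0\<in>I. X j0 k0 \<otimes> (a \<otimes> c k0 j0)) = (\<Oplus>k0\<in>I. a \<otimes> (X j0 k0 \<otimes> c k0 j0))"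
    by (rule add.finprod_cong') (use X c a j0 in \<open>auto simp: m_lcomm\<close>)
  also have "\<dots> = a \<otimes> (\<Oplus>k0\<in>I. X j0 k0 \<otimes> c k0 j0)"
    by (rule finsum_rdistr[symmetric]) (use X c a j0 fin in auto)
  also have "\<dots> = a [^] (2::nat)" using inv[OF j0 j0] a by (simp add: numeral_2_eq_2)
  finally show ?case by (rule power_torsion_base_pow[OF a])
qed

end


section \<open>Quotients of full rank\<close>

lemma (in module) lincomb_lincomb:
  assumes "finite K" "finite J" "\<And>i. i \<in> K \<Longrightarrow> u i \<in> carrier R"
    "\<And>i j. \<lbrakk>i \<in> K; j \<in> J\<rbrakk> \<Longrightarrow> c i j \<in> carrier R" "\<And>j. j \<in> J \<Longrightarrow> b j \<in> carrier M"
  shows "(\<Oplus>\<^bsub>M\<^esub>i\<in>K. u i \<odot>\<^bsub>M\<^esub> (\<Oplus>\<^bsub>M\<^esub>j\<in>J. c i j \<odot>\<^bsub>M\<^esub> b j)) = (\<Oplus>\<^bsub>M\<^esub>j\<in>J. (\<Oplus>i\<in>K. u i \<otimes> c i j) \<odot>\<^bsub>M\<^esub> b j)"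
  using assms(1,3,4)
proof (induction K)
  case empty
  have "(\<Oplus>\<^bsub>M\<^esub>j\<in>J. \<zero> \<odot>\<^bsub>M\<^esub> b j) = (\<Oplus>\<^bsub>M\<^esub>j\<in>J. \<zero>\<^bsub>M\<^esub>)"
    by (rule M.add.finprod_cong') (use assms(5) in auto)
  then show ?case by simp
next
  case (insert x K)
  have "(\<Oplus>\<^bsub>M\<^esub>i\<in>insert x K. u i \<odot>\<^bsub>M\<^esub> (\<Oplus>\<^bsub>M\<^esub>j\<in>J. c i j \<odot>\<^bsub>M\<^esub> b j))
      = u x \<odot>\<^bsub>M\<^esub> (\<Oplus>\<^bsub>M\<^esub>j\<in>J. c x j \<odot>\<^bsub>M\<^esub> b j) \<oplus>\<^bsub>M\<^esub> (\<Oplus>\<^bsub>M\<^esub>i\<in>K. u i \<odot>\<^bsub>M\<^esub> (\<Oplus>\<^bsub>M\<^esub>j\<in>J. c i j \<odot>\<^bsub>M\<^esub> b j))"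
    by (rule M.finsum_insert) (use insert assms(5) in \<open>auto intro!: smult_closed M.finsum_closed\<close>)
  also have "u x \<odot>\<^bsub>M\<^esub> (\<Oplus>\<^bsub>M\<^esub>j\<in>J. c x j \<odot>\<^bsub>M\<^esub> b j) = (\<Oplus>\<^bsub>M\<^esub>j\<in>J. u x \<odot>\<^bsub>M\<^esub> (c x j \<odot>\<^bsub>M\<^esub> b j))"
    by (rule finsum_smult_ldistr) (use insert assms in auto)
  also have "(\<Oplus>\<^bsub>M\<^esub>i\<in>K. u i \<odot>\<^bsub>M\<^esub> (\<Oplus>\<^bsub>M\<^esub>j\<in>J. c i j \<odot>\<^bsub>M\<^esub> b j)) = (\<Oplus>\<^bsub>M\<^esub>j\<in>J. (\<Oplus>i\<in>K. u i \<otimes> c i j) \<odot>\<^bsub>M\<^esub> b j)"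
    using insert by simp
  also have "(\<Oplus>\<^bsub>M\<^esub>j\<in>J. u x \<odot>\<^bsub>M\<^esub> (c x j \<odot>\<^bsub>M\<^esub> b j)) \<oplus>\<^bsub>M\<^esub> \<dots>
      = (\<Oplus>\<^bsub>M\<^esub>j\<in>J. u x \<odot>\<^bsub>M\<^esub> (c x j \<odot>\<^bsub>M\<^esub> b j) \<oplus>\<^bsub>M\<^esub> (\<Oplus>i\<in>K. u i \<otimes> c i j) \<odot>\<^bsub>M\<^esub> b j)"
    by (rule M.finsum_addf[symmetric]) (use insert assms(5) in \<open>auto intro!: smult_closed R.finsum_closed\<close>)
  also have "\<dots> = (\<Oplus>\<^bsub>M\<^esub>j\<in>J. (\<Oplus>i\<in>insert x K. u i \<otimes> c i j) \<odot>\<^bsub>M\<^esub> b j)"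
  proof (rule M.add.finprod_cong')
    fix j assume j: "j \<in> J"
    have "(\<Oplus>i\<in>insert x K. u i \<otimes> c i j) = u x \<otimes> c x j \<oplus> (\<Oplus>i\<in>K. u i \<otimes> c i j)"
      by (rule R.finsum_insert) (use insert j in auto)
    moreover have "(\<Oplus>i\<in>K. u i \<otimes> c i j) \<in> carrier R" by (rule R.finsum_closed) (use insert j in auto)
    ultimately show "u x \<odot>\<^bsub>M\<^esub> (c x j \<odot>\<^bsub>M\<^esub> b j) \<oplus>\<^bsub>M\<^esub> (\<Oplus>i\<in>K. u i \<otimes> c i j) \<odot>\<^bsub>M\<^esub> b j
        = (\<Oplus>i\<in>insert x K. u i \<otimes> c i j) \<odot>\<^bsub>M\<^esub> b j"
      using insert j assms(5) by (simp add: smult_l_distr smult_assoc1)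
  qed (use insert assms(5) in \<open>auto intro!: smult_closed R.finsum_closed\<close>)
  finally show ?case .
qed

lemma quot_coset_zero_iff:
  assumes "module R V" "submodule R W V" "x \<in> carrier V"
  shows "W +>\<^bsub>V\<^esub> x = \<zero>\<^bsub>quot_module V W\<^esub> \<longleftrightarrow> x \<in> W"
proof -
  interpret module R V by fact
  interpret W: abelian_subgroup W V by (rule submodule_abelian_subgroup[OF assms(1,2)])
  have z: "\<zero>\<^bsub>quot_module V W\<^esub> = W" by (simp add: quot_module_def)
  show ?thesis unfolding z using W.a_rcos_self[OF assms(3)] W.a_rcos_const by auto
qed

text \<open>A surjection from a module with \<open>n\<close> generators onto a locally free module of rank \<open>n\<close> is injective.
  Where the quotient is free, express the generators in a basis and the basis in the generators; this
  gives two \<open>n \<times> n\<close> matrices whose product in one order is the identity, by independence of the basis. A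
  relation among the images of the generators is a row vector in the kernel of one of them, so it vanishes
  locally. All this holds up to powers of an element \<open>f\<close>; since such \<open>f\<close> generate the unit ideal,
  the coefficients of the relation vanish.\<close>

lemma full_rank_quotient_imp_zero:
  fixes A :: "'r ring" and Q :: "('r, 'q) module"
  assumes Q: "module A Q" and N: "submodule A N Q" and \<epsilon>: "\<epsilon> \<in> {..<n} \<rightarrow> carrier Q"
    and gen: "\<And>q. q \<in> carrier Q \<Longrightarrow> \<exists>y\<in>{..<n} \<rightarrow> carrier A. q = (\<Oplus>\<^bsub>Q\<^esub>i\<in>{..<n}. y i \<odot>\<^bsub>Q\<^esub> \<epsilon> i)"
    and lf: "loc_free A (quot_module Q N) (int n)"
  shows "N = {\<zero>\<^bsub>Q\<^esub>}"
proof -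
  interpret Q: module A Q by fact
  interpret N: submodule A N Q by fact
  let ?P = "quot_module Q N"
  let ?\<pi> = "\<lambda>x. N +>\<^bsub>Q\<^esub> x"
  have P: "module A ?P" by (rule quot_module_module[OF Q N])
  interpret P: module A ?P by fact
  have \<pi>: "?\<pi> \<in> module_hom A Q ?P" by (rule quot_proj_hom[OF Q N])
  have \<epsilon>Q: "\<epsilon> i \<in> carrier Q" if "i < n" for i using \<epsilon> that by auto
  have \<pi>\<epsilon>: "?\<pi> (\<epsilon> i) \<in> carrier ?P" if "i < n" for i using module_hom_in[OF \<pi>] \<epsilon>Q that by blast
  have \<pi>lin: "?\<pi> (\<Oplus>\<^bsub>Q\<^esub>i\<in>{..<n}. y i \<odot>\<^bsub>Q\<^esub> \<epsilon> i) = (\<Oplus>\<^bsub>?P\<^esub>i\<in>{..<n}. y i \<odot>\<^bsub>?P\<^esub> ?\<pi> (\<epsilon> i))"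
    if y: "y \<in> {..<n} \<rightarrow> carrier A" for y
  proof -
    have "?\<pi> (\<Oplus>\<^bsub>Q\<^esub>i\<in>{..<n}. y i \<odot>\<^bsub>Q\<^esub> \<epsilon> i) = (\<Oplus>\<^bsub>?P\<^esub>i\<in>{..<n}. ?\<pi> (y i \<odot>\<^bsub>Q\<^esub> \<epsilon> i))"
      by (rule module_hom_finsum[OF Q P \<pi>]) (use y \<epsilon>Q in auto)
    also have "\<dots> = (\<Oplus>\<^bsub>?P\<^esub>i\<in>{..<n}. y i \<odot>\<^bsub>?P\<^esub> ?\<pi> (\<epsilon> i))"
    proof (rule P.M.add.finprod_cong')
      show "?\<pi> (y i \<odot>\<^bsub>Q\<^esub> \<epsilon> i) = y i \<odot>\<^bsub>?P\<^esub> ?\<pi> (\<epsilon> i)" if "i \<in> {..<n}" for i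
        using quot_smult[OF Q N, of "y i" "\<epsilon> i"] y \<epsilon>Q that by auto
    qed (use y \<pi>\<epsilon> in auto)
    finally show ?thesis .
  qed
  have "x = \<zero>\<^bsub>Q\<^esub>" if x: "x \<in> N" for x
  proof -
    have xQ: "x \<in> carrier Q" using x N.subset by auto
    obtain y where y: "y \<in> {..<n} \<rightarrow> carrier A" and xy: "x = (\<Oplus>\<^bsub>Q\<^esub>i\<in>{..<n}. y i \<odot>\<^bsub>Q\<^esub> \<epsilon> i)"
      using gen[OF xQ] by auto
    have yA: "y i \<in> carrier A" if "i < n" for i using y that by auto
    have tors: "y i \<in> Q.power_torsion f" if f: "f \<in> carrier A" "free_at A ?P n f" and i: "i < n" for f i
    proof -
      obtain b where b: "b \<in> {..<n} \<rightarrow> carrier ?P"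
        and span: "\<forall>q\<in>carrier ?P. \<exists>(e::nat) c. c \<in> {..<n} \<rightarrow> carrier A \<and>
          (f [^]\<^bsub>A\<^esub> e) \<odot>\<^bsub>?P\<^esub> q = (\<Oplus>\<^bsub>?P\<^esub>j\<in>{..<n}. c j \<odot>\<^bsub>?P\<^esub> b j)"
        and indep: "\<forall>c. c \<in> {..<n} \<rightarrow> carrier A \<and> (\<Oplus>\<^bsub>?P\<^esub>j\<in>{..<n}. c j \<odot>\<^bsub>?P\<^esub> b j) = \<zero>\<^bsub>?P\<^esub> \<longrightarrow>
          (\<exists>e::nat. \<forall>j<n. f [^]\<^bsub>A\<^esub> e \<otimes>\<^bsub>A\<^esub> c j = \<zero>\<^bsub>A\<^esub>)"
        using f(2) unfolding free_at_def by blast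
      have bP: "b j \<in> carrier ?P" if "j < n" for j using b that by auto
      have "\<forall>k\<in>{..<n}. \<exists>ec. snd ec \<in> {..<n} \<rightarrow> carrier A \<and>
          (f [^]\<^bsub>A\<^esub> (fst ec :: nat)) \<odot>\<^bsub>?P\<^esub> ?\<pi> (\<epsilon> k) = (\<Oplus>\<^bsub>?P\<^esub>j\<in>{..<n}. snd ec j \<odot>\<^bsub>?P\<^esub> b j)"
        using span \<pi>\<epsilon> by fastforce
      from bchoice[OF this] obtain ec where "\<forall>k\<in>{..<n}. snd (ec k) \<in> {..<n} \<rightarrow> carrier A \<and>
          (f [^]\<^bsub>A\<^esub> (fst (ec k) :: nat)) \<odot>\<^bsub>?P\<^esub> ?\<pi> (\<epsilon> k) = (\<Oplus>\<^bsub>?P\<^esub>j\<in>{..<n}. snd (ec k) j \<odot>\<^bsub>?P\<^esub> b j)"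
        by blast
      then have ec: "snd (ec k) \<in> {..<n} \<rightarrow> carrier A \<and>
          (f [^]\<^bsub>A\<^esub> (fst (ec k) :: nat)) \<odot>\<^bsub>?P\<^esub> ?\<pi> (\<epsilon> k) = (\<Oplus>\<^bsub>?P\<^esub>j\<in>{..<n}. snd (ec k) j \<odot>\<^bsub>?P\<^esub> b j)"
        if "k < n" for k using that by simp
      \<comment> \<open>A common exponent for all generators: the coefficients are multiplied by the missing powers of \<open>f\<close>.\<close>
      define e where "e = (\<Sum>k<n. fst (ec k))"
      define c where "c k j = f [^]\<^bsub>A\<^esub> (e - fst (ec k)) \<otimes>\<^bsub>A\<^esub> snd (ec k) j" for k j
      have cA: "c k j \<in> carrier A" if "k < n" "j < n" for k j
        using ec[OF that(1)] that f by (auto simp: c_def)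
      have \<epsilon>c: "f [^]\<^bsub>A\<^esub> e \<odot>\<^bsub>?P\<^esub> ?\<pi> (\<epsilon> k) = (\<Oplus>\<^bsub>?P\<^esub>j\<in>{..<n}. c k j \<odot>\<^bsub>?P\<^esub> b j)" if k: "k < n" for k
      proof -
        have sc: "snd (ec k) j \<in> carrier A" if "j < n" for j using ec[OF k] that by auto
        have "fst (ec k) \<le> e" unfolding e_def by (rule member_le_sum) (use k in auto)
        then have "f [^]\<^bsub>A\<^esub> e = f [^]\<^bsub>A\<^esub> (e - fst (ec k)) \<otimes>\<^bsub>A\<^esub> f [^]\<^bsub>A\<^esub> fst (ec k)"
          using f by (simp add: Q.nat_pow_mult)
        then have "f [^]\<^bsub>A\<^esub> e \<odot>\<^bsub>?P\<^esub> ?\<pi> (\<epsilon> k) = f [^]\<^bsub>A\<^esub> (e - fst (ec k)) \<odot>\<^bsub>?P\<^esub> (f [^]\<^bsub>A\<^esub> fst (ec k) \<odot>\<^bsub>?P\<^esub> ?\<pi> (\<epsilon> k))"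
          using f \<pi>\<epsilon>[OF k] by (simp add: P.smult_assoc1)
        also have "\<dots> = f [^]\<^bsub>A\<^esub> (e - fst (ec k)) \<odot>\<^bsub>?P\<^esub> (\<Oplus>\<^bsub>?P\<^esub>j\<in>{..<n}. snd (ec k) j \<odot>\<^bsub>?P\<^esub> b j)"
          using ec[OF k] by simp
        also have "\<dots> = (\<Oplus>\<^bsub>?P\<^esub>j\<in>{..<n}. f [^]\<^bsub>A\<^esub> (e - fst (ec k)) \<odot>\<^bsub>?P\<^esub> (snd (ec k) j \<odot>\<^bsub>?P\<^esub> b j))"
          by (rule P.finsum_smult_ldistr) (use f sc bP in auto)
        also have "\<dots> = (\<Oplus>\<^bsub>?P\<^esub>j\<in>{..<n}. c k j \<odot>\<^bsub>?P\<^esub> b j)"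
          by (rule P.M.add.finprod_cong') (use f sc bP in \<open>auto simp: c_def P.smult_assoc1\<close>)
        finally show ?thesis .
      qed
      have lift: "f [^]\<^bsub>A\<^esub> e \<odot>\<^bsub>?P\<^esub> (\<Oplus>\<^bsub>?P\<^esub>k\<in>{..<n}. u k \<odot>\<^bsub>?P\<^esub> ?\<pi> (\<epsilon> k))
          = (\<Oplus>\<^bsub>?P\<^esub>j\<in>{..<n}. (\<Oplus>\<^bsub>A\<^esub>k\<in>{..<n}. u k \<otimes>\<^bsub>A\<^esub> c k j) \<odot>\<^bsub>?P\<^esub> b j)"
        if u: "u \<in> {..<n} \<rightarrow> carrier A" for u
      proof -
        have uA: "u k \<in> carrier A" if "k < n" for k using u that by auto
        have "f [^]\<^bsub>A\<^esub> e \<odot>\<^bsub>?P\<^esub> (\<Oplus>\<^bsub>?P\<^esub>k\<in>{..<n}. u k \<odot>\<^bsub>?P\<^esub> ?\<pi> (\<epsilon> k))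
            = (\<Oplus>\<^bsub>?P\<^esub>k\<in>{..<n}. f [^]\<^bsub>A\<^esub> e \<odot>\<^bsub>?P\<^esub> (u k \<odot>\<^bsub>?P\<^esub> ?\<pi> (\<epsilon> k)))"
          by (rule P.finsum_smult_ldistr) (use f uA \<pi>\<epsilon> in auto)
        also have "\<dots> = (\<Oplus>\<^bsub>?P\<^esub>k\<in>{..<n}. u k \<odot>\<^bsub>?P\<^esub> (\<Oplus>\<^bsub>?P\<^esub>j\<in>{..<n}. c k j \<odot>\<^bsub>?P\<^esub> b j))"
        proof (rule P.M.add.finprod_cong')
          fix k assume "k \<in> {..<n}"
          then have k: "k < n" by simp
          have "f [^]\<^bsub>A\<^esub> e \<odot>\<^bsub>?P\<^esub> (u k \<odot>\<^bsub>?P\<^esub> ?\<pi> (\<epsilon> k)) = u k \<odot>\<^bsub>?P\<^esub> (f [^]\<^bsub>A\<^esub> e \<odot>\<^bsub>?P\<^esub> ?\<pi> (\<epsilon> k))"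
            using f uA[OF k] \<pi>\<epsilon>[OF k] by (simp add: P.smult_assoc1[symmetric] Q.m_comm)
          then show "f [^]\<^bsub>A\<^esub> e \<odot>\<^bsub>?P\<^esub> (u k \<odot>\<^bsub>?P\<^esub> ?\<pi> (\<epsilon> k)) = u k \<odot>\<^bsub>?P\<^esub> (\<Oplus>\<^bsub>?P\<^esub>j\<in>{..<n}. c k j \<odot>\<^bsub>?P\<^esub> b j)"
            using \<epsilon>c[OF k] by simp
        qed (use uA cA bP in \<open>auto intro!: P.smult_closed P.M.finsum_closed\<close>)
        also have "\<dots> = (\<Oplus>\<^bsub>?P\<^esub>j\<in>{..<n}. (\<Oplus>\<^bsub>A\<^esub>k\<in>{..<n}. u k \<otimes>\<^bsub>A\<^esub> c k j) \<odot>\<^bsub>?P\<^esub> b j)"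
          by (rule P.lincomb_lincomb) (use uA cA bP in auto)
        finally show ?thesis .
      qed
      have "\<exists>d. d \<in> {..<n} \<rightarrow> carrier A \<and> b i = (\<Oplus>\<^bsub>?P\<^esub>k\<in>{..<n}. d k \<odot>\<^bsub>?P\<^esub> ?\<pi> (\<epsilon> k))" if i: "i < n" for i
      proof -
        obtain \<beta> where \<beta>: "\<beta> \<in> carrier Q" "b i = ?\<pi> \<beta>" using bP[OF i] by (auto simp: quot_carrier)
        obtain u where u: "u \<in> {..<n} \<rightarrow> carrier A" "\<beta> = (\<Oplus>\<^bsub>Q\<^esub>i\<in>{..<n}. u i \<odot>\<^bsub>Q\<^esub> \<epsilon> i)"
          using gen[OF \<beta>(1)] by blast
        show ?thesis using u(1) \<pi>lin[OF u(1)] \<beta>(2) u(2) by auto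
      qed
      then have "\<forall>i\<in>{..<n}. \<exists>d. d \<in> {..<n} \<rightarrow> carrier A \<and> b i = (\<Oplus>\<^bsub>?P\<^esub>k\<in>{..<n}. d k \<odot>\<^bsub>?P\<^esub> ?\<pi> (\<epsilon> k))"
        by simp
      from bchoice[OF this] obtain d where
        "\<forall>i\<in>{..<n}. d i \<in> {..<n} \<rightarrow> carrier A \<and> b i = (\<Oplus>\<^bsub>?P\<^esub>k\<in>{..<n}. d i k \<odot>\<^bsub>?P\<^esub> ?\<pi> (\<epsilon> k))"
        by blast
      then have d: "\<And>i. i < n \<Longrightarrow> d i \<in> {..<n} \<rightarrow> carrier A"
        and bd: "\<And>i. i < n \<Longrightarrow> b i = (\<Oplus>\<^bsub>?P\<^esub>k\<in>{..<n}. d i k \<odot>\<^bsub>?P\<^esub> ?\<pi> (\<epsilon> k))" by simp_all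
      have dA: "d i k \<in> carrier A" if "i < n" "k < n" for i k using d that by auto
      \<comment> \<open>The product of the two base change matrices; independence of \<open>b\<close> shows that, up to a power of \<open>f\<close>,
        it is the scalar matrix \<open>f [^] e\<close>.\<close>
      let ?g = "\<lambda>i j. (\<Oplus>\<^bsub>A\<^esub>k\<in>{..<n}. d i k \<otimes>\<^bsub>A\<^esub> c k j)"
      let ?\<delta> = "\<lambda>i j. if i = j then f [^]\<^bsub>A\<^esub> e else \<zero>\<^bsub>A\<^esub>"
      have gA: "?g i j \<in> carrier A" if "i < n" "j < n" for i j
        by (rule Q.R.finsum_closed) (use dA cA that in auto)
      have "\<exists>m::nat. \<forall>j<n. f [^]\<^bsub>A\<^esub> m \<otimes>\<^bsub>A\<^esub> (?g i j \<ominus>\<^bsub>A\<^esub> ?\<delta> i j) = \<zero>\<^bsub>A\<^esub>" if i: "i < n" for i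
      proof (rule indep[rule_format], intro conjI)
        have "(\<Oplus>\<^bsub>?P\<^esub>j\<in>{..<n}. (?g i j \<ominus>\<^bsub>A\<^esub> ?\<delta> i j) \<odot>\<^bsub>?P\<^esub> b j)
            = (\<Oplus>\<^bsub>?P\<^esub>j\<in>{..<n}. ?g i j \<odot>\<^bsub>?P\<^esub> b j \<oplus>\<^bsub>?P\<^esub> \<ominus>\<^bsub>?P\<^esub> (?\<delta> i j \<odot>\<^bsub>?P\<^esub> b j))"
          by (rule P.M.add.finprod_cong')
            (use gA bP f i in \<open>auto simp: a_minus_def P.smult_l_distr P.smult_l_minus\<close>)
        also have "\<dots> = (\<Oplus>\<^bsub>?P\<^esub>j\<in>{..<n}. ?g i j \<odot>\<^bsub>?P\<^esub> b j) \<oplus>\<^bsub>?P\<^esub> (\<Oplus>\<^bsub>?P\<^esub>j\<in>{..<n}. \<ominus>\<^bsub>?P\<^esub> (?\<delta> i j \<odot>\<^bsub>?P\<^esub> b j))"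
          by (rule P.M.finsum_addf) (use gA bP f i in auto)
        also have "(\<Oplus>\<^bsub>?P\<^esub>j\<in>{..<n}. \<ominus>\<^bsub>?P\<^esub> (?\<delta> i j \<odot>\<^bsub>?P\<^esub> b j)) = (\<Oplus>\<^bsub>?P\<^esub>j\<in>{..<n}. if i = j then \<ominus>\<^bsub>?P\<^esub> (f [^]\<^bsub>A\<^esub> e \<odot>\<^bsub>?P\<^esub> b j) else \<zero>\<^bsub>?P\<^esub>)"
          by (rule P.M.add.finprod_cong') (use bP f i in auto)
        also have "\<dots> = \<ominus>\<^bsub>?P\<^esub> (f [^]\<^bsub>A\<^esub> e \<odot>\<^bsub>?P\<^esub> b i)"
          by (rule P.M.add.finprod_singleton) (use bP f i in auto)
        also have "(\<Oplus>\<^bsub>?P\<^esub>j\<in>{..<n}. ?g i j \<odot>\<^bsub>?P\<^esub> b j) = f [^]\<^bsub>A\<^esub> e \<odot>\<^bsub>?P\<^esub> b i"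
          using lift[OF d[OF i]] bd[OF i] by simp
        also have "f [^]\<^bsub>A\<^esub> e \<odot>\<^bsub>?P\<^esub> b i \<oplus>\<^bsub>?P\<^esub> \<ominus>\<^bsub>?P\<^esub> (f [^]\<^bsub>A\<^esub> e \<odot>\<^bsub>?P\<^esub> b i) = \<zero>\<^bsub>?P\<^esub>"
          by (rule P.M.r_neg) (use f bP[OF i] in auto)
        finally show "(\<Oplus>\<^bsub>?P\<^esub>j\<in>{..<n}. (?g i j \<ominus>\<^bsub>A\<^esub> ?\<delta> i j) \<odot>\<^bsub>?P\<^esub> b j) = \<zero>\<^bsub>?P\<^esub>" .
      qed (use gA f i in auto)
      then obtain m :: "nat \<Rightarrow> nat" where m: "\<And>i j. i < n \<Longrightarrow> j < n \<Longrightarrow> f [^]\<^bsub>A\<^esub> m i \<otimes>\<^bsub>A\<^esub> (?g i j \<ominus>\<^bsub>A\<^esub> ?\<delta> i j) = \<zero>\<^bsub>A\<^esub>"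
        by metis
      define m' where "m' = (\<Sum>i<n. m i)"
      have gd: "f [^]\<^bsub>A\<^esub> m' \<otimes>\<^bsub>A\<^esub> ?g i j = (if i = j then f [^]\<^bsub>A\<^esub> (m' + e) else \<zero>\<^bsub>A\<^esub>)" if ij: "i < n" "j < n" for i j
      proof -
        have "m i \<le> m'" unfolding m'_def by (rule member_le_sum) (use ij in auto)
        then have "f [^]\<^bsub>A\<^esub> m' = f [^]\<^bsub>A\<^esub> (m' - m i) \<otimes>\<^bsub>A\<^esub> f [^]\<^bsub>A\<^esub> m i" using f by (simp add: Q.nat_pow_mult)
        then have "f [^]\<^bsub>A\<^esub> m' \<otimes>\<^bsub>A\<^esub> (?g i j \<ominus>\<^bsub>A\<^esub> ?\<delta> i j)
            = f [^]\<^bsub>A\<^esub> (m' - m i) \<otimes>\<^bsub>A\<^esub> (f [^]\<^bsub>A\<^esub> m i \<otimes>\<^bsub>A\<^esub> (?g i j \<ominus>\<^bsub>A\<^esub> ?\<delta> i j))"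
          using f gA[OF ij] by (simp add: Q.m_assoc)
        also have "\<dots> = \<zero>\<^bsub>A\<^esub>" using m[OF ij] f by simp
        finally have "f [^]\<^bsub>A\<^esub> m' \<otimes>\<^bsub>A\<^esub> ?g i j \<ominus>\<^bsub>A\<^esub> f [^]\<^bsub>A\<^esub> m' \<otimes>\<^bsub>A\<^esub> ?\<delta> i j = \<zero>\<^bsub>A\<^esub>"
          using f gA[OF ij] by (auto simp: Q.r_distr a_minus_def Q.r_minus)
        then have "f [^]\<^bsub>A\<^esub> m' \<otimes>\<^bsub>A\<^esub> ?g i j = f [^]\<^bsub>A\<^esub> m' \<otimes>\<^bsub>A\<^esub> ?\<delta> i j"
          using f gA[OF ij]
            Q.R.minus_equality[of "f [^]\<^bsub>A\<^esub> m' \<otimes>\<^bsub>A\<^esub> ?g i j" "\<ominus>\<^bsub>A\<^esub> (f [^]\<^bsub>A\<^esub> m' \<otimes>\<^bsub>A\<^esub> ?\<delta> i j)"]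
          by (simp add: a_minus_def split: if_splits)
        then show ?thesis using f by (simp add: Q.nat_pow_mult)
      qed
      \<comment> \<open>As \<open>x\<close> becomes zero in the quotient, its coordinates with respect to \<open>b\<close> vanish up to a power of \<open>f\<close>.\<close>
      have "\<exists>l::nat. \<forall>j<n. f [^]\<^bsub>A\<^esub> l \<otimes>\<^bsub>A\<^esub> (\<Oplus>\<^bsub>A\<^esub>k\<in>{..<n}. y k \<otimes>\<^bsub>A\<^esub> c k j) = \<zero>\<^bsub>A\<^esub>"
      proof (rule indep[rule_format], intro conjI)
        have "?\<pi> x = \<zero>\<^bsub>?P\<^esub>" using quot_coset_zero_iff[OF Q N xQ] x by simp
        then show "(\<Oplus>\<^bsub>?P\<^esub>j\<in>{..<n}. (\<Oplus>\<^bsub>A\<^esub>k\<in>{..<n}. y k \<otimes>\<^bsub>A\<^esub> c k j) \<odot>\<^bsub>?P\<^esub> b j) = \<zero>\<^bsub>?P\<^esub>"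
          using lift[OF y] \<pi>lin[OF y] xy f by simp
      qed (use yA cA in \<open>auto intro!: Q.R.finsum_closed\<close>)
      then obtain l :: nat where l: "\<And>j. j < n \<Longrightarrow> f [^]\<^bsub>A\<^esub> l \<otimes>\<^bsub>A\<^esub> (\<Oplus>\<^bsub>A\<^esub>k\<in>{..<n}. y k \<otimes>\<^bsub>A\<^esub> c k j) = \<zero>\<^bsub>A\<^esub>" by blast
      have "f [^]\<^bsub>A\<^esub> l \<otimes>\<^bsub>A\<^esub> y i \<in> Q.power_torsion (f [^]\<^bsub>A\<^esub> (m' + e))"
      proof (rule Q.left_inverse_up_to_scalar[of "{..<n}" "{..<n}" _ "\<lambda>i k. f [^]\<^bsub>A\<^esub> m' \<otimes>\<^bsub>A\<^esub> d i k" c])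
        fix i j assume ij: "i \<in> {..<n}" "j \<in> {..<n}"
        have "(\<Oplus>\<^bsub>A\<^esub>k\<in>{..<n}. f [^]\<^bsub>A\<^esub> m' \<otimes>\<^bsub>A\<^esub> d i k \<otimes>\<^bsub>A\<^esub> c k j) = (\<Oplus>\<^bsub>A\<^esub>k\<in>{..<n}. f [^]\<^bsub>A\<^esub> m' \<otimes>\<^bsub>A\<^esub> (d i k \<otimes>\<^bsub>A\<^esub> c k j))"
          by (rule Q.R.add.finprod_cong') (use ij f dA cA in \<open>auto simp: Q.m_assoc\<close>)
        also have "\<dots> = f [^]\<^bsub>A\<^esub> m' \<otimes>\<^bsub>A\<^esub> ?g i j"
          by (rule Q.finsum_rdistr[symmetric]) (use ij f dA cA in auto)
        also have "\<dots> = (if i = j then f [^]\<^bsub>A\<^esub> (m' + e) else \<zero>\<^bsub>A\<^esub>)" using gd ij by simp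
        finally show "(\<Oplus>\<^bsub>A\<^esub>k\<in>{..<n}. f [^]\<^bsub>A\<^esub> m' \<otimes>\<^bsub>A\<^esub> d i k \<otimes>\<^bsub>A\<^esub> c k j) = (if i = j then f [^]\<^bsub>A\<^esub> (m' + e) else \<zero>\<^bsub>A\<^esub>)" .
      next
        fix j assume j: "j \<in> {..<n}"
        have "(\<Oplus>\<^bsub>A\<^esub>k\<in>{..<n}. c k j \<otimes>\<^bsub>A\<^esub> (f [^]\<^bsub>A\<^esub> l \<otimes>\<^bsub>A\<^esub> y k)) = (\<Oplus>\<^bsub>A\<^esub>k\<in>{..<n}. f [^]\<^bsub>A\<^esub> l \<otimes>\<^bsub>A\<^esub> (y k \<otimes>\<^bsub>A\<^esub> c k j))"
          by (rule Q.R.add.finprod_cong') (use j f yA cA in \<open>auto simp: Q.m_ac\<close>)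
        also have "\<dots> = f [^]\<^bsub>A\<^esub> l \<otimes>\<^bsub>A\<^esub> (\<Oplus>\<^bsub>A\<^esub>k\<in>{..<n}. y k \<otimes>\<^bsub>A\<^esub> c k j)"
          by (rule Q.finsum_rdistr[symmetric]) (use j f yA cA in auto)
        finally show "(\<Oplus>\<^bsub>A\<^esub>k\<in>{..<n}. c k j \<otimes>\<^bsub>A\<^esub> (f [^]\<^bsub>A\<^esub> l \<otimes>\<^bsub>A\<^esub> y k)) = \<zero>\<^bsub>A\<^esub>" using l j by simp
      qed (use f dA cA yA i in auto)
      then have "f [^]\<^bsub>A\<^esub> l \<otimes>\<^bsub>A\<^esub> y i \<in> Q.power_torsion f" by (rule Q.power_torsion_base_pow[OF f(1)])
      then show ?thesis by (rule Q.power_torsion_pow[OF f(1) yA[OF i]])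
    qed
    have y0: "y i = \<zero>\<^bsub>A\<^esub>" if i: "i < n" for i
    proof -
      have "Idl\<^bsub>A\<^esub> {f \<in> carrier A. \<exists>n'. int n' = int n \<and> free_at A ?P n' f} \<subseteq> {r \<in> carrier A. y i \<in> Q.power_torsion r}"
        by (rule Q.genideal_minimal[OF Q.power_torsion_base_ideal[OF yA[OF i]]]) (use tors i in auto)
      then have "y i \<in> Q.power_torsion \<one>\<^bsub>A\<^esub>" using lf Q.R.one_closed unfolding loc_free_def by auto
      then show ?thesis using yA[OF i] by (auto simp: Q.power_torsion_def)
    qed
    have "(\<Oplus>\<^bsub>Q\<^esub>i\<in>{..<n}. y i \<odot>\<^bsub>Q\<^esub> \<epsilon> i) = (\<Oplus>\<^bsub>Q\<^esub>i\<in>{..<n}. \<zero>\<^bsub>Q\<^esub>)"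
      by (rule Q.M.add.finprod_cong') (use y0 \<epsilon>Q in auto)
    then show ?thesis using xy by simp
  qed
  then show ?thesis using N.zero_closed by auto
qed


section \<open>Quotient modules and local freeness\<close>

text \<open>The homomorphism \<open>g\<close> is constant on the cosets of \<open>W\<close>; its value is recovered as the only element of
  the image of a coset.\<close>

lemma quot_factor:
  fixes V :: "('r, 'v) module" and P :: "('r, 'p) module"
  assumes V: "module R V" and W: "submodule R W V" and P: "module R P" and g: "g \<in> module_hom R V P"
    and ker: "\<And>x. x \<in> W \<Longrightarrow> g x = \<zero>\<^bsub>P\<^esub>"
  shows "\<exists>f\<in>module_hom R (quot_module V W) P. \<forall>x\<in>carrier V. f (W +>\<^bsub>V\<^esub> x) = g x"
proof -
  interpret V: module R V by fact
  interpret P: module R P by fact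
  interpret W: submodule R W V by fact
  have eq: "g ` (W +>\<^bsub>V\<^esub> x) = {g x}" if x: "x \<in> carrier V" for x
  proof -
    have "g ` (W +>\<^bsub>V\<^esub> x) = (\<lambda>w. g (w \<oplus>\<^bsub>V\<^esub> x)) ` W" by (auto simp: a_r_coset_def')
    also have "\<dots> = (\<lambda>w. g x) ` W"
    proof (rule image_cong)
      fix w assume w: "w \<in> W"
      then have "g (w \<oplus>\<^bsub>V\<^esub> x) = g w \<oplus>\<^bsub>P\<^esub> g x"
        using g x W.subset by (auto simp: module_hom_def)
      then show "g (w \<oplus>\<^bsub>V\<^esub> x) = g x" using ker[OF w] module_hom_in[OF g x] by simp
    qed simp
    also have "\<dots> = {g x}" by (rule image_constant[OF W.zero_closed])
    finally show ?thesis .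
  qed
  define f where "f X = the_elem (g ` X)" for X
  have f: "f (W +>\<^bsub>V\<^esub> x) = g x" if "x \<in> carrier V" for x using eq[OF that] by (simp add: f_def)
  have "f \<in> module_hom R (quot_module V W) P"
    using g by (auto simp: module_hom_def quot_carrier quot_add[OF V W] quot_smult[OF V W] f)
  then show ?thesis using f by blast
qed

lemma module_iso_inverse:
  assumes "f \<in> module_hom R P P'" "bij_betw f (carrier P) (carrier P')" "module R P" "module R P'"
  shows "inv_into (carrier P) f \<in> module_hom R P' P"
proof -
  interpret P: module R P by fact
  interpret P': module R P' by fact
  let ?g = "inv_into (carrier P) f"
  have g: "?g y \<in> carrier P" "f (?g y) = y" if "y \<in> carrier P'" for y
    using bij_betw_imp_surj_on[OF assms(2)] that by (auto intro: inv_into_into f_inv_into_f)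
  have inj: "?g y = x" if "x \<in> carrier P" "y = f x" for x y
    using bij_betw_imp_inj_on[OF assms(2)] that by simp
  show ?thesis unfolding module_hom_def
    using g assms(1) by (auto intro!: inj simp: module_hom_def)
qed

lemma free_at_iso:
  assumes P: "module A P" and P': "module A P'" and f: "f \<in> module_hom A P P'"
    and bij: "bij_betw f (carrier P) (carrier P')" and g: "g \<in> carrier A" and fr: "free_at A P n g"
  shows "free_at A P' n g"
proof -
  interpret P: module A P by fact
  interpret P': module A P' by fact
  obtain b where b: "b \<in> {..<n} \<rightarrow> carrier P"
    and span: "\<And>q. q \<in> carrier P \<Longrightarrow> \<exists>(e::nat) c. c \<in> {..<n} \<rightarrow> carrier A \<and>
      (g [^]\<^bsub>A\<^esub> e) \<odot>\<^bsub>P\<^esub> q = (\<Oplus>\<^bsub>P\<^esub>j\<in>{..<n}. c j \<odot>\<^bsub>P\<^esub> b j)"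
    and indep: "\<And>c. c \<in> {..<n} \<rightarrow> carrier A \<Longrightarrow> (\<Oplus>\<^bsub>P\<^esub>j\<in>{..<n}. c j \<odot>\<^bsub>P\<^esub> b j) = \<zero>\<^bsub>P\<^esub> \<Longrightarrow>
      (\<exists>e::nat. \<forall>j<n. g [^]\<^bsub>A\<^esub> e \<otimes>\<^bsub>A\<^esub> c j = \<zero>\<^bsub>A\<^esub>)"
    using fr unfolding free_at_def by blast
  have bP: "b j \<in> carrier P" if "j < n" for j using b that by auto
  have fb: "f (b j) \<in> carrier P'" if "j < n" for j using module_hom_in[OF f bP[OF that]] .
  have lin: "f (\<Oplus>\<^bsub>P\<^esub>j\<in>{..<n}. c j \<odot>\<^bsub>P\<^esub> b j) = (\<Oplus>\<^bsub>P'\<^esub>j\<in>{..<n}. c j \<odot>\<^bsub>P'\<^esub> f (b j))"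
    if c: "c \<in> {..<n} \<rightarrow> carrier A" for c
  proof -
    have "f (\<Oplus>\<^bsub>P\<^esub>j\<in>{..<n}. c j \<odot>\<^bsub>P\<^esub> b j) = (\<Oplus>\<^bsub>P'\<^esub>j\<in>{..<n}. f (c j \<odot>\<^bsub>P\<^esub> b j))"
      by (rule module_hom_finsum[OF P P' f]) (use c bP in auto)
    also have "\<dots> = (\<Oplus>\<^bsub>P'\<^esub>j\<in>{..<n}. c j \<odot>\<^bsub>P'\<^esub> f (b j))"
      by (rule P'.M.add.finprod_cong') (use funcset_mem[OF c] bP fb module_hom_smult[OF f] in auto)
    finally show ?thesis .
  qed
  show ?thesis unfolding free_at_def
  proof (intro exI[of _ "\<lambda>j. f (b j)"] conjI ballI allI impI)
    fix q assume "q \<in> carrier P'"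
    then obtain p where p: "p \<in> carrier P" "q = f p" using bij_betw_imp_surj_on[OF bij] by auto
    obtain e :: nat and c where ec: "c \<in> {..<n} \<rightarrow> carrier A"
      "(g [^]\<^bsub>A\<^esub> e) \<odot>\<^bsub>P\<^esub> p = (\<Oplus>\<^bsub>P\<^esub>j\<in>{..<n}. c j \<odot>\<^bsub>P\<^esub> b j)" using span[OF p(1)] by blast
    have "(g [^]\<^bsub>A\<^esub> e) \<odot>\<^bsub>P'\<^esub> q = f ((g [^]\<^bsub>A\<^esub> e) \<odot>\<^bsub>P\<^esub> p)" using f p g by (simp add: module_hom_def)
    then have "(g [^]\<^bsub>A\<^esub> e) \<odot>\<^bsub>P'\<^esub> q = (\<Oplus>\<^bsub>P'\<^esub>j\<in>{..<n}. c j \<odot>\<^bsub>P'\<^esub> f (b j))"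
      using ec(2) lin[OF ec(1)] by simp
    then show "\<exists>(e::nat) c. c \<in> {..<n} \<rightarrow> carrier A \<and> (g [^]\<^bsub>A\<^esub> e) \<odot>\<^bsub>P'\<^esub> q = (\<Oplus>\<^bsub>P'\<^esub>j\<in>{..<n}. c j \<odot>\<^bsub>P'\<^esub> f (b j))"
      using ec(1) by blast
  next
    fix c assume c: "c \<in> {..<n} \<rightarrow> carrier A \<and> (\<Oplus>\<^bsub>P'\<^esub>j\<in>{..<n}. c j \<odot>\<^bsub>P'\<^esub> f (b j)) = \<zero>\<^bsub>P'\<^esub>"
    let ?s = "\<Oplus>\<^bsub>P\<^esub>j\<in>{..<n}. c j \<odot>\<^bsub>P\<^esub> b j"
    have s: "?s \<in> carrier P" by (rule P.M.finsum_closed) (use c bP in auto)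
    have "f ?s = f \<zero>\<^bsub>P\<^esub>" using c lin[of c] module_hom_zero[OF P P' f] by simp
    then have "?s = \<zero>\<^bsub>P\<^esub>" using inj_onD[OF bij_betw_imp_inj_on[OF bij] _ s] by simp
    then show "\<exists>e::nat. \<forall>j<n. g [^]\<^bsub>A\<^esub> e \<otimes>\<^bsub>A\<^esub> c j = \<zero>\<^bsub>A\<^esub>" using indep c by blast
  qed (use fb in auto)
qed

lemma loc_free_iso:
  assumes P: "module A P" and P': "module A P'" and f: "f \<in> module_hom A P P'"
    and bij: "bij_betw f (carrier P) (carrier P')"
  shows "loc_free A P r \<longleftrightarrow> loc_free A P' r"
proof -
  have "free_at A P n g \<longleftrightarrow> free_at A P' n g" if "g \<in> carrier A" for n g
    using free_at_iso[OF P P' f bij that]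
      free_at_iso[OF P' P module_iso_inverse[OF f bij P P'] bij_betw_inv_into[OF bij] that] by blast
  then have "{f \<in> carrier A. \<exists>n. int n = r \<and> free_at A P n f} = {f \<in> carrier A. \<exists>n. int n = r \<and> free_at A P' n f}"
    by auto
  then show ?thesis by (simp add: loc_free_def)
qed

text \<open>The formula for the isomorphism on cosets is part of the conclusion because the computation of
  kernels after extension of scalars has to invert it explicitly.\<close>

lemma first_isomorphism:
  fixes V :: "('r, 'v) module" and P :: "('r, 'p) module"
  assumes V: "module R V" and P: "module R P" and g: "g \<in> module_hom R V P"
    and surj: "g ` carrier V = carrier P" and W: "W = {x \<in> carrier V. g x = \<zero>\<^bsub>P\<^esub>}"
  shows "submodule R W V"
    "\<exists>f\<in>module_hom R (quot_module V W) P. bij_betw f (carrier (quot_module V W)) (carrier P) \<and>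
      (\<forall>x\<in>carrier V. f (W +>\<^bsub>V\<^esub> x) = g x)"
proof -
  interpret mod_hom R V P g using V P g by (simp add: mod_hom_def mod_hom_axioms_def)
  show Ws: "submodule R W V" using ker_is_submodule by (simp add: ker_def W)
  obtain f where f: "f \<in> module_hom R (quot_module V W) P" and fg: "\<And>x. x \<in> carrier V \<Longrightarrow> f (W +>\<^bsub>V\<^esub> x) = g x"
    using quot_factor[OF V Ws P g] by (auto simp: W)
  interpret Q: module R "quot_module V W" by (rule quot_module_module[OF V Ws])
  interpret f: mod_hom R "quot_module V W" P f
    using Q.module_axioms P f by (simp add: mod_hom_def mod_hom_axioms_def)
  have "x = y" if x: "x \<in> carrier (quot_module V W)" and y: "y \<in> carrier (quot_module V W)" and e: "f x = f y" for x y
  proof -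
    obtain x' y' where x': "x' \<in> carrier V" "x = W +>\<^bsub>V\<^esub> x'" and y': "y' \<in> carrier V" "y = W +>\<^bsub>V\<^esub> y'"
      using x y by (auto simp: quot_carrier)
    have "g (x' \<ominus>\<^bsub>V\<^esub> y') = \<zero>\<^bsub>P\<^esub>"
      using e fg x' y' module_hom_in[OF g y'(1)] by (simp add: N.M.r_neg a_minus_def)
    then have "x' \<ominus>\<^bsub>V\<^esub> y' \<in> W" using x' y' by (simp add: W)
    interpret W: abelian_subgroup W V by (rule submodule_abelian_subgroup[OF V Ws])
    have "x' = (x' \<ominus>\<^bsub>V\<^esub> y') \<oplus>\<^bsub>V\<^esub> y'" using x' y' by (simp add: a_minus_def M.M.a_assoc M.M.l_neg)
    then have "x' \<in> W +>\<^bsub>V\<^esub> y'" using \<open>x' \<ominus>\<^bsub>V\<^esub> y' \<in> W\<close> by (auto simp: a_r_coset_def')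
    from W.a_repr_independence'[OF this y'(1)] show ?thesis using x' y' by simp
  qed
  then have "inj_on f (carrier (quot_module V W))" by (auto simp: inj_on_def)
  moreover have "f ` carrier (quot_module V W) = carrier P"
  proof -
    have "f ` carrier (quot_module V W) = g ` carrier V" using fg by (simp add: quot_carrier image_image)
    then show ?thesis using surj by simp
  qed
  ultimately show "\<exists>f\<in>module_hom R (quot_module V W) P. bij_betw f (carrier (quot_module V W)) (carrier P) \<and>
      (\<forall>x\<in>carrier V. f (W +>\<^bsub>V\<^esub> x) = g x)"
    using f fg unfolding bij_betw_def by blast
qed

lemma submodule_preimage:
  assumes V: "module R V" and P: "module R P" and g: "g \<in> module_hom R V P" and W: "submodule R W P"
  shows "submodule R {x \<in> carrier V. g x \<in> W} V"
proof -
  interpret mod_hom R V P g using V P g by (simp add: mod_hom_def mod_hom_axioms_def)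
  interpret W: submodule R W P by fact
  show ?thesis by (rule submodule.intro) (use V in auto)
qed

lemma submodule_image:
  assumes V: "module R V" and P: "module R P" and g: "g \<in> module_hom R V P" and W: "submodule R W V"
  shows "submodule R (g ` W) P"
proof -
  interpret V: module R V by fact
  interpret W: submodule R W V by fact
  have "module R (V\<lparr>carrier := W\<rparr>)" by (rule V.submodule_is_module[OF W])
  moreover have "g \<in> module_hom R (V\<lparr>carrier := W\<rparr>) P"
    using g subsetD[OF W.subset] by (auto simp: module_hom_def)
  ultimately show ?thesis using module_hom_image_submodule[OF _ P, of "V\<lparr>carrier := W\<rparr>" g] by simp
qed

lemma preimage_of_image:
  assumes V: "module R V" and P: "module R P" and g: "g \<in> module_hom R V P" and W: "submodule R W V"
    and ker: "{x \<in> carrier V. g x = \<zero>\<^bsub>P\<^esub>} \<subseteq> W"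
  shows "{x \<in> carrier V. g x \<in> g ` W} = W"
proof
  interpret mod_hom R V P g using V P g by (simp add: mod_hom_def mod_hom_axioms_def)
  interpret W: submodule R W V by fact
  show "W \<subseteq> {x \<in> carrier V. g x \<in> g ` W}" using W.subset by auto
  show "{x \<in> carrier V. g x \<in> g ` W} \<subseteq> W"
  proof clarify
    fix x y assume x: "x \<in> carrier V" and y: "y \<in> W" and e: "g x = g y"
    have yV: "y \<in> carrier V" using y W.subset by auto
    have "g (x \<ominus>\<^bsub>V\<^esub> y) = \<zero>\<^bsub>P\<^esub>" using x yV e module_hom_in[OF g yV] by (simp add: N.M.r_neg a_minus_def)
    then have "x \<ominus>\<^bsub>V\<^esub> y \<in> W" using ker x yV by auto
    moreover have "x = (x \<ominus>\<^bsub>V\<^esub> y) \<oplus>\<^bsub>V\<^esub> y" using x yV by (simp add: a_minus_def M.M.a_assoc M.M.l_neg)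
    ultimately show "x \<in> W" using W.m_closed[of "x \<ominus>\<^bsub>V\<^esub> y" y] y by simp
  qed
qed

lemma image_span:
  assumes V: "module R V" and P: "module R P" and g: "g \<in> module_hom R V P" and X: "X \<subseteq> carrier V"
  shows "g ` LinearCombinations.module.span R V X = LinearCombinations.module.span R P (g ` X)"
proof -
  interpret V: module R V by fact
  interpret P: module R P by fact
  have gX: "g ` X \<subseteq> carrier P" using X module_hom_in[OF g] by auto
  have "g x \<in> P.span (g ` X)" if "x \<in> V.span X" for x
    by (rule span_into[OF V P g P.span_is_submodule[OF gX] X _ that]) (use P.in_own_span[OF gX] in auto)
  moreover have "P.span (g ` X) \<subseteq> g ` V.span X"
    by (rule P.span_is_subset) (use V.in_own_span[OF X] submodule_image[OF V P g V.span_is_submodule[OF X]] in auto)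
  ultimately show ?thesis by auto
qed

text \<open>Preimages under a surjection do not change the quotient, hence not its rank: this is what makes
  the two Grassmannians have the same points.\<close>

lemma loc_free_quotient_preimage:
  assumes V: "module A V" and P: "module A P" and g: "g \<in> module_hom A V P"
    and surj: "g ` carrier V = carrier P" and W: "submodule A W P"
  shows "loc_free A (quot_module V {x \<in> carrier V. g x \<in> W}) r \<longleftrightarrow> loc_free A (quot_module P W) r"
proof -
  let ?\<pi> = "\<lambda>x. W +>\<^bsub>P\<^esub> x"
  have \<pi>: "?\<pi> \<in> module_hom A P (quot_module P W)" by (rule quot_proj_hom[OF P W])
  have h: "(\<lambda>x. ?\<pi> (g x)) \<in> module_hom A V (quot_module P W)" by (rule module_hom_compose[OF g \<pi>])
  have s: "(\<lambda>x. ?\<pi> (g x)) ` carrier V = carrier (quot_module P W)"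
    unfolding quot_carrier surj[symmetric] by auto
  have k: "{x \<in> carrier V. g x \<in> W} = {x \<in> carrier V. ?\<pi> (g x) = \<zero>\<^bsub>quot_module P W\<^esub>}"
    using quot_coset_zero_iff[OF P W module_hom_in[OF g]] by auto
  note Q = quot_module_module[OF P W]
  note fi = first_isomorphism[OF V Q h s k]
  show ?thesis using loc_free_iso[OF quot_module_module[OF V fi(1)] Q] fi(2) by blast
qed


section \<open>Extension of scalars\<close>

text \<open>A map that is additive and semilinear along \<open>h\<close> is a homomorphism to \<open>restrict_scalars h N\<close>. With
  this reading, facts about homomorphisms also cover semilinear maps.\<close>

definition restrict_scalars :: "('k \<Rightarrow> 'r) \<Rightarrow> ('r, 'n) module \<Rightarrow> ('k, 'n) module" where
  "restrict_scalars h N =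
     \<lparr>carrier = carrier N, monoid.mult = monoid.mult N, one = one N, zero = zero N, add = add N,
      smult = (\<lambda>r x. h r \<odot>\<^bsub>N\<^esub> x)\<rparr>"

lemma restrict_scalars_sel [simp]:
  "carrier (restrict_scalars h N) = carrier N" "\<zero>\<^bsub>restrict_scalars h N\<^esub> = \<zero>\<^bsub>N\<^esub>"
  "x \<oplus>\<^bsub>restrict_scalars h N\<^esub> y = x \<oplus>\<^bsub>N\<^esub> y" "r \<odot>\<^bsub>restrict_scalars h N\<^esub> x = h r \<odot>\<^bsub>N\<^esub> x"
  by (simp_all add: restrict_scalars_def)

text \<open>Sums are formed in a record whose extension field is the unspecified element of the type of the
  extension. It is the same on both sides only if the two rings have elements of the same type.\<close>

lemma restrict_scalars_finsum:
  fixes \<phi> :: "'r \<Rightarrow> 'r" and N :: "('r, 'n) module"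
  shows "finsum (restrict_scalars \<phi> N) = finsum N"
  by (simp add: fun_eq_iff finsum_def restrict_scalars_def)

lemma (in abelian_group) eq_if_minus_zero:
  assumes "x \<in> carrier G" "y \<in> carrier G" "x \<ominus> y = \<zero>"
  shows "x = y"
proof -
  have "x = (x \<ominus> y) \<oplus> y" using assms(1,2) by (simp add: a_minus_def a_assoc l_neg)
  then show ?thesis using assms by simp
qed

lemma (in module) span_image_indexed:
  assumes "finite I" "x \<in> I \<rightarrow> carrier M" "z \<in> span (x ` I)"
  shows "\<exists>y\<in>I \<rightarrow> carrier R. z = (\<Oplus>\<^bsub>M\<^esub>i\<in>I. y i \<odot>\<^bsub>M\<^esub> x i)"
proof -
  let ?S = "\<lambda>y. \<Oplus>\<^bsub>M\<^esub>i\<in>I. y i \<odot>\<^bsub>M\<^esub> x i"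
  have x: "x i \<in> carrier M" if "i \<in> I" for i using assms(2) that by auto
  have "submodule R {?S y | y. y \<in> I \<rightarrow> carrier R} M"
  proof (rule submodule.intro)
    show "{?S y | y. y \<in> I \<rightarrow> carrier R} \<subseteq> carrier M" using x by (auto intro!: M.finsum_closed)
    have "?S (\<lambda>_. \<zero>) = (\<Oplus>\<^bsub>M\<^esub>i\<in>I. \<zero>\<^bsub>M\<^esub>)" by (rule M.add.finprod_cong') (use x in auto)
    then show "\<zero>\<^bsub>M\<^esub> \<in> {?S y | y. y \<in> I \<rightarrow> carrier R}"
      by (intro CollectI exI[of _ "\<lambda>_. \<zero>"]) auto
  next
    fix u v assume "u \<in> {?S y | y. y \<in> I \<rightarrow> carrier R}" "v \<in> {?S y | y. y \<in> I \<rightarrow> carrier R}"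
    then obtain y y' where y: "y \<in> I \<rightarrow> carrier R" "u = ?S y" "y' \<in> I \<rightarrow> carrier R" "v = ?S y'" by blast
    have yR: "y i \<in> carrier R" "y' i \<in> carrier R" if "i \<in> I" for i using y that by auto
    have "u \<oplus>\<^bsub>M\<^esub> v = (\<Oplus>\<^bsub>M\<^esub>i\<in>I. y i \<odot>\<^bsub>M\<^esub> x i \<oplus>\<^bsub>M\<^esub> y' i \<odot>\<^bsub>M\<^esub> x i)"
      unfolding y by (rule M.finsum_addf[symmetric]) (use yR x in auto)
    also have "\<dots> = ?S (\<lambda>i. y i \<oplus> y' i)"
      by (rule M.add.finprod_cong') (use yR x in \<open>auto simp: smult_l_distr\<close>)
    finally show "u \<oplus>\<^bsub>M\<^esub> v \<in> {?S y | y. y \<in> I \<rightarrow> carrier R}"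
      using yR by (intro CollectI exI[of _ "\<lambda>i. y i \<oplus> y' i"]) auto
  next
    fix r u assume r: "r \<in> carrier R" and "u \<in> {?S y | y. y \<in> I \<rightarrow> carrier R}"
    then obtain y where y: "y \<in> I \<rightarrow> carrier R" "u = ?S y" by blast
    have yR: "y i \<in> carrier R" if "i \<in> I" for i using y that by auto
    have "r \<odot>\<^bsub>M\<^esub> u = (\<Oplus>\<^bsub>M\<^esub>i\<in>I. r \<odot>\<^bsub>M\<^esub> (y i \<odot>\<^bsub>M\<^esub> x i))"
      unfolding y by (rule finsum_smult_ldistr) (use yR x r assms(1) in auto)
    also have "\<dots> = ?S (\<lambda>i. r \<otimes> y i)"
      by (rule M.add.finprod_cong') (use yR x r in \<open>auto simp: smult_assoc1\<close>)
    finally show "r \<odot>\<^bsub>M\<^esub> u \<in> {?S y | y. y \<in> I \<rightarrow> carrier R}"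
      using yR r by (intro CollectI exI[of _ "\<lambda>i. r \<otimes> y i"]) auto
  qed (rule module_axioms)
  moreover have "x ` I \<subseteq> {?S y | y. y \<in> I \<rightarrow> carrier R}"
  proof
    fix v assume "v \<in> x ` I"
    then obtain j where j: "j \<in> I" "v = x j" by auto
    have "?S (\<lambda>i. if j = i then \<one> else \<zero>) = (\<Oplus>\<^bsub>M\<^esub>i\<in>I. if j = i then x i else \<zero>\<^bsub>M\<^esub>)"
      by (rule M.add.finprod_cong') (use x in auto)
    also have "\<dots> = x j" by (rule M.add.finprod_singleton) (use j x assms(1) in auto)
    finally show "v \<in> {?S y | y. y \<in> I \<rightarrow> carrier R}" using j by (intro CollectI exI[of _ "\<lambda>i. if j = i then \<one> else \<zero>"]) auto
  qed
  ultimately have "span (x ` I) \<subseteq> {?S y | y. y \<in> I \<rightarrow> carrier R}" by (intro span_is_subset) auto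
  then show ?thesis using assms(3) by blast
qed

locale scalar_extension =
  fixes k :: "'k ring" and A :: "'r ring" and h :: "'k \<Rightarrow> 'r"
  assumes k: "cring k" and A: "cring A" and h: "h \<in> ring_hom k A"
begin

sublocale k: cring k by (rule k)
sublocale A: cring A by (rule A)

lemma h_closed [simp]: "r \<in> carrier k \<Longrightarrow> h r \<in> carrier A"
  using ring_hom_closed[OF h] .

lemma restrict_scalars_module:
  assumes "module A N" shows "module k (restrict_scalars h N)"
proof -
  interpret N: module A N by fact
  show ?thesis
  proof (rule moduleI)
    show "abelian_group (restrict_scalars h N)"
      by (rule abelian_groupI)
        (auto simp: N.M.a_ac intro: bexI[of _ "\<ominus>\<^bsub>N\<^esub> x" for x] N.M.l_neg)
  qed (use ring_hom_add[OF h] ring_hom_mult[OF h] ring_hom_one[OF h] in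
      \<open>auto simp: N.smult_l_distr N.smult_r_distr N.smult_assoc1 k.is_cring\<close>)
qed

lemma restrict_scalars_hom:
  "f \<in> module_hom A N P \<Longrightarrow> f \<in> module_hom k (restrict_scalars h N) (restrict_scalars h P)"
  by (simp add: module_hom_def)

lemma restrict_scalars_submodule:
  assumes "submodule A W N" shows "submodule k W (restrict_scalars h N)"
proof -
  interpret W: submodule A W N by fact
  show ?thesis
    by (rule submodule.intro) (use W.subset restrict_scalars_module[OF W.module] in auto)
qed

abbreviation "ext V \<equiv> scal k A h V"
abbreviation "tensor V \<equiv> scal_gen k A h V"

text \<open>The relations of \<open>V \<otimes> A\<close> in the form of a universal property: applied to the projection onto
  \<open>V \<otimes> A\<close> it yields the semilinearity of \<open>v \<mapsto> v \<otimes> 1\<close>, and in the other direction it provides the maps out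
  of \<open>V \<otimes> A\<close>.\<close>

lemma scalar_rels_hom:
  fixes V :: "('k, 'v) module" and N :: "('r, 'n) module"
  assumes V: "module k V" and N: "module A N" and f: "f \<in> module_hom A (free_module A (carrier V)) N"
  shows "scalar_rels k A h V \<subseteq> carrier (free_module A (carrier V))"
    and "(\<forall>p\<in>scalar_rels k A h V. f p = \<zero>\<^bsub>N\<^esub>) \<longleftrightarrow>
      (\<lambda>v. f (basis_elt A v)) \<in> module_hom k V (restrict_scalars h N)"
proof -
  interpret V: module k V by fact
  interpret N: module A N by fact
  let ?F = "free_module A (carrier V)"
  let ?e = "basis_elt A :: 'v \<Rightarrow> 'v \<Rightarrow> 'r"
  interpret F: module A ?F by (rule free_module_module[OF A])
  interpret f: mod_hom A ?F N f using F.module_axioms N f by (simp add: mod_hom_def mod_hom_axioms_def)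
  have e: "?e v \<in> carrier ?F" if "v \<in> carrier V" for v by (rule basis_elt_closed[OF A that])
  show "scalar_rels k A h V \<subseteq> carrier ?F"
    using e by (auto simp: scalar_rels_def Let_def)
  have fe: "f (?e v) \<in> carrier N" if "v \<in> carrier V" for v using e[OF that] by simp
  have 1: "f (?e (v \<oplus>\<^bsub>V\<^esub> w) \<ominus>\<^bsub>?F\<^esub> (?e v \<oplus>\<^bsub>?F\<^esub> ?e w)) = \<zero>\<^bsub>N\<^esub> \<longleftrightarrow> f (?e (v \<oplus>\<^bsub>V\<^esub> w)) = f (?e v) \<oplus>\<^bsub>N\<^esub> f (?e w)"
    if "v \<in> carrier V" "w \<in> carrier V" for v w
  proof -
    have "f (?e (v \<oplus>\<^bsub>V\<^esub> w) \<ominus>\<^bsub>?F\<^esub> (?e v \<oplus>\<^bsub>?F\<^esub> ?e w)) = f (?e (v \<oplus>\<^bsub>V\<^esub> w)) \<ominus>\<^bsub>N\<^esub> (f (?e v) \<oplus>\<^bsub>N\<^esub> f (?e w))"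
      using that e by simp
    then show ?thesis using N.M.eq_if_minus_zero fe that by (auto simp: a_minus_def N.M.r_neg)
  qed
  have 2: "f (?e (r \<odot>\<^bsub>V\<^esub> v) \<ominus>\<^bsub>?F\<^esub> h r \<odot>\<^bsub>?F\<^esub> ?e v) = \<zero>\<^bsub>N\<^esub> \<longleftrightarrow> f (?e (r \<odot>\<^bsub>V\<^esub> v)) = h r \<odot>\<^bsub>N\<^esub> f (?e v)"
    if "r \<in> carrier k" "v \<in> carrier V" for r v
  proof -
    have "f (?e (r \<odot>\<^bsub>V\<^esub> v) \<ominus>\<^bsub>?F\<^esub> h r \<odot>\<^bsub>?F\<^esub> ?e v) = f (?e (r \<odot>\<^bsub>V\<^esub> v)) \<ominus>\<^bsub>N\<^esub> h r \<odot>\<^bsub>N\<^esub> f (?e v)"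
      using that e by simp
    then show ?thesis using N.M.eq_if_minus_zero fe that by (auto simp: a_minus_def N.M.r_neg)
  qed
  have "(\<forall>p\<in>scalar_rels k A h V. f p = \<zero>\<^bsub>N\<^esub>) \<longleftrightarrow>
      (\<forall>v w. v \<in> carrier V \<and> w \<in> carrier V \<longrightarrow> f (?e (v \<oplus>\<^bsub>V\<^esub> w) \<ominus>\<^bsub>?F\<^esub> (?e v \<oplus>\<^bsub>?F\<^esub> ?e w)) = \<zero>\<^bsub>N\<^esub>) \<and>
      (\<forall>r v. r \<in> carrier k \<and> v \<in> carrier V \<longrightarrow> f (?e (r \<odot>\<^bsub>V\<^esub> v) \<ominus>\<^bsub>?F\<^esub> h r \<odot>\<^bsub>?F\<^esub> ?e v) = \<zero>\<^bsub>N\<^esub>)"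
    unfolding scalar_rels_def Let_def by blast
  also have "\<dots> \<longleftrightarrow> (\<lambda>v. f (?e v)) \<in> module_hom k V (restrict_scalars h N)"
    using 1 2 fe by (simp add: module_hom_def)
  finally show "(\<forall>p\<in>scalar_rels k A h V. f p = \<zero>\<^bsub>N\<^esub>) \<longleftrightarrow> (\<lambda>v. f (?e v)) \<in> module_hom k V (restrict_scalars h N)" .
qed

lemma scalar_rels_sub:
  assumes "module k V" shows "scalar_rels k A h V \<subseteq> carrier (free_module A (carrier V))"
  by (rule scalar_rels_hom(1)[OF assms free_module_module[OF A], of "\<lambda>x. x" "carrier V"]) (simp add: module_hom_def)

lemma ext_module: "module k V \<Longrightarrow> module A (ext V)"
  unfolding scal_def by (rule pres_module[OF A scalar_rels_sub])

lemma tensor_closed: "v \<in> carrier V \<Longrightarrow> tensor V v \<in> carrier (ext V)"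
  unfolding scal_def scal_gen_def by (rule pres_gen_closed[OF A])

lemma tensor_image: "X \<subseteq> carrier V \<Longrightarrow> tensor V ` X \<subseteq> carrier (ext V)"
  by (intro image_subsetI tensor_closed) auto

lemma tensor_hom:
  assumes V: "module k V" shows "tensor V \<in> module_hom k V (restrict_scalars h (ext V))"
proof -
  let ?F = "free_module A (carrier V)" and ?W = "pres_rel A (carrier V) (scalar_rels k A h V)"
  let ?q = "\<lambda>c. ?W +>\<^bsub>?F\<^esub> c"
  note W = pres_rel_submodule[OF A scalar_rels_sub[OF V]]
  note F = free_module_module[OF A, of "carrier V"]
  have q: "?q \<in> module_hom A ?F (ext V)"
    unfolding scal_def pres_def by (rule quot_proj_hom[OF F W(1)])
  have "?q p = \<zero>\<^bsub>ext V\<^esub>" if "p \<in> scalar_rels k A h V" for p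
    using quot_coset_zero_iff[OF F W(1), of p] that W(2) scalar_rels_sub[OF V] by (auto simp: scal_def pres_def)
  then have "(\<lambda>v. ?q (basis_elt A v)) \<in> module_hom k V (restrict_scalars h (ext V))"
    using scalar_rels_hom(2)[OF V ext_module[OF V] q] by blast
  then show ?thesis by (simp add: scal_gen_def[abs_def] pres_gen_def[abs_def])
qed

text \<open>Extension of scalars is left adjoint to restriction of scalars; \<open>ext_eqI\<close> is the uniqueness part.\<close>

lemma ext_lift:
  assumes V: "module k V" and N: "module A N" and F: "F \<in> module_hom k V (restrict_scalars h N)"
  shows "pres_map A id N F \<in> module_hom A (ext V) N"
    and "v \<in> carrier V \<Longrightarrow> pres_map A id N F (tensor V v) = F v"
proof -
  interpret V: module k V by fact
  have FX: "F \<in> carrier V \<rightarrow> carrier N" using F by (simp add: module_hom_def)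
  have l: "lin_ext A id N F \<in> module_hom A (free_module A (carrier V)) N" by (rule lin_ext_hom[OF N FX])
  have "(\<lambda>v. lin_ext A id N F (basis_elt A v)) \<in> module_hom k V (restrict_scalars h N)"
    using F lin_ext_basis[OF N FX] by (auto simp: module_hom_def)
  then have "\<forall>p\<in>scalar_rels k A h V. lin_ext A id N F p = \<zero>\<^bsub>N\<^esub>"
    using scalar_rels_hom(2)[OF V N l] by blast
  note pm = pres_map[OF N FX scalar_rels_sub[OF V] this[rule_format]]
  show "pres_map A id N F \<in> module_hom A (ext V) N" unfolding scal_def by (rule pm(1))
  show "v \<in> carrier V \<Longrightarrow> pres_map A id N F (tensor V v) = F v" unfolding scal_gen_def by (rule pm(2))
qed

lemma ext_eqI:
  fixes N :: "('r, 'n) module"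
  assumes "module k V" "module A N" "f \<in> module_hom A (ext V) N" "g \<in> module_hom A (ext V) N"
    "\<And>v. v \<in> carrier V \<Longrightarrow> f (tensor V v) = g (tensor V v)" "z \<in> carrier (ext V)"
  shows "f z = g z"
  by (rule pres_hom_eqI[OF assms(2) scalar_rels_sub[OF assms(1)], of f g])
    (use assms in \<open>auto simp: scal_def scal_gen_def\<close>)

lemma ext_subset:
  fixes V :: "('k, 'v) module"
  assumes "module k V" "submodule A W (ext V)" "\<And>v. v \<in> carrier V \<Longrightarrow> tensor V v \<in> W"
  shows "carrier (ext V) \<subseteq> W"
proof
  fix z assume z: "z \<in> carrier (ext V)"
  have "(\<lambda>z. z) \<in> module_hom A (pres A (carrier V) (scalar_rels k A h V)) (ext V)"
    by (simp add: module_hom_def scal_def)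
  from pres_hom_into[OF ext_module[OF assms(1)] scalar_rels_sub[OF assms(1)] this, of W z]
  show "z \<in> W" using assms(2,3) z by (simp add: scal_def scal_gen_def)
qed

lemma scal_map_hom:
  assumes "module k V" "module k W" "f \<in> module_hom k V W"
  shows "scal_map k A h W f \<in> module_hom A (ext V) (ext W)"
    and "v \<in> carrier V \<Longrightarrow> scal_map k A h W f (tensor V v) = tensor W (f v)"
  unfolding scal_map_def
  using ext_lift[OF assms(1) ext_module[OF assms(2)] module_hom_compose[OF assms(3) tensor_hom[OF assms(2)]]]
  by auto

lemma scal_map_compose:
  fixes V :: "('k, 'v) module" and W :: "('k, 'w) module" and X :: "('k, 'x) module"
  assumes V: "module k V" and W: "module k W" and X: "module k X"
    and f: "f \<in> module_hom k V W" and g: "g \<in> module_hom k W X" and z: "z \<in> carrier (ext V)"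
  shows "scal_map k A h X g (scal_map k A h W f z) = scal_map k A h X (\<lambda>v. g (f v)) z"
  by (rule ext_eqI[OF V ext_module[OF X] module_hom_compose[OF scal_map_hom(1)[OF V W f] scal_map_hom(1)[OF W X g]]
        scal_map_hom(1)[OF V X module_hom_compose[OF f g]] _ z])
    (use scal_map_hom(2)[OF V W f] scal_map_hom(2)[OF W X g] scal_map_hom(2)[OF V X module_hom_compose[OF f g]]
       module_hom_in[OF f] in simp)

lemma scal_map_cong:
  assumes V: "module k V" and W: "module k W" and f: "f \<in> module_hom k V W" and g: "g \<in> module_hom k V W"
    and "\<And>v. v \<in> carrier V \<Longrightarrow> f v = g v" and z: "z \<in> carrier (ext V)"
  shows "scal_map k A h W f z = scal_map k A h W g z"
  by (rule ext_eqI[OF V ext_module[OF W] scal_map_hom(1)[OF V W f] scal_map_hom(1)[OF V W g] _ z])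
    (use scal_map_hom(2)[OF V W f] scal_map_hom(2)[OF V W g] assms(5) in simp)

lemma scal_map_surj:
  assumes V: "module k V" and W: "module k W" and f: "f \<in> module_hom k V W" and s: "f ` carrier V = carrier W"
  shows "scal_map k A h W f ` carrier (ext V) = carrier (ext W)"
proof
  show "scal_map k A h W f ` carrier (ext V) \<subseteq> carrier (ext W)"
    using module_hom_in[OF scal_map_hom(1)[OF V W f]] by auto
  show "carrier (ext W) \<subseteq> scal_map k A h W f ` carrier (ext V)"
  proof (rule ext_subset[OF W])
    show "submodule A (scal_map k A h W f ` carrier (ext V)) (ext W)"
      by (rule module_hom_image_submodule[OF ext_module[OF V] ext_module[OF W] scal_map_hom(1)[OF V W f]])
    fix w assume "w \<in> carrier W"
    then obtain v where v: "v \<in> carrier V" "w = f v" using s by auto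
    then have "tensor W w = scal_map k A h W f (tensor V v)" using scal_map_hom(2)[OF V W f] by simp
    then show "tensor W w \<in> scal_map k A h W f ` carrier (ext V)" using tensor_closed[OF v(1)] by auto
  qed
qed

text \<open>The image of \<open>X \<otimes> A\<close> in \<open>V \<otimes> A\<close> if \<open>X\<close> is a subspace of \<open>V\<close>.\<close>

definition ext_sub :: "('k, 'v) module \<Rightarrow> 'v set \<Rightarrow> ('v \<Rightarrow> 'r) set set" where
  "ext_sub V X = LinearCombinations.module.span A (ext V) (tensor V ` X)"

lemma ext_sub_submodule:
  assumes "module k V" "X \<subseteq> carrier V"
  shows "submodule A (ext_sub V X) (ext V)" "tensor V ` X \<subseteq> ext_sub V X"
proof -
  interpret E: module A "ext V" by (rule ext_module[OF assms(1)])
  have "tensor V ` X \<subseteq> carrier (ext V)" by (rule tensor_image[OF assms(2)])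
  then show "submodule A (ext_sub V X) (ext V)" "tensor V ` X \<subseteq> ext_sub V X"
    unfolding ext_sub_def using E.span_is_submodule E.in_own_span by auto
qed

lemma ext_sub_least:
  assumes "module k V" "submodule A W (ext V)" "tensor V ` X \<subseteq> W"
  shows "ext_sub V X \<subseteq> W"
  unfolding ext_sub_def by (rule module.span_is_subset[OF ext_module[OF assms(1)] assms(3,2)])

lemma scal_map_ext_sub:
  assumes V: "module k V" and W: "module k W" and f: "f \<in> module_hom k V W" and X: "X \<subseteq> carrier V"
  shows "scal_map k A h W f ` ext_sub V X = ext_sub W (f ` X)"
proof -
  have "scal_map k A h W f ` tensor V ` X = tensor W ` f ` X"
    using X scal_map_hom(2)[OF V W f] by (auto simp: image_image intro!: image_cong)
  then show ?thesis unfolding ext_sub_def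
    using image_span[OF ext_module[OF V] ext_module[OF W] scal_map_hom(1)[OF V W f] tensor_image[OF X]]
    by simp
qed

text \<open>Right exactness of the tensor product. Modulo \<open>ext_sub V K\<close>, the map \<open>v \<mapsto> v \<otimes> 1\<close> factors over
  \<open>V / K\<close>, which is isomorphic to \<open>W\<close>. The resulting map on \<open>W\<close> extends to \<open>W \<otimes> A\<close>, and composing it with
  the map induced by \<open>f\<close> gives the projection modulo \<open>ext_sub V K\<close>. So whatever is sent to zero by the map
  induced by \<open>f\<close> lies in \<open>ext_sub V K\<close>.\<close>

lemma scal_map_ker:
  fixes V :: "('k, 'v) module" and W :: "('k, 'w) module"
  assumes V: "module k V" and W: "module k W" and f: "f \<in> module_hom k V W" and s: "f ` carrier V = carrier W"
    and K: "K = {v \<in> carrier V. f v = \<zero>\<^bsub>W\<^esub>}"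
  shows "{z \<in> carrier (ext V). scal_map k A h W f z = \<zero>\<^bsub>ext W\<^esub>} = ext_sub V K"
proof
  interpret f: mod_hom k V W f using V W f by (simp add: mod_hom_def mod_hom_axioms_def)
  interpret EV: module A "ext V" by (rule ext_module[OF V])
  interpret EW: module A "ext W" by (rule ext_module[OF W])
  note m = scal_map_hom[OF V W f]
  interpret m: mod_hom A "ext V" "ext W" "scal_map k A h W f"
    using EV.module_axioms EW.module_axioms m(1) by (simp add: mod_hom_def mod_hom_axioms_def)
  have KV: "K \<subseteq> carrier V" by (auto simp: K)
  note sub = ext_sub_submodule[OF V KV]
  have t0: "tensor W \<zero>\<^bsub>W\<^esub> = \<zero>\<^bsub>ext W\<^esub>"
    using module_hom_zero[OF W restrict_scalars_module[OF EW.module_axioms] tensor_hom[OF W]] by simp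
  show "ext_sub V K \<subseteq> {z \<in> carrier (ext V). scal_map k A h W f z = \<zero>\<^bsub>ext W\<^esub>}"
    by (rule ext_sub_least[OF V])
      (use m.ker_is_submodule m(2) KV tensor_closed t0 in \<open>auto simp: m.ker_def K\<close>)
  let ?P = "quot_module (ext V) (ext_sub V K)"
  let ?\<pi> = "\<lambda>z. ext_sub V K +>\<^bsub>ext V\<^esub> z"
  note P = quot_module_module[OF EV.module_axioms sub(1)]
  note \<pi> = quot_proj_hom[OF EV.module_axioms sub(1)]
  interpret KS: submodule k K V using f.ker_is_submodule by (simp add: f.ker_def K)
  have \<pi>t: "(\<lambda>v. ?\<pi> (tensor V v)) \<in> module_hom k V (restrict_scalars h ?P)"
    by (rule module_hom_compose[OF tensor_hom[OF V] restrict_scalars_hom[OF \<pi>]])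
  have "?\<pi> (tensor V v) = \<zero>\<^bsub>restrict_scalars h ?P\<^esub>" if "v \<in> K" for v
    using quot_coset_zero_iff[OF EV.module_axioms sub(1) tensor_closed, of v] that KV sub(2) by auto
  from quot_factor[OF V KS.submodule_axioms restrict_scalars_module[OF P] \<pi>t this]
  obtain g where g: "g \<in> module_hom k (quot_module V K) (restrict_scalars h ?P)"
    and g\<pi>: "\<And>v. v \<in> carrier V \<Longrightarrow> g (K +>\<^bsub>V\<^esub> v) = ?\<pi> (tensor V v)" by blast
  obtain f' where f': "f' \<in> module_hom k (quot_module V K) W" "bij_betw f' (carrier (quot_module V K)) (carrier W)"
    and ff: "\<And>v. v \<in> carrier V \<Longrightarrow> f' (K +>\<^bsub>V\<^esub> v) = f v"
    using first_isomorphism(2)[OF V W f s K] by blast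
  let ?i = "inv_into (carrier (quot_module V K)) f'"
  note i = module_iso_inverse[OF f' quot_module_module[OF V KS.submodule_axioms] W]
  have ifv: "?i (f v) = K +>\<^bsub>V\<^esub> v" if "v \<in> carrier V" for v
    using inv_into_f_f[OF bij_betw_imp_inj_on[OF f'(2)], of "K +>\<^bsub>V\<^esub> v"] ff[OF that] that by (simp add: quot_carrier)
  note gi = module_hom_compose[OF i g]
  note s = ext_lift[OF W P gi]
  show "{z \<in> carrier (ext V). scal_map k A h W f z = \<zero>\<^bsub>ext W\<^esub>} \<subseteq> ext_sub V K"
  proof clarify
    fix z assume z: "z \<in> carrier (ext V)" "scal_map k A h W f z = \<zero>\<^bsub>ext W\<^esub>"
    have "pres_map A id ?P (\<lambda>x. g (?i x)) (scal_map k A h W f z) = ?\<pi> z"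
      by (rule ext_eqI[OF V P module_hom_compose[OF m(1) s(1)] \<pi> _ z(1)])
        (use m(2) s(2) module_hom_in[OF f] g\<pi> ifv in simp)
    then have "?\<pi> z = \<zero>\<^bsub>?P\<^esub>" using module_hom_zero[OF EW.module_axioms P s(1)] z(2) by simp
    then show "z \<in> ext_sub V K" using quot_coset_zero_iff[OF EV.module_axioms sub(1) z(1)] by simp
  qed
qed

lemma scal_map_inj:
  fixes V :: "('k, 'v) module" and W :: "('k, 'w) module"
  assumes V: "module k V" and W: "module k W" and f: "f \<in> module_hom k V W" and b: "bij_betw f (carrier V) (carrier W)"
  shows "inj_on (scal_map k A h W f) (carrier (ext V))"
proof (rule inj_on_inverseI)
  let ?i = "inv_into (carrier V) f"
  note i = module_iso_inverse[OF f b V W]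
  fix z assume z: "z \<in> carrier (ext V)"
  have id: "(\<lambda>v. v) \<in> module_hom k V V" "(\<lambda>z. z) \<in> module_hom A (ext V) (ext V)" by (simp_all add: module_hom_def)
  have "scal_map k A h V ?i (scal_map k A h W f z) = scal_map k A h V (\<lambda>v. v) z"
    unfolding scal_map_compose[OF V W V f i z]
    by (rule scal_map_cong[OF V V module_hom_compose[OF f i] id(1) _ z])
      (use inv_into_f_f[OF bij_betw_imp_inj_on[OF b]] in simp)
  also have "\<dots> = z"
    by (rule ext_eqI[OF V ext_module[OF V] scal_map_hom(1)[OF V V id(1)] id(2) _ z]) (use scal_map_hom(2)[OF V V id(1)] in simp)
  finally show "scal_map k A h V ?i (scal_map k A h W f z) = z" .
qed

lemma ext_generated:
  fixes V :: "('k, 'v) module"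
  assumes V: "module k V" and X: "X \<subseteq> carrier V" "LinearCombinations.module.span k V X = carrier V"
  shows "ext_sub V X = carrier (ext V)"
proof
  note sub = ext_sub_submodule[OF V X(1)]
  show "ext_sub V X \<subseteq> carrier (ext V)" using submodule.subset[OF sub(1)] .
  show "carrier (ext V) \<subseteq> ext_sub V X"
  proof (rule ext_subset[OF V sub(1)])
    fix v assume "v \<in> carrier V"
    then have "v \<in> LinearCombinations.module.span k V X" using X by simp
    then show "tensor V v \<in> ext_sub V X"
      by (rule span_into[OF V restrict_scalars_module[OF ext_module[OF V]] tensor_hom[OF V]
            restrict_scalars_submodule[OF sub(1)] X(1), rotated]) (use sub(2) in auto)
  qed
qed

end

locale scalar_change = A: scalar_extension k A h + B: scalar_extension k B h'
  for k :: "'k ring" and A :: "'r ring" and h :: "'k \<Rightarrow> 'r" and B :: "'r ring" and h' :: "'k \<Rightarrow> 'r" +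
  fixes \<phi> :: "'r \<Rightarrow> 'r"
  assumes \<phi>: "\<phi> \<in> k_alg_hom k A h B h'"
begin

sublocale AB: scalar_extension A B \<phi>
  by unfold_locales (use \<phi> A.A B.A in \<open>auto simp: k_alg_hom_def\<close>)

text \<open>The change of algebras is \<open>A\<close>-linear as a map to a restriction of scalars. Hence it is an instance of
  \<open>ext_lift\<close>, and identities involving it can be checked on the elements \<open>v \<otimes> 1\<close>.\<close>

lemma change_hom:
  assumes V: "module k V"
  shows "scal_change k A B h' \<phi> V \<in> module_hom A (A.ext V) (restrict_scalars \<phi> (B.ext V))"
    and "v \<in> carrier V \<Longrightarrow> scal_change k A B h' \<phi> V (A.tensor V v) = B.tensor V v"
proof -
  have "lin_ext A \<phi> (B.ext V) (B.tensor V) = lin_ext A id (restrict_scalars \<phi> (B.ext V)) (B.tensor V)"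
    by (simp add: lin_ext_def fun_eq_iff restrict_scalars_finsum)
  then have eq: "scal_change k A B h' \<phi> V = pres_map A id (restrict_scalars \<phi> (B.ext V)) (B.tensor V)"
    by (simp add: scal_change_def pres_map_def fun_eq_iff)
  have "B.tensor V \<in> module_hom k V (restrict_scalars h (restrict_scalars \<phi> (B.ext V)))"
    using B.tensor_hom[OF V] \<phi> by (simp add: module_hom_def k_alg_hom_def)
  from A.ext_lift[OF V AB.restrict_scalars_module[OF B.ext_module[OF V]] this]
  show "scal_change k A B h' \<phi> V \<in> module_hom A (A.ext V) (restrict_scalars \<phi> (B.ext V))"
    "v \<in> carrier V \<Longrightarrow> scal_change k A B h' \<phi> V (A.tensor V v) = B.tensor V v"
    unfolding eq by auto
qed

lemma change_natural:
  fixes V :: "('k, 'v) module" and W :: "('k, 'w) module"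
  assumes V: "module k V" and W: "module k W" and f: "f \<in> module_hom k V W" and z: "z \<in> carrier (A.ext V)"
  shows "scal_change k A B h' \<phi> W (scal_map k A h W f z) = scal_map k B h' W f (scal_change k A B h' \<phi> V z)"
  by (rule A.ext_eqI[OF V AB.restrict_scalars_module[OF B.ext_module[OF W]]
        module_hom_compose[OF A.scal_map_hom(1)[OF V W f] change_hom(1)[OF W]]
        module_hom_compose[OF change_hom(1)[OF V] AB.restrict_scalars_hom[OF B.scal_map_hom(1)[OF V W f]]] _ z])
    (use A.scal_map_hom(2)[OF V W f] B.scal_map_hom(2)[OF V W f] change_hom(2)[OF V] change_hom(2)[OF W]
       module_hom_in[OF f] in simp)

text \<open>Taking images of submodules commutes with the pullback of points of Grassmannians.\<close>

lemma span_change_natural: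
  fixes V :: "('k, 'v) module" and W :: "('k, 'w) module"
  assumes V: "module k V" and W: "module k W" and f: "f \<in> module_hom k V W" and X: "X \<subseteq> carrier (A.ext V)"
  shows "scal_map k B h' W f ` LinearCombinations.module.span B (B.ext V) (scal_change k A B h' \<phi> V ` X)
    = LinearCombinations.module.span B (B.ext W) (scal_change k A B h' \<phi> W ` scal_map k A h W f ` X)"
proof -
  have c: "scal_change k A B h' \<phi> V ` X \<subseteq> carrier (B.ext V)"
    using X module_hom_in[OF change_hom(1)[OF V]] by auto
  have "scal_map k B h' W f ` scal_change k A B h' \<phi> V ` X = scal_change k A B h' \<phi> W ` scal_map k A h W f ` X"
    unfolding image_image by (rule image_cong) (use change_natural[OF V W f] X in auto)
  then show ?thesis
    using image_span[OF B.ext_module[OF V] B.ext_module[OF W] B.scal_map_hom(1)[OF V W f] c] by simp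
qed

end


section \<open>Dimensions of subspaces and quotients\<close>

lemma linear_mapI:
  "\<lbrakk>vectorspace k V; vectorspace k W; f \<in> module_hom k V W\<rbrakk> \<Longrightarrow> linear_map k V W f"
  by (simp add: linear_map_def mod_hom_def mod_hom_axioms_def vectorspace_def)

text \<open>Independent subsets of \<open>W\<close> remain independent in \<open>V\<close>, so their size is bounded, and one of maximal
  size spans \<open>W\<close>.\<close>

lemma fin_dim_subspace:
  assumes V: "vectorspace k V" and f: "vectorspace.fin_dim k V" and W: "submodule k W V"
  shows "vectorspace.fin_dim k (V\<lparr>carrier := W\<rparr>)"
proof -
  interpret V: vectorspace k V by fact
  interpret Ws: submodule k W V by fact
  interpret W: vectorspace k "V\<lparr>carrier := W\<rparr>"
    using V.submodule_is_module[OF W] V.field_axioms by (simp add: vectorspace_def)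
  have bound: "finite X \<and> card X \<le> V.dim" if X: "X \<subseteq> W" "W.lin_indpt X" for X
  proof -
    have "V.lin_indpt X" using V.span_li_not_depend(2)[OF X(1) W] X(2) by simp
    moreover have "X \<subseteq> carrier V" using X(1) Ws.subset by auto
    ultimately show ?thesis using V.li_le_dim[OF f] V.fin_dim_li_fin[OF f] by blast
  qed
  have "W.lin_indpt {}" by (auto simp: W.lin_dep_def)
  from maximal_exists[of "\<lambda>X. X \<subseteq> W \<and> W.lin_indpt X", OF bound] this
  obtain X where X: "finite X" "maximal X (\<lambda>X. X \<subseteq> W \<and> W.lin_indpt X)" by auto
  then have "X \<subseteq> W" by (simp add: maximal_def)
  moreover have "W.gen_set X" using W.max_li_is_gen X(2) by simp
  ultimately show ?thesis using X(1) by (auto simp: W.fin_dim_def)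
qed

lemma dim_quotient:
  assumes V: "vectorspace k V" and f: "vectorspace.fin_dim k V" and W: "submodule k W V"
  shows "vectorspace k (quot_module V W)" "vectorspace.fin_dim k (quot_module V W)"
    "int (vectorspace.dim k (quot_module V W)) = int (vectorspace.dim k V) - int (vectorspace.dim k (V\<lparr>carrier := W\<rparr>))"
proof -
  interpret V: vectorspace k V by fact
  have Vm: "module k V" by unfold_locales
  show Q: "vectorspace k (quot_module V W)"
    using quot_module_module[OF Vm W] V.field_axioms by (simp add: vectorspace_def)
  interpret T: linear_map k V "quot_module V W" "\<lambda>x. W +>\<^bsub>V\<^esub> x"
    by (rule linear_mapI[OF V Q quot_proj_hom[OF Vm W]])
  have s: "(\<lambda>x. W +>\<^bsub>V\<^esub> x) ` carrier V = carrier (quot_module V W)" by (simp add: quot_carrier)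
  show "vectorspace.fin_dim k (quot_module V W)" by (rule T.rank_nullity_main(2)[OF f s])
  have "T.ker = W"
    using quot_coset_zero_iff[OF Vm W] submodule.subset[OF W] by (auto simp: T.ker_def)
  moreover have "T.im = carrier (quot_module V W)" using s by (simp add: T.im_def)
  ultimately show "int (vectorspace.dim k (quot_module V W)) = int (vectorspace.dim k V) - int (vectorspace.dim k (V\<lparr>carrier := W\<rparr>))"
    using T.rank_nullity[OF f] by simp
qed

lemma (in scalar_extension) full_rank_quotient_ext:
  fixes V :: "('k, 'v) module"
  assumes V: "vectorspace k V" and f: "vectorspace.fin_dim k V" and N: "submodule A N (ext V)"
    and lf: "loc_free A (quot_module (ext V) N) (int (vectorspace.dim k V))"
  shows "N = {\<zero>\<^bsub>ext V\<^esub>}"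
proof -
  interpret V: vectorspace k V by fact
  have Vm: "module k V" by unfold_locales
  interpret E: module A "ext V" by (rule ext_module[OF Vm])
  obtain X where X: "finite X" "V.basis X" using V.finite_basis_exists[OF f] by blast
  then have Xs: "X \<subseteq> carrier V" "V.span X = carrier V" "card X = V.dim"
    using V.dim_basis by (auto simp: V.basis_def)
  obtain x where x: "bij_betw x {..<V.dim} X"
    using ex_bij_betw_nat_finite[OF X(1)] Xs(3) by (auto simp: atLeast0LessThan)
  then have xX: "x ` {..<V.dim} = X" by (simp add: bij_betw_def)
  have t: "(\<lambda>i. tensor V (x i)) \<in> {..<V.dim} \<rightarrow> carrier (ext V)"
    using xX Xs(1) by (auto intro!: tensor_closed)
  show ?thesis
  proof (rule full_rank_quotient_imp_zero[OF E.module_axioms N t _ lf])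
    fix q assume "q \<in> carrier (ext V)"
    then have "q \<in> E.span (tensor V ` X)" using ext_generated[OF Vm Xs(1,2)] by (simp add: ext_sub_def)
    then have "q \<in> E.span ((\<lambda>i. tensor V (x i)) ` {..<V.dim})" using xX by (simp add: image_image[symmetric])
    from E.span_image_indexed[OF _ t this]
    show "\<exists>y\<in>{..<V.dim} \<rightarrow> carrier A. q = (\<Oplus>\<^bsub>ext V\<^esub>i\<in>{..<V.dim}. y i \<odot>\<^bsub>ext V\<^esub> tensor V (x i))" by simp
  qed
qed


section \<open>Finite-dimensionality of intermediate extensions\<close>

text \<open>The height of a vertex is the number of vertices from which a nontrivial walk leads to it.\<close>

lemma (in fin_digraph) acyclic_height:
  assumes "\<nexists>p. cycle p"
  shows "\<exists>ht :: 'a \<Rightarrow> nat. (\<forall>e\<in>arcs G. ht (tail G e) < ht (head G e)) \<and> (\<forall>v. ht v \<le> card (verts G))"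
proof -
  let ?P = "\<lambda>v. {u \<in> verts G. \<exists>p. awalk u p v \<and> p \<noteq> []}"
  have "card (?P (tail G e)) < card (?P (head G e))" if e: "e \<in> arcs G" for e
  proof (rule psubset_card_mono)
    have sub: "?P (tail G e) \<subseteq> ?P (head G e)"
    proof clarify
      fix u p assume p: "awalk u p (tail G e)"
      have "awalk u (p @ [e]) (head G e)"
        by (rule awalk_appendI[OF p]) (use e in \<open>simp add: awalk_simps\<close>)
      then show "\<exists>p. awalk u p (head G e) \<and> p \<noteq> []" by blast
    qed
    have "awalk (tail G e) [e] (head G e)" using e by (simp add: awalk_simps)
    then have "tail G e \<in> ?P (head G e)" using e by blast
    moreover have "tail G e \<notin> ?P (tail G e)"
      using closed_w_imp_cycle assms by (auto simp: closed_w_def)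
    ultimately show "?P (tail G e) \<subset> ?P (head G e)" using sub by blast
  qed simp
  moreover have "card (?P v) \<le> card (verts G)" for v by (rule card_mono) auto
  ultimately show ?thesis by (intro exI[of _ "\<lambda>v. card (?P v)"]) blast
qed

text \<open>A function that increases along arrows bounds the length of the walks between two given vertices,
  and there are finitely many walks of bounded length.\<close>

lemma (in wf_digraph) finite_awalks:
  fixes \<psi> :: "'a \<Rightarrow> int"
  assumes fin: "\<And>v. finite (out_arcs G v)" and \<psi>: "\<And>e. e \<in> arcs G \<Longrightarrow> \<psi> (tail G e) < \<psi> (head G e)"
  shows "finite {p. awalk a p b}"
proof -
  have len: "int (length p) \<le> \<psi> b - \<psi> a" if "awalk a p b" for p
    using that
  proof (induction p arbitrary: a)
    case Nil then show ?case by (simp add: awalk_simps)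
  next
    case (Cons e p)
    then have "e \<in> arcs G" "a = tail G e" "awalk (head G e) p b" by (simp_all add: awalk_simps)
    then show ?case using Cons.IH[of "head G e"] \<psi>[of e] by simp
  qed
  have "finite {p. length p \<le> n \<and> awalk a p b}" for n
  proof (induction n arbitrary: a)
    case 0
    have "{p. length p \<le> 0 \<and> awalk a p b} \<subseteq> {[]}" by auto
    then show ?case using finite_subset by blast
  next
    case (Suc n)
    have "{p. length p \<le> Suc n \<and> awalk a p b}
        \<subseteq> {[]} \<union> (\<Union>e\<in>out_arcs G a. (#) e ` {p. length p \<le> n \<and> awalk (head G e) p b})"
    proof
      fix p assume "p \<in> {p. length p \<le> Suc n \<and> awalk a p b}"
      then show "p \<in> {[]} \<union> (\<Union>e\<in>out_arcs G a. (#) e ` {p. length p \<le> n \<and> awalk (head G e) p b})"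
        by (cases p) (auto simp: awalk_simps)
    qed
    then show ?case using Suc fin by (auto intro: finite_subset)
  qed
  moreover have "{p. awalk a p b} \<subseteq> {p. length p \<le> nat (\<psi> b - \<psi> a) \<and> awalk a p b}"
    using len by force
  ultimately show ?thesis using finite_subset by blast
qed

text \<open>The arrows \<open>(\<alpha>, p)\<close> increase the height in the framed quiver and keep the second coordinate. The
  arrows \<open>\<sigma>(\<alpha>, p)\<close> decrease the height, by at most \<open>m\<close>, and increase the second coordinate by one. So the
  height plus \<open>m + 1\<close> times the second coordinate increases along all arrows.\<close>

lemma finite_awalks_Zframed:
  assumes "fin_digraph Q" "\<nexists>p. pre_digraph.cycle Q p"
  shows "finite {p. pre_digraph.awalk (Zframed Q) a p b}"
proof -
  interpret Q: fin_digraph Q by fact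
  interpret Z: wf_digraph "Zframed Q" by (rule wf_Zframed[OF assms(1)])
  obtain ht where ht: "\<And>e. e \<in> arcs Q \<Longrightarrow> ht (tail Q e) < ht (head Q e)" "\<And>v. ht v \<le> card (verts Q)"
    using Q.acyclic_height[OF assms(2)] by blast
  define m where "m = int (card (verts Q)) + 1"
  define ht' where "ht' i = (case i of Inl v \<Rightarrow> int (ht v) | Inr v \<Rightarrow> m)" for i :: "'a + 'a"
  have ht': "0 \<le> ht' i" "ht' i \<le> m" for i
    using ht(2) by (auto simp: ht'_def m_def split: sum.splits intro: order_trans[of _ "int (card (verts Q))"])
  have fr: "ht' (tail (framed Q) e) < ht' (head (framed Q) e)" if "e \<in> arcs (framed Q)" for e
    using that ht(1) ht(2) le_imp_less_Suc[OF ht(2)] by (auto simp: framed_def ht'_def m_def)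
  show ?thesis
  proof (rule Z.finite_awalks[OF finite_out_arcs_Zframed[OF assms(1)], of "\<lambda>(i, p). ht' i + (m + 1) * p"])
    fix e assume "e \<in> arcs (Zframed Q)"
    then consider e' p where "e = Inl (e', p)" "e' \<in> arcs (framed Q)" | e' p where "e = Inr (e', p)" "e' \<in> arcs (framed Q)"
      by (auto simp: repetition_def)
    then show "(case tail (Zframed Q) e of (i, p) \<Rightarrow> ht' i + (m + 1) * p) < (case head (Zframed Q) e of (i, p) \<Rightarrow> ht' i + (m + 1) * p)"
    proof cases
      case 1 then show ?thesis using fr by (simp add: repetition_def)
    next
      case 2 then show ?thesis
        using ht'(2)[of "head (framed Q) e'"] ht'(1)[of "tail (framed Q) e'"]
        by (simp add: repetition_def right_diff_distrib)
    qed
  qed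
qed

lemma free_module_fin_dim:
  assumes "field k" "finite X"
  shows "vectorspace k (free_module k X)" "vectorspace.fin_dim k (free_module k X)"
proof -
  interpret k: field k by fact
  have F: "module k (free_module k X)" by (rule free_module_module[OF k.is_cring])
  then show V: "vectorspace k (free_module k X)" by (simp add: vectorspace_def k.field_axioms)
  interpret vectorspace k "free_module k X" by fact
  let ?B = "basis_elt k ` X"
  have B: "?B \<subseteq> carrier (free_module k X)" using basis_elt_closed[OF k.is_cring] by auto
  have id: "(\<lambda>c. c) \<in> module_hom k (free_module k X) (free_module k X)" by (simp add: module_hom_def)
  have "c \<in> span ?B" if "c \<in> carrier (free_module k X)" for c
    by (rule free_hom_into[OF F id span_is_submodule[OF B] _ that]) (use in_own_span[OF B] in auto)
  then have "gen_set ?B" using span_is_subset2[OF B] by auto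
  then show "fin_dim" using B assms(2) unfolding fin_dim_def by blast
qed

text \<open>These morphism spaces are obtained from the span of the finitely many paths by passing to a
  quotient twice.\<close>

lemma Nakajima_C_homs_fin_dim:
  assumes k: "field k" and Q: "fin_digraph Q" and acyc: "\<nexists>p. pre_digraph.cycle Q p"
    and a: "a \<in> obj (Nakajima_C k Q C)" and b: "b \<in> obj (Nakajima_C k Q C)"
  shows "vectorspace.fin_dim k (homs (Nakajima_C k Q C) a b)"
proof -
  let ?P = "path_cat k (Zframed Q)" and ?N = "Nakajima k Q"
  have o: "obj ?N = obj ?P" "obj (Nakajima_C k Q C) = obj ?N"
    by (simp_all add: Nakajima_def Nakajima_C_def quot_cat_def)
  interpret I: k_ideal k ?P "mesh_ideal k Q" by (rule mesh_ideal_k_ideal[OF k Q])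
  have fr: "frozen Q - sigma_inv Q C \<subseteq> obj ?N"
    by (auto simp: Nakajima_def quot_cat_def path_cat_def repetition_def framed_def frozen_def)
  interpret J: k_ideal k ?N "ident_ideal k ?N (frozen Q - sigma_inv Q C)"
    by (rule ident_ideal_k_ideal[OF k_category_Nakajima[OF k Q] fr])
  have ab: "a \<in> obj ?P" "b \<in> obj ?P" "a \<in> obj ?N" "b \<in> obj ?N" using a b o by auto
  have P: "vectorspace.fin_dim k (homs ?P a b)"
    using free_module_fin_dim(2)[OF k finite_awalks_Zframed[OF Q acyc]] by (simp add: path_cat_sel)
  have N: "homs ?N a b = quot_module (homs ?P a b) (mesh_ideal k Q a b)"
    by (simp add: Nakajima_def quot_cat_def)
  have R: "homs (Nakajima_C k Q C) a b = quot_module (homs ?N a b) (ident_ideal k ?N (frozen Q - sigma_inv Q C) a b)"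
    by (simp add: Nakajima_C_def quot_cat_def)
  have "vectorspace.fin_dim k (homs ?N a b)"
    unfolding N by (rule dim_quotient(2)[OF I.hom_vs[OF ab(1,2)] P I.sub[OF ab(1,2)]])
  then show ?thesis
    unfolding R by (rule dim_quotient(2)[OF J.hom_vs[OF ab(3,4)] _ J.sub[OF ab(3,4)]])
qed

context kan_data
begin

text \<open>The symbols \<open>g \<otimes> m\<close> are bilinear, so those with \<open>g\<close> and \<open>m\<close> in finite generating sets suffice, and
  only finitely many objects \<open>s\<close> contribute.\<close>

lemma K_L_fin_dim:
  assumes homs: "\<And>x s. \<lbrakk>x \<in> obj C; s \<in> S\<rbrakk> \<Longrightarrow> vectorspace.fin_dim k (homs C x s)"
    and fM: "fin_dim_mod k (full_subcat C S) M" and x: "x \<in> obj C"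
  shows "vectorspace.fin_dim k (KL x)"
proof -
  interpret L: cat_module k C "K_L k C S M" by (rule K_L_cat_module)
  interpret KL: vectorspace k "KL x" by (rule L.space_vs[OF x])
  have Mvs: "vectorspace k (space M s)" if "s \<in> S" for s using cat_module.space_vs[OF M] that by simp
  have "\<forall>s\<in>S. \<exists>X. finite X \<and> X \<subseteq> carrier (homs C x s) \<and>
      LinearCombinations.module.span k (homs C x s) X = carrier (homs C x s)"
    using homs[OF x] vectorspace.fin_dim_def[OF hom_vs[OF x S_obj]] by auto
  from bchoice[OF this] obtain \<Gamma> where "\<forall>s\<in>S. finite (\<Gamma> s) \<and> \<Gamma> s \<subseteq> carrier (homs C x s) \<and>
      LinearCombinations.module.span k (homs C x s) (\<Gamma> s) = carrier (homs C x s)" by blast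
  then have \<Gamma>: "\<And>s. s \<in> S \<Longrightarrow> finite (\<Gamma> s)" "\<And>s. s \<in> S \<Longrightarrow> \<Gamma> s \<subseteq> carrier (homs C x s)"
    "\<And>s. s \<in> S \<Longrightarrow> LinearCombinations.module.span k (homs C x s) (\<Gamma> s) = carrier (homs C x s)" by simp_all
  have "\<forall>s\<in>S. \<exists>X. finite X \<and> X \<subseteq> carrier (space M s) \<and>
      LinearCombinations.module.span k (space M s) X = carrier (space M s)"
    using fM vectorspace.fin_dim_def[OF Mvs] by (auto simp: fin_dim_mod_def)
  from bchoice[OF this] obtain \<beta> where "\<forall>s\<in>S. finite (\<beta> s) \<and> \<beta> s \<subseteq> carrier (space M s) \<and>
      LinearCombinations.module.span k (space M s) (\<beta> s) = carrier (space M s)" by blast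
  then have \<beta>: "\<And>s. s \<in> S \<Longrightarrow> finite (\<beta> s)" "\<And>s. s \<in> S \<Longrightarrow> \<beta> s \<subseteq> carrier (space M s)"
    "\<And>s. s \<in> S \<Longrightarrow> LinearCombinations.module.span k (space M s) (\<beta> s) = carrier (space M s)" by simp_all
  define T where "T = {s \<in> S. carrier (space M s) \<noteq> {\<zero>\<^bsub>space M s\<^esub>}}"
  have T: "finite T" "T \<subseteq> S" using fM by (auto simp: T_def fin_dim_mod_def)
  define G where "G = (\<Union>s\<in>T. (\<lambda>(g, m). gen x (s, g, m)) ` (\<Gamma> s \<times> \<beta> s))"
  have "finite G" using T \<Gamma>(1) \<beta>(1) unfolding G_def by (intro finite_UN_I finite_imageI finite_cartesian_product) auto
  moreover have "G \<subseteq> carrier (KL x)"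
  proof
    fix z assume "z \<in> G"
    then obtain s g m where "s \<in> T" "g \<in> \<Gamma> s" "m \<in> \<beta> s" "z = gen x (s, g, m)" by (auto simp: G_def)
    then show "z \<in> carrier (KL x)" using gen_closed[OF x, of s g m] T(2) \<Gamma>(2)[of s] \<beta>(2)[of s] by blast
  qed
  ultimately have G: "finite G" "G \<subseteq> carrier (KL x)" by auto
  have W: "submodule k (KL.span G) (KL x)" by (rule KL.span_is_submodule[OF G(2)])
  interpret W: submodule k "KL.span G" "KL x" by (rule W)
  \<comment> \<open>Fix \<open>m\<close> in the generating set and let \<open>g\<close> vary, then fix an arbitrary \<open>g\<close> and let \<open>m\<close> vary.\<close>
  have gW: "gen x (s, g, m) \<in> KL.span G" if s: "s \<in> S" and g: "g \<in> carrier (homs C x s)" and m: "m \<in> carrier (space M s)" for s g m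
  proof (cases "s \<in> T")
    case False
    then have "m = \<zero>\<^bsub>space M s\<^esub>" using s m by (auto simp: T_def)
    then have "gen x (s, g, m) = \<zero>\<^bsub>KL x\<^esub>"
      using module_hom_zero[OF M_mod[OF s] KL_module[OF x] KL_balD(1)[OF gen_bal[OF x] s g]] by simp
    then show ?thesis by simp
  next
    case True
    have 1: "gen x (s, g, m) \<in> KL.span G" if m: "m \<in> \<beta> s" for m
    proof (rule span_into[OF hom_mod[OF x S_obj[OF s]] KL_module[OF x] KL_balD(2)[OF gen_bal[OF x] s] W \<Gamma>(2)[OF s]])
      show "m \<in> carrier (space M s)" using m \<beta>(2)[OF s] by auto
      show "g \<in> LinearCombinations.module.span k (homs C x s) (\<Gamma> s)" using g \<Gamma>(3)[OF s] by simp
      fix g' assume "g' \<in> \<Gamma> s"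
      then have "gen x (s, g', m) \<in> G" using True m by (auto simp: G_def)
      then show "gen x (s, g', m) \<in> KL.span G" using KL.in_own_span[OF G(2)] by blast
    qed
    show ?thesis
      by (rule span_into[OF M_mod[OF s] KL_module[OF x] KL_balD(1)[OF gen_bal[OF x] s g] W \<beta>(2)[OF s] 1])
        (use m \<beta>(3)[OF s] in auto)
  qed
  have id: "(\<lambda>z. z) \<in> module_hom k (pres k (KLX x) (KLR x)) (KL x)" by (simp add: KL_pres module_hom_def)
  have "carrier (KL x) \<subseteq> KL.span G"
  proof
    fix z assume z: "z \<in> carrier (KL x)"
    show "z \<in> KL.span G"
      by (rule pres_hom_into[OF KL_module[OF x] KL_rels_sub[OF x] id W _ z[unfolded KL_pres]])
        (use gW in \<open>auto simp: K_L_gens_def K_L_gen_def\<close>)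
  qed
  then have "KL.gen_set G" using W.subset by auto
  then show ?thesis using G unfolding KL.fin_dim_def by blast
qed

lemma K_LR_fin_dim:
  assumes homs: "\<And>x s. \<lbrakk>x \<in> obj C; s \<in> S\<rbrakk> \<Longrightarrow> vectorspace.fin_dim k (homs C x s)"
    and fM: "fin_dim_mod k (full_subcat C S) M" and x: "x \<in> obj C"
  shows "vectorspace.fin_dim k (space (K_LR k C S M) x)"
proof -
  interpret L: cat_module k C "K_L k C S M" by (rule K_L_cat_module)
  interpret LR: cat_module k C "K_LR k C S M" by (rule K_LR_cat_module)
  have sp: "space (K_LR k C S M) x = KR x\<lparr>carrier := K_can k C S M x ` carrier (KL x)\<rparr>"
    using x by (simp add: K_LR_def sub_mod_def K_LR_carrier_def)
  have "K_can k C S M x \<in> module_hom k (KL x) (space (K_LR k C S M) x)"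
    using K_can_module_hom[OF x] unfolding sp by (auto simp: module_hom_def)
  then interpret T: linear_map k "KL x" "space (K_LR k C S M) x" "K_can k C S M x"
    by (rule linear_mapI[OF L.space_vs[OF x] LR.space_vs[OF x]])
  show ?thesis
    by (rule T.rank_nullity_main(2)[OF K_L_fin_dim[OF homs fM x]]) (auto simp: sp)
qed

end


section \<open>The intermediate extension of a submodule\<close>

context kan_data
begin

lemma K_LR_space: "x \<in> obj C \<Longrightarrow> space (K_LR k C S M) x = KR x\<lparr>carrier := K_LR_carrier k C S M x\<rparr>"
  by (simp add: K_LR_def sub_mod_def)

lemma K_LR_carrier_sub: "x \<in> obj C \<Longrightarrow> K_LR_carrier k C S M x \<subseteq> carrier (KR x)"
  using K_LR_submod by (auto simp: is_submod_def dest: submodule.subset)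

lemma K_LR_module: "x \<in> obj C \<Longrightarrow> module k (space (K_LR k C S M) x)"
  using cat_module.space_vs[OF K_LR_cat_module] by (simp add: vectorspace_def)

text \<open>An element \<open>\<phi>\<close> of \<open>K\<^sub>R(M)(s)\<close> with \<open>s \<in> S\<close> is determined by its value at the identity, because
  \<open>\<phi>(g) = M(g)(\<phi>(1))\<close>; and by \<open>K_can_adjoint\<close> all values are attained on the image of \<open>K\<^sub>L(M)\<close>.\<close>

lemma K_LR_counit:
  assumes s: "s \<in> S"
  shows "K_R_counit C s \<in> module_hom k (space (K_LR k C S M) s) (space M s)"
    and "bij_betw (K_R_counit C s) (carrier (space (K_LR k C S M) s)) (carrier (space M s))"
proof -
  note sp = K_LR_space[OF S_obj[OF s]] and sub = K_LR_carrier_sub[OF S_obj[OF s]]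
  have h: "K_R_counit C s \<in> module_hom k (KR s) (space M s)"
    using K_R_counit_hom s by (simp add: cmod_hom_def)
  then show h': "K_R_counit C s \<in> module_hom k (space (K_LR k C S M) s) (space M s)"
    using subsetD[OF sub] unfolding sp by (auto simp: module_hom_def)
  have val: "\<phi> t g = act M t s g (K_R_counit C s \<phi>)"
    if "\<phi> \<in> carrier (KR s)" "t \<in> S" "g \<in> carrier (homs C t s)" for \<phi> t g
    using KR_memD(2)[OF that(1,2) s that(3) ident_closed[OF S_obj[OF s]]] ident_left[OF S_obj[OF that(2)] S_obj[OF s] that(3)]
    by (simp add: K_R_counit_def)
  have "inj_on (K_R_counit C s) (carrier (space (K_LR k C S M) s))"
  proof (rule inj_onI)
    fix \<phi> \<psi> assume p: "\<phi> \<in> carrier (space (K_LR k C S M) s)" "\<psi> \<in> carrier (space (K_LR k C S M) s)"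
      and e: "K_R_counit C s \<phi> = K_R_counit C s \<psi>"
    then have KR: "\<phi> \<in> carrier (KR s)" "\<psi> \<in> carrier (KR s)" using sub by (auto simp: sp)
    show "\<phi> = \<psi>" by (rule KR_eqI[OF KR]) (simp add: val[OF KR(1)] val[OF KR(2)] e)
  qed
  moreover have "carrier (space M s) \<subseteq> K_R_counit C s ` carrier (space (K_LR k C S M) s)"
  proof
    fix m assume m: "m \<in> carrier (space M s)"
    have "K_L_unit k C S M s m \<in> carrier (KL s)"
      unfolding K_L_unit_def by (rule gen_closed[OF S_obj[OF s] s ident_closed[OF S_obj[OF s]] m])
    then have "K_can k C S M s (K_L_unit k C S M s m) \<in> carrier (space (K_LR k C S M) s)"
      using s by (simp add: sp K_LR_carrier_def)
    then show "m \<in> K_R_counit C s ` carrier (space (K_LR k C S M) s)"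
      using K_can_adjoint[OF s m] by (metis image_eqI)
  qed
  ultimately show "bij_betw (K_R_counit C s) (carrier (space (K_LR k C S M) s)) (carrier (space M s))"
    using module_hom_in[OF h'] by (auto simp: bij_betw_def)
qed

end

text \<open>The argument takes place over an arbitrary linear category with a set of objects \<open>S\<close>. Below,
  \<open>L\<close> and \<open>L'\<close> are the intermediate extensions of \<open>M\<close> and of its submodule \<open>U\<close>, and \<open>Q\<close> is the module
  \<open>L / L'\<close>.\<close>

locale fibre_data = kan_data k C S M for k :: "'k ring" and C :: "('o, 'm, 'k) kcat" and S and M :: "('o, 'm, 'k, 'v) cmod" +
  fixes U :: "'o \<Rightarrow> 'v set"
  assumes k: "field k" and U: "is_submod k (full_subcat C S) M U"
    and fin: "\<And>x. x \<in> obj C \<Longrightarrow> vectorspace.fin_dim k (space (K_LR k C S M) x)"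
begin

sublocale U: kan_data k C S "sub_mod M U"
  by (rule kan_data.intro[OF k_category_axioms kan_data_axioms.intro[OF S sub_mod_cat_module[OF M U]]])

sublocale LR: cat_module k C "K_LR k C S M" by (rule K_LR_cat_module)

abbreviation "L x \<equiv> space (K_LR k C S M) x"
abbreviation "L' \<equiv> K_LR_carrier k C S (sub_mod M U)"
abbreviation "Q \<equiv> quot_mod (K_LR k C S M) L'"
abbreviation "proj x \<equiv> \<lambda>v. L' x +>\<^bsub>L x\<^esub> v"

lemma L'_sub: "x \<in> obj C \<Longrightarrow> submodule k (L' x) (L x)"
  using K_LR_mono[OF U] by (simp add: is_submod_def)

lemma L'_subset: "x \<in> obj C \<Longrightarrow> L' x \<subseteq> carrier (L x)"
  using submodule.subset[OF L'_sub] .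

lemma L'_space: "x \<in> obj C \<Longrightarrow> space (K_LR k C S (sub_mod M U)) x = L x\<lparr>carrier := L' x\<rparr>"
  by (simp add: K_LR_space U.K_LR_space) (simp add: K_R_def sub_mod_def)

lemma counit_L':
  assumes s: "s \<in> S" shows "K_R_counit C s ` L' s = U s"
  using bij_betw_imp_surj_on[OF U.K_LR_counit(2)[OF s]] s by (simp add: L'_space) (simp add: sub_mod_def)

lemma dim_L':
  assumes s: "s \<in> S" shows "dimv k (K_LR k C S (sub_mod M U)) s = dimv k (sub_mod M U) s"
proof -
  interpret ULR: cat_module k C "K_LR k C S (sub_mod M U)" by (rule U.K_LR_cat_module)
  have M': "vectorspace k (space (sub_mod M U) s)" using cat_module.space_vs[OF U.M] s by simp
  interpret T: linear_map k "space (K_LR k C S (sub_mod M U)) s" "space (sub_mod M U) s" "K_R_counit C s"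
    by (rule linear_mapI[OF ULR.space_vs[OF S_obj[OF s]] M' U.K_LR_counit(1)[OF s]])
  have "vectorspace.fin_dim k (space (K_LR k C S (sub_mod M U)) s)"
    unfolding L'_space[OF S_obj[OF s]]
    by (rule fin_dim_subspace[OF LR.space_vs[OF S_obj[OF s]] fin[OF S_obj[OF s]] L'_sub[OF S_obj[OF s]]])
  from T.dim_eq[OF this] show ?thesis
    using U.K_LR_counit(2)[OF s] by (simp add: bij_betw_def dimv_def)
qed

text \<open>The module \<open>L'\<close> is generated by its restriction to \<open>S\<close>: it is the image of \<open>K\<^sub>L(U)\<close>, whose generator
  \<open>g \<otimes> m\<close> is obtained by letting \<open>g\<close> act on \<open>1 \<otimes> m\<close>.\<close>

lemma L'_generated:
  assumes x: "x \<in> obj C" and W: "submodule k W (L x)"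
    and gen: "\<And>s g z. \<lbrakk>s \<in> S; g \<in> carrier (homs C x s); z \<in> L' s\<rbrakk> \<Longrightarrow> act (K_LR k C S M) x s g z \<in> W"
  shows "L' x \<subseteq> W"
proof
  fix z assume "z \<in> L' x"
  then obtain y where y: "y \<in> carrier (U.KL x)" "z = K_can k C S (sub_mod M U) x y"
    using x by (auto simp: K_LR_carrier_def)
  have KRops: "U.KR x = KR x\<lparr>carrier := carrier (U.KR x)\<rparr>" by (simp add: K_R_def sub_mod_def)
  have act: "act (K_LR k C S M) = act (K_R k C S (sub_mod M U))" by (simp add: K_LR_def K_R_def sub_mod_def)
  have im: "K_can k C S (sub_mod M U) x u \<in> carrier (L x)" if "u \<in> carrier (U.KL x)" for u
    using that subsetD[OF L'_subset[OF x], of "K_can k C S (sub_mod M U) x u"] x by (simp add: K_LR_carrier_def)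
  have "K_can k C S (sub_mod M U) x \<in> module_hom k (pres k (U.KLX x) (U.KLR x)) (L x)"
    using U.K_can_module_hom[OF x] im K_LR_space[OF x]
    by (subst (asm) KRops) (auto simp: module_hom_def U.KL_pres)
  from pres_hom_into[OF K_LR_module[OF x] U.KL_rels_sub[OF x] this W _ y(1)[unfolded U.KL_pres]]
  show "z \<in> W" unfolding y(2)
  proof -
    assume r: "(\<And>t. t \<in> U.KLX x \<Longrightarrow> K_can k C S (sub_mod M U) x (pres_gen k (U.KLX x) (U.KLR x) t) \<in> W)
      \<Longrightarrow> K_can k C S (sub_mod M U) x y \<in> W"
    show "K_can k C S (sub_mod M U) x y \<in> W"
    proof (rule r)
      fix t assume "t \<in> U.KLX x"
      then obtain s g m where t: "t = (s, g, m)" "s \<in> S" "g \<in> carrier (homs C x s)" "m \<in> carrier (space (sub_mod M U) s)"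
        by (auto simp: K_L_gens_def)
      let ?u = "K_L_unit k C S (sub_mod M U) s m"
      have u: "?u \<in> carrier (U.KL s)"
        unfolding K_L_unit_def by (rule U.gen_closed[OF S_obj[OF t(2)] t(2) ident_closed[OF S_obj[OF t(2)]] t(4)])
      have "K_can k C S (sub_mod M U) x (U.gen x t) = act (K_LR k C S M) x s g (K_can k C S (sub_mod M U) s ?u)"
        unfolding t(1) U.gen_unit[OF x t(2-4)] act
        using U.K_can_hom x t(2,3) u by (simp add: cmod_hom_def)
      moreover have "K_can k C S (sub_mod M U) s ?u \<in> L' s" using u t(2) by (simp add: K_LR_carrier_def)
      ultimately show "K_can k C S (sub_mod M U) x (pres_gen k (U.KLX x) (U.KLR x) t) \<in> W"
        using gen[OF t(2,3)] by (simp add: K_L_gen_def)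
    qed
  qed
qed

lemma Q_space: "space Q x = quot_module (L x) (L' x)"
  by (simp add: quot_mod_def)

lemma Q_vs: "x \<in> obj C \<Longrightarrow> vectorspace k (space Q x)" "x \<in> obj C \<Longrightarrow> vectorspace.fin_dim k (space Q x)"
  "x \<in> obj C \<Longrightarrow> dimv k Q x = dimv k (K_LR k C S M) x - dimv k (K_LR k C S (sub_mod M U)) x"
  using dim_quotient[OF LR.space_vs fin L'_sub] by (simp_all add: Q_space dimv_def L'_space)

lemma Q_module: "x \<in> obj C \<Longrightarrow> module k (space Q x)"
  using Q_vs(1) by (simp add: vectorspace_def)

lemma proj_hom: "x \<in> obj C \<Longrightarrow> proj x \<in> module_hom k (L x) (space Q x)"
  unfolding Q_space by (rule quot_proj_hom[OF K_LR_module L'_sub])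

lemma proj_surj: "proj x ` carrier (L x) = carrier (space Q x)"
  by (simp add: Q_space quot_carrier)

lemma proj_ker: "x \<in> obj C \<Longrightarrow> L' x = {v \<in> carrier (L x). proj x v = \<zero>\<^bsub>space Q x\<^esub>}"
  using quot_coset_zero_iff[OF K_LR_module L'_sub, of x] subsetD[OF L'_subset, of x] unfolding Q_space by blast

text \<open>The action on the quotient is defined as a union over a coset; this identifies it with the map
  induced by the action on \<open>L\<close>.\<close>

lemma Q_act:
  assumes a: "a \<in> obj C" and b: "b \<in> obj C" and f: "f \<in> carrier (homs C a b)"
  shows "v \<in> carrier (L b) \<Longrightarrow> act Q a b f (proj b v) = proj a (act (K_LR k C S M) a b f v)"
    and "act Q a b f \<in> module_hom k (space Q b) (space Q a)"
proof -
  let ?f = "act (K_LR k C S M) a b f"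
  have st: "?f v \<in> L' a" if "v \<in> L' b" for v
    using K_LR_mono[OF U] a b f that unfolding is_submod_def by blast
  have h: "(\<lambda>v. proj a (?f v)) \<in> module_hom k (L b) (space Q a)"
    by (rule module_hom_compose[OF LR.act_hom[OF a b f] proj_hom[OF a]])
  have "proj a (?f v) = \<zero>\<^bsub>space Q a\<^esub>" if "v \<in> L' b" for v
    using st[OF that] proj_ker[OF a] by auto
  from quot_factor[OF K_LR_module[OF b] L'_sub[OF b] Q_module[OF a] h this]
  obtain F where F: "F \<in> module_hom k (space Q b) (space Q a)" "\<And>v. v \<in> carrier (L b) \<Longrightarrow> F (proj b v) = proj a (?f v)"
    by (auto simp: Q_space)
  have eq: "act Q a b f (proj b v) = proj a (?f v)" if v: "v \<in> carrier (L b)" for v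
  proof -
    interpret B: abelian_subgroup "L' b" "L b" by (rule submodule_abelian_subgroup[OF K_LR_module[OF b] L'_sub[OF b]])
    have c: "proj a (?f w) = proj a (?f v)" if "w \<in> proj b v" for w
      using F(2)[of w] F(2)[OF v] B.a_repr_independence'[OF that v] B.a_elemrcos_carrier[OF v that] by simp
    have "act Q a b f (proj b v) = (\<Union>w\<in>proj b v. proj a (?f w))" by (simp add: quot_mod_def)
    also have "\<dots> = (\<Union>w\<in>proj b v. proj a (?f v))" by (rule SUP_cong) (simp_all add: c)
    also have "\<dots> = proj a (?f v)" using B.a_rcos_self[OF v] by (simp only: UN_constant) auto
    finally show ?thesis .
  qed
  then show "v \<in> carrier (L b) \<Longrightarrow> act Q a b f (proj b v) = proj a (?f v)" .
  interpret Qb: module k "space Q b" by (rule Q_module[OF b])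
  have "act Q a b f y = F y" if "y \<in> carrier (space Q b)" for y
    using that eq F(2) by (auto simp: proj_surj[symmetric])
  then show "act Q a b f \<in> module_hom k (space Q b) (space Q a)"
    using F(1) by (simp add: module_hom_def Pi_iff)
qed

end


section \<open>The fibre of the restriction map\<close>

lemma restrict_eq_iff: "restrict f X = restrict g X \<longleftrightarrow> (\<forall>x\<in>X. f x = g x)"
  by (auto simp: restrict_def fun_eq_iff)

context fibre_data begin

context
  fixes A :: "'r ring" and h :: "'k \<Rightarrow> 'r"
  assumes Ah: "k_algebra k A h"
begin

interpretation scalar_extension k A h
  using Ah k by (intro scalar_extension.intro) (auto simp: k_algebra_def field_def domain_def)

abbreviation "proj_ext x \<equiv> scal_map k A h (space Q x) (proj x)"

lemma ext_L_module: "x \<in> obj C \<Longrightarrow> module A (ext (L x))"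
  by (rule ext_module[OF K_LR_module])

lemma ext_Q_module: "x \<in> obj C \<Longrightarrow> module A (ext (space Q x))"
  by (rule ext_module[OF Q_module])

lemma proj_ext_hom: "x \<in> obj C \<Longrightarrow> proj_ext x \<in> module_hom A (ext (L x)) (ext (space Q x))"
  by (rule scal_map_hom(1)[OF K_LR_module Q_module proj_hom])

lemma proj_ext_surj: "x \<in> obj C \<Longrightarrow> proj_ext x ` carrier (ext (L x)) = carrier (ext (space Q x))"
  by (rule scal_map_surj[OF K_LR_module Q_module proj_hom proj_surj])

lemma proj_ext_ker: "x \<in> obj C \<Longrightarrow> {z \<in> carrier (ext (L x)). proj_ext x z = \<zero>\<^bsub>ext (space Q x)\<^esub>} = ext_sub (L x) (L' x)"
  by (rule scal_map_ker[OF K_LR_module Q_module proj_hom proj_surj proj_ker])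

lemma proj_ext_act:
  assumes a: "a \<in> obj C" and b: "b \<in> obj C" and f: "f \<in> carrier (homs C a b)" and z: "z \<in> carrier (ext (L b))"
  shows "scal_map k A h (space Q a) (act Q a b f) (proj_ext b z) = proj_ext a (scal_map k A h (L a) (act (K_LR k C S M) a b f) z)"
proof -
  note LL = K_LR_module[OF a] K_LR_module[OF b] and QQ = Q_module[OF a] Q_module[OF b]
  note pf = module_hom_compose[OF proj_hom[OF b] Q_act(2)[OF a b f]]
    and fp = module_hom_compose[OF LR.act_hom[OF a b f] proj_hom[OF a]]
  show ?thesis
    unfolding scal_map_compose[OF LL(2) QQ(2,1) proj_hom[OF b] Q_act(2)[OF a b f] z]
      scal_map_compose[OF LL(2,1) QQ(1) LR.act_hom[OF a b f] proj_hom[OF a] z]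
    by (rule scal_map_cong[OF LL(2) QQ(1) pf fp Q_act(1)[OF a b f] z])
qed

text \<open>The counit induces an injective map \<open>L(s) \<otimes> A \<rightarrow> M(s) \<otimes> A\<close>, and this map takes the image of
  \<open>L'(s) \<otimes> A\<close> onto the image of \<open>U(s) \<otimes> A\<close>.\<close>

lemma fibre_condition:
  assumes s: "s \<in> S" and N: "N \<subseteq> carrier (ext (L s))"
  shows "scal_map k A h (space M s) (K_R_counit C s) ` N = ext_sub (space M s) (U s) \<longleftrightarrow> N = ext_sub (L s) (L' s)"
proof -
  note o = S_obj[OF s]
  note c = K_LR_counit[OF s]
  have "inj_on (scal_map k A h (space M s) (K_R_counit C s)) (carrier (ext (L s)))"
    by (rule scal_map_inj[OF K_LR_module[OF o] M_mod[OF s] c])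
  moreover have "ext_sub (L s) (L' s) \<subseteq> carrier (ext (L s))"
    by (rule submodule.subset[OF ext_sub_submodule(1)[OF K_LR_module[OF o] L'_subset[OF o]]])
  moreover have "scal_map k A h (space M s) (K_R_counit C s) ` ext_sub (L s) (L' s) = ext_sub (space M s) (U s)"
    using scal_map_ext_sub[OF K_LR_module[OF o] M_mod[OF s] c(1) L'_subset[OF o]] counit_L'[OF s] by simp
  ultimately show ?thesis using N inj_on_image_eq_iff by metis
qed

text \<open>The \<open>z \<in> L(x)\<close> with \<open>z \<otimes> 1 \<in> N(x)\<close> form a subspace. Since \<open>N\<close> is stable under the action, this
  subspace contains everything that arises from the values of \<open>L'\<close> on \<open>S\<close>, hence all of \<open>L'(x)\<close>.\<close>

lemma fibre_contains_kernel:
  assumes sub: "\<And>a. a \<in> obj C \<Longrightarrow> submodule A (N a) (ext (L a))"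
    and st: "\<And>a b f. \<lbrakk>a \<in> obj C; b \<in> obj C; f \<in> carrier (homs C a b)\<rbrakk>
      \<Longrightarrow> scal_map k A h (L a) (act (K_LR k C S M) a b f) ` N b \<subseteq> N a"
    and fib: "\<And>s. s \<in> S \<Longrightarrow> N s = ext_sub (L s) (L' s)" and x: "x \<in> obj C"
  shows "ext_sub (L x) (L' x) \<subseteq> N x"
proof (rule ext_sub_least[OF K_LR_module[OF x] sub[OF x]])
  let ?W = "{z \<in> carrier (L x). tensor (L x) z \<in> N x}"
  have W: "submodule k ?W (L x)"
    by (rule submodule_preimage[OF K_LR_module[OF x] restrict_scalars_module[OF ext_L_module[OF x]]
          tensor_hom[OF K_LR_module[OF x]] restrict_scalars_submodule[OF sub[OF x]]])
  have "L' x \<subseteq> ?W"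
  proof (rule L'_generated[OF x W])
    fix s g z assume s: "s \<in> S" and g: "g \<in> carrier (homs C x s)" and z: "z \<in> L' s"
    note o = S_obj[OF s]
    have zL: "z \<in> carrier (L s)" using z L'_subset[OF o] by auto
    note f = LR.act_hom[OF x o g]
    have "tensor (L s) z \<in> N s"
      using fib[OF s] ext_sub_submodule(2)[OF K_LR_module[OF o] L'_subset[OF o]] z by auto
    then have "scal_map k A h (L x) (act (K_LR k C S M) x s g) (tensor (L s) z) \<in> N x"
      using st[OF x o g] by auto
    then have "tensor (L x) (act (K_LR k C S M) x s g z) \<in> N x"
      using scal_map_hom(2)[OF K_LR_module[OF o] K_LR_module[OF x] f zL] by simp
    then show "act (K_LR k C S M) x s g z \<in> ?W" using module_hom_in[OF f zL] by simp
  qed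
  then show "tensor (L x) ` L' x \<subseteq> N x" by auto
qed

lemma Gr_point_ext_sub:
  "Gr_point k (full_subcat C S) M U A h = (\<lambda>s\<in>S. ext_sub (space M s) (U s))"
  by (simp add: Gr_point_def ext_sub_def)

lemma fibre_pts:
  "N \<in> pts (kfun_fibre (quiver_Gr k C (K_LR k C S M) d) (Gr_res k C S M) (Gr_point k (full_subcat C S) M U)) A h \<longleftrightarrow>
    N \<in> pts (quiver_Gr k C (K_LR k C S M) d) A h \<and> (\<forall>s\<in>S. N s = ext_sub (L s) (L' s))"
proof -
  have "Gr_res k C S M A h N = (\<lambda>s\<in>S. ext_sub (space M s) (U s)) \<longleftrightarrow> (\<forall>s\<in>S. N s = ext_sub (L s) (L' s))"
    if N: "N \<in> pts (quiver_Gr k C (K_LR k C S M) d) A h"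
  proof -
    have "N s \<subseteq> carrier (ext (L s))" if "s \<in> S" for s
      using N that by (auto simp: quiver_Gr_def dest: submodule.subset)
    then have "(\<forall>s\<in>S. scal_map k A h (space M s) (K_R_counit C s) ` N s = ext_sub (space M s) (U s)) \<longleftrightarrow>
        (\<forall>s\<in>S. N s = ext_sub (L s) (L' s))"
      using fibre_condition by simp
    moreover have "Gr_res k C S M A h N = (\<lambda>s\<in>S. ext_sub (space M s) (U s)) \<longleftrightarrow>
        (\<forall>s\<in>S. scal_map k A h (space M s) (K_R_counit C s) ` N s = ext_sub (space M s) (U s))"
      unfolding Gr_res_def by (rule restrict_eq_iff)
    ultimately show ?thesis by simp
  qed
  then show ?thesis by (auto simp: kfun_fibre_def Gr_point_ext_sub)
qed

text \<open>Image and preimage under \<open>L \<otimes> A \<rightarrow> Q \<otimes> A\<close> are inverse to each other on submodules that contain the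
  kernel. That images satisfy the rank condition is additivity of dimensions; that preimages lie over \<open>U\<close>
  is the statement about quotients of full rank.\<close>

lemma fibre_bij:
  assumes d: "\<And>s. s \<in> S \<Longrightarrow> d s = dimv k (sub_mod M U) s"
  shows "bij_betw (\<lambda>N. \<lambda>x\<in>obj C. proj_ext x ` N x)
    (pts (kfun_fibre (quiver_Gr k C (K_LR k C S M) d) (Gr_res k C S M) (Gr_point k (full_subcat C S) M U)) A h)
    (pts (quiver_Gr k C Q (\<lambda>x. d x - dimv k (K_LR k C S (sub_mod M U)) x)) A h)"
    (is "bij_betw ?\<eta> ?X ?Y")
proof (rule bij_betw_byWitness[where f' = "\<lambda>P. \<lambda>x\<in>obj C. {z \<in> carrier (ext (L x)). proj_ext x z \<in> P x}"])
  let ?\<theta> = "\<lambda>P. \<lambda>x\<in>obj C. {z \<in> carrier (ext (L x)). proj_ext x z \<in> P x}"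
  have rank: "dimv k Q x - (d x - dimv k (K_LR k C S (sub_mod M U)) x) = dimv k (K_LR k C S M) x - d x" if "x \<in> obj C" for x
    using Q_vs(3)[OF that] by simp
  have X: "N \<in> extensional (obj C)" "\<And>a. a \<in> obj C \<Longrightarrow> submodule A (N a) (ext (L a))"
    "\<And>a. a \<in> obj C \<Longrightarrow> loc_free A (quot_module (ext (L a)) (N a)) (dimv k (K_LR k C S M) a - d a)"
    "\<And>a b f. \<lbrakk>a \<in> obj C; b \<in> obj C; f \<in> carrier (homs C a b)\<rbrakk> \<Longrightarrow> scal_map k A h (L a) (act (K_LR k C S M) a b f) ` N b \<subseteq> N a"
    "\<And>s. s \<in> S \<Longrightarrow> N s = ext_sub (L s) (L' s)"
    if "N \<in> ?X" for N
    using that unfolding fibre_pts by (auto simp: quiver_Gr_def)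
  have Y: "P \<in> extensional (obj C)" "\<And>a. a \<in> obj C \<Longrightarrow> submodule A (P a) (ext (space Q a))"
    "\<And>a. a \<in> obj C \<Longrightarrow> loc_free A (quot_module (ext (space Q a)) (P a)) (dimv k (K_LR k C S M) a - d a)"
    "\<And>a b f. \<lbrakk>a \<in> obj C; b \<in> obj C; f \<in> carrier (homs C a b)\<rbrakk> \<Longrightarrow> scal_map k A h (space Q a) (act Q a b f) ` P b \<subseteq> P a"
    if "P \<in> ?Y" for P
    using that rank unfolding quiver_Gr_def by auto
  have sat: "{z \<in> carrier (ext (L x)). proj_ext x z \<in> proj_ext x ` N x} = N x" if N: "N \<in> ?X" and x: "x \<in> obj C" for N x
    using fibre_contains_kernel[OF X(2)[OF N] X(4)[OF N] X(5)[OF N] x]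
    by (intro preimage_of_image[OF ext_L_module[OF x] ext_Q_module[OF x] proj_ext_hom[OF x] X(2)[OF N x]]) (simp add: proj_ext_ker[OF x])
  show "\<forall>N\<in>?X. ?\<theta> (?\<eta> N) = N"
  proof
    fix N assume N: "N \<in> ?X"
    show "?\<theta> (?\<eta> N) = N"
      by (rule extensionalityI[OF restrict_extensional X(1)[OF N]]) (use sat[OF N] in simp)
  qed
  show "\<forall>P\<in>?Y. ?\<eta> (?\<theta> P) = P"
  proof
    fix P assume P: "P \<in> ?Y"
    show "?\<eta> (?\<theta> P) = P"
    proof (rule extensionalityI[OF restrict_extensional Y(1)[OF P]])
      fix x assume x: "x \<in> obj C"
      have "P x \<subseteq> proj_ext x ` carrier (ext (L x))"
        using submodule.subset[OF Y(2)[OF P x]] proj_ext_surj[OF x] by simp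
      then show "?\<eta> (?\<theta> P) x = P x" using x by auto
    qed
  qed
  show "?\<eta> ` ?X \<subseteq> ?Y"
  proof
    fix P assume "P \<in> ?\<eta> ` ?X"
    then obtain N where N: "N \<in> ?X" and P: "P = ?\<eta> N" by blast
    have sub: "submodule A (proj_ext a ` N a) (ext (space Q a))" if "a \<in> obj C" for a
      by (rule submodule_image[OF ext_L_module[OF that] ext_Q_module[OF that] proj_ext_hom[OF that] X(2)[OF N that]])
    have lf: "loc_free A (quot_module (ext (space Q a)) (proj_ext a ` N a)) (dimv k (K_LR k C S M) a - d a)" if a: "a \<in> obj C" for a
      using loc_free_quotient_preimage[OF ext_L_module[OF a] ext_Q_module[OF a] proj_ext_hom[OF a] proj_ext_surj[OF a] sub[OF a]] X(3)[OF N a]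
      by (simp add: sat[OF N a])
    have st: "scal_map k A h (space Q a) (act Q a b f) ` proj_ext b ` N b \<subseteq> proj_ext a ` N a"
      if o: "a \<in> obj C" "b \<in> obj C" "f \<in> carrier (homs C a b)" for a b f
    proof clarify
      fix z assume z: "z \<in> N b"
      then have "z \<in> carrier (ext (L b))" using submodule.subset[OF X(2)[OF N o(2)]] by auto
      then show "scal_map k A h (space Q a) (act Q a b f) (proj_ext b z) \<in> proj_ext a ` N a"
        using proj_ext_act[OF o] X(4)[OF N o] z by auto
    qed
    have "loc_free A (quot_module (ext (space Q a)) (proj_ext a ` N a))
        (dimv k Q a - (d a - dimv k (K_LR k C S (sub_mod M U)) a))" if "a \<in> obj C" for a
      using lf[OF that] by (simp only: rank[OF that])
    then show "P \<in> ?Y" unfolding P quiver_Gr_def using sub st by simp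
  qed
  show "?\<theta> ` ?Y \<subseteq> ?X"
  proof
    fix N assume "N \<in> ?\<theta> ` ?Y"
    then obtain P where P: "P \<in> ?Y" and N: "N = ?\<theta> P" by blast
    let ?N = "\<lambda>x. {z \<in> carrier (ext (L x)). proj_ext x z \<in> P x}"
    have sub: "submodule A (?N a) (ext (L a))" if "a \<in> obj C" for a
      by (rule submodule_preimage[OF ext_L_module[OF that] ext_Q_module[OF that] proj_ext_hom[OF that] Y(2)[OF P that]])
    have lf: "loc_free A (quot_module (ext (L a)) (?N a)) (dimv k (K_LR k C S M) a - d a)" if a: "a \<in> obj C" for a
      using loc_free_quotient_preimage[OF ext_L_module[OF a] ext_Q_module[OF a] proj_ext_hom[OF a] proj_ext_surj[OF a] Y(2)[OF P a]] Y(3)[OF P a] by simp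
    have st: "scal_map k A h (L a) (act (K_LR k C S M) a b f) ` ?N b \<subseteq> ?N a"
      if o: "a \<in> obj C" "b \<in> obj C" "f \<in> carrier (homs C a b)" for a b f
    proof clarify
      fix z assume z: "z \<in> carrier (ext (L b))" "proj_ext b z \<in> P b"
      have "scal_map k A h (L a) (act (K_LR k C S M) a b f) z \<in> carrier (ext (L a))"
        by (rule module_hom_in[OF scal_map_hom(1)[OF K_LR_module[OF o(2)] K_LR_module[OF o(1)] LR.act_hom[OF o]] z(1)])
      moreover have "proj_ext a (scal_map k A h (L a) (act (K_LR k C S M) a b f) z) \<in> P a"
        using proj_ext_act[OF o z(1)] Y(4)[OF P o] z(2) by auto
      ultimately show "scal_map k A h (L a) (act (K_LR k C S M) a b f) z \<in> carrier (ext (L a)) \<and>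
        proj_ext a (scal_map k A h (L a) (act (K_LR k C S M) a b f) z) \<in> P a" by simp
    qed
    \<comment> \<open>The rank prescribed at \<open>s\<close> is the full dimension of \<open>Q(s)\<close>, which forces \<open>P(s)\<close> to be zero.\<close>
    have fib: "?N s = ext_sub (L s) (L' s)" if s: "s \<in> S" for s
    proof -
      note o = S_obj[OF s]
      have "dimv k (K_LR k C S M) s - d s = int (vectorspace.dim k (space Q s))"
        using Q_vs(3)[OF o] d[OF s] dim_L'[OF s] by (simp add: dimv_def)
      then have "P s = {\<zero>\<^bsub>ext (space Q s)\<^esub>}"
        using full_rank_quotient_ext[OF Q_vs(1,2)[OF o] Y(2)[OF P o]] Y(3)[OF P o] by simp
      then show ?thesis using proj_ext_ker[OF o] by simp
    qed
    show "N \<in> ?X" unfolding fibre_pts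
      unfolding N quiver_Gr_def using sub lf st fib by simp
  qed
qed

end

theorem fibre_iso:
  fixes d :: "'o \<Rightarrow> int"
  assumes d: "\<And>s. s \<in> S \<Longrightarrow> d s = dimv k (sub_mod M U) s"
  shows "kfun_iso k
    (kfun_fibre (quiver_Gr k C (K_LR k C S M) d :: ('k, 'r, _) kfun) (Gr_res k C S M) (Gr_point k (full_subcat C S) M U))
    (quiver_Gr k C Q (\<lambda>x. d x - dimv k (K_LR k C S (sub_mod M U)) x))"
    (is "kfun_iso k ?X ?Y")
  unfolding kfun_iso_def
proof (intro exI[of _ "\<lambda>A h N. \<lambda>x\<in>obj C. scal_map k A h (space Q x) (proj x) ` N x"] conjI allI impI ballI)
  fix A :: "'r ring" and h assume "k_algebra k A h"
  then show "bij_betw (\<lambda>N. \<lambda>x\<in>obj C. scal_map k A h (space Q x) (proj x) ` N x) (pts ?X A h) (pts ?Y A h)"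
    using d by (rule fibre_bij)
next
  fix A :: "'r ring" and h B h' \<phi> N
  assume AB: "k_algebra k A h \<and> k_algebra k B h'" and \<phi>: "\<phi> \<in> k_alg_hom k A h B h'" and N: "N \<in> pts ?X A h"
  interpret scalar_change k A h B h' \<phi>
    using AB k \<phi> by (intro scalar_change.intro scalar_extension.intro scalar_change_axioms.intro)
      (auto simp: k_algebra_def field_def domain_def)
  have Ns: "N x \<subseteq> carrier (A.ext (L x))" if "x \<in> obj C" for x
    using N that by (auto simp: kfun_fibre_def quiver_Gr_def dest: submodule.subset)
  show "(\<lambda>x\<in>obj C. scal_map k B h' (space Q x) (proj x) ` pull ?X A h B h' \<phi> N x)
      = pull ?Y A h B h' \<phi> (\<lambda>x\<in>obj C. scal_map k A h (space Q x) (proj x) ` N x)"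
  proof (rule extensionalityI[of _ "obj C"])
    fix x assume x: "x \<in> obj C"
    show "(\<lambda>x\<in>obj C. scal_map k B h' (space Q x) (proj x) ` pull ?X A h B h' \<phi> N x) x
      = pull ?Y A h B h' \<phi> (\<lambda>x\<in>obj C. scal_map k A h (space Q x) (proj x) ` N x) x"
      using span_change_natural[OF K_LR_module[OF x] Q_module[OF x] proj_hom[OF x] Ns[OF x]] x
      by (simp add: kfun_fibre_def quiver_Gr_def)
  qed (simp_all add: quiver_Gr_def)
qed

end

text \<open>For the Nakajima categories the two inputs of \<open>fibre_iso\<close> are the finite-dimensionality of \<open>K\<^sub>L\<^sub>R(M)\<close>
  and the equality of \<open>(v, w)\<close> with the dimension vector of \<open>U\<close> on \<open>S\<close>. The latter holds because \<open>S\<close>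
  consists of frozen vertices, where \<open>v\<close> vanishes.\<close>

theorem theorem3p13:
  fixes k :: "'k ring"
    and Q :: "('v, 'e) pre_digraph"
    and C :: "('v \<times> int) set"
    and M :: "('v nvert, (('v, 'e) npath \<Rightarrow> 'k) set set, 'k, 'm) cmod"
    and v w :: "'v nvert \<Rightarrow> nat"
    and U :: "'v nvert \<Rightarrow> 'm set"
  defines "RC \<equiv> Nakajima_C k Q C"
    and "SC \<equiv> Nakajima_S k Q C"
    and "S \<equiv> sigma_inv Q C"
  assumes "field k"
    and "fin_digraph Q" and "\<nexists>p. pre_digraph.cycle Q p"
    and "C \<subseteq> verts (repetition Q)" and "assumption_E k Q C"
    and "cat_module k SC M" and "fin_dim_mod k SC M"
    and "rigid k RC (K_LR k RC S M)"
    and "finite {x. v x \<noteq> 0}" and "{x. v x \<noteq> 0} \<subseteq> nonfrozen Q"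
    and "finite {x. w x \<noteq> 0}" and "{x. w x \<noteq> 0} \<subseteq> S"
    and "is_submod k SC M U" and "\<forall>s\<in>S. dimv k (sub_mod M U) s = int (w s)"
  shows "kfun_iso k
    (kfun_fibre
      (quiver_Gr k RC (K_LR k RC S M) (\<lambda>x. int (v x) + int (w x)) :: ('k, 'r, _) kfun)
      (Gr_res k RC S M)
      (Gr_point k SC M U))
    (quiver_Gr k RC (quot_mod (K_LR k RC S M) (K_LR_carrier k RC S (sub_mod M U)))
      (\<lambda>x. int (v x) + int (w x) - dimv k (K_LR k RC S (sub_mod M U)) x))"
proof -
  have SC: "SC = full_subcat RC S" by (simp add: RC_def SC_def S_def Nakajima_S_def)
  interpret kan_data k RC S M
    unfolding RC_def S_def by (rule kan_data_Nakajima[OF assms(4,5)]) (use assms(9) in \<open>simp add: SC_def\<close>)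
  interpret fibre_data k RC S M U
  proof (intro fibre_data.intro fibre_data_axioms.intro)
    show "vectorspace.fin_dim k (space (K_LR k RC S M) x)" if "x \<in> obj RC" for x
    proof (rule K_LR_fin_dim[OF _ _ that])
      show "vectorspace.fin_dim k (homs RC y s)" if "y \<in> obj RC" "s \<in> S" for y s
        using Nakajima_C_homs_fin_dim[OF assms(4-6)] that S_obj[OF that(2)] by (simp add: RC_def)
    qed (use assms(10) in \<open>simp add: SC\<close>)
    show "is_submod k (full_subcat RC S) M U" using assms(16) by (simp add: SC)
  qed (rule assms(4) kan_data_axioms)+
  have vS: "v s = 0" if "s \<in> S" for s
  proof (rule ccontr)
    assume "v s \<noteq> 0"
    then have "s \<in> nonfrozen Q" using assms(13) by auto
    then show False using that by (auto simp: S_def sigma_inv_def nonfrozen_def nu_sigma_def map_prod_def)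
  qed
  show ?thesis
    unfolding SC by (rule fibre_iso) (use vS assms(17) in simp)
qed

end
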